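(* Let $x=w\varepsilon^\mu$ and $x'=w'\varepsilon^{\mu'}$ be elements of $\widetilde W$ and let $(v,J_1,\dots,J_m)$ be a Bruhat-deciding datum for $x$. Then $x\le x'$ in the Bruhat order if and only if for every $i=1,\dots,m$ there exists $v_i'\in W$ with $$v^{-1}\mu+\mathrm{wt}(v_i'\Rightarrow v)+\mathrm{wt}(wv\Rightarrow w'v_i')\le (v_i')^{-1}\mu'\pmod{\Phi_{J_i}^\vee}.$$
   Context: Let $\Phi$ be a reduced crystallographic finite root system with fixed basis $\Delta$, positive roots $\Phi^+$, negative roots $\Phi^-=-\Phi^+$, Weyl group $W$ and $2\rho=\sum_{\beta\in\Phi^+}\beta$. For $\alpha\in\Phi$, $\alpha^\vee$ is its coroot and $s_\alpha$ its reflection; $\ell$ on $W$ is the Coxeter length with respect to $\{s_\alpha:\alpha\in\Delta\}$. Let $X_*$ be an abelian group containing the coroot lattice $\mathbb Z\Phi^\vee$, with a bilinear pairing $\langle\cdot,\cdot\rangle:X_*\times\mathbb Z\Phi\to\mathbb Z$ extending the natural coroot–root pairing; $W$ acts on $X_*$ by $s_\alpha(\mu)=\mu-\langle\mu,\alpha\rangle\alpha^\vee$. For $\mu,\mu'\in X_*$ write $\mu\le\mu'$ if $\mu'-\mu$ is a $\mathbb Z_{\ge0}$-linear combination of positive coroots. For $J\subseteq\Delta$, $\Phi_J$ is the root subsystem generated by $J$, and $\mu\le\mu'\pmod{\Phi_J^\vee}$ means $\mu'-\mu\in\mathbb Z_{\ge0}\{\beta^\vee:\beta\in\Phi^+\}+\mathbb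 Z\Phi_J^\vee$. Write $\Phi^+(\alpha)=1$ if $\alpha\in\Phi^+$ and $\Phi^+(\alpha)=0$ if $\alpha\in\Phi^-$. The extended affine Weyl group is $\widetilde W=W\ltimes X_*$; its elements are written $w\varepsilon^\mu$ with $\varepsilon^\mu w=w\varepsilon^{w^{-1}\mu}$. Affine roots are $\Phi_{\mathrm{af}}=\Phi\times\mathbb Z$, with action $(w\varepsilon^\mu)(\alpha,k)=(w\alpha,k-\langle\mu,\alpha\rangle)$; $\Phi_{\mathrm{af}}^+=\{(\alpha,k):k\ge\Phi^+(-\alpha)\}$, $\Phi_{\mathrm{af}}^-=\Phi_{\mathrm{af}}\setminus\Phi_{\mathrm{af}}^+$. Length $\ell(x)=\#\{a\in\Phi^+_{\mathrm{af}}:xa\in\Phi^-_{\mathrm{af}}\}$. Affine reflection $r_{(\alpha,k)}=s_\alpha\varepsilon^{k\alpha^\vee}$. The Bruhat order on $\widetilde W$ is the partial order generated by $x<xr_a$ for $a\in\Phi_{\mathrm{af}}$ with $\ell(x)<\ell(xr_a)$. For $x=w\varepsilon^\mu$ and $\alpha\in\Phi$ the length functional is $\ell(x,\alpha)=\langle\mu,\alpha\rangle+\Phi^+(\alpha)-\Phi^+(w\alpha)$, and $\mathrm{LP}(x)=\{v\in W:\ell(x,v\alpha)\ge0\text{ for all }\alpha\in\Phi^+\}$. A Bruhat-deciding datum for $x$ is a tuple $(v,J_1,\dots,J_m)$ with $m\ge1$, $v\in W$, $J_i\subseteq\Delta$, such that $v\in\mathrm{LP}(x)$ and, with $J=J_1\cap\dots\cap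 J_m$, $\ell(x,v\alpha)=0$ for all $\alpha\in\Phi_J$. The quantum Bruhat graph $\mathrm{QB}(W)$ has vertex set $W$ and an edge $w\to ws_\alpha$ ($\alpha\in\Phi^+$) whenever $\ell(ws_\alpha)=\ell(w)+1$ (Bruhat edge, weight $0$) or $\ell(ws_\alpha)=\ell(w)+1-\langle\alpha^\vee,2\rho\rangle$ (quantum edge, weight $\alpha^\vee$). It is known that $\mathrm{QB}(W)$ is strongly connected and that all shortest paths from $w$ to $w'$ have the same weight (sum of edge weights), denoted $\mathrm{wt}(w\Rightarrow w')$. *)

theory Defs
  imports "HOL-Analysis.Analysis"
begin

inductive_set zspan :: "'a::real_vector set \<Rightarrow> 'a set" for S where
  zspan_zero: "0 \<in> zspan S"
| zspan_add: "v \<in> zspan S \<Longrightarrow> a \<in> S \<Longrightarrow> v + a \<in> zspan S"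
| zspan_diff: "v \<in> zspan S \<Longrightarrow> a \<in> S \<Longrightarrow> v - a \<in> zspan S"

inductive_set nspan :: "'a::real_vector set \<Rightarrow> 'a set" for S where
  nspan_zero: "0 \<in> nspan S"
| nspan_add: "v \<in> nspan S \<Longrightarrow> a \<in> S \<Longrightarrow> v + a \<in> nspan S"

definition refl :: "'a::euclidean_space \<Rightarrow> 'a \<Rightarrow> 'a" where
  "refl \<alpha> v = v - (2 * (v \<bullet> \<alpha>) / (\<alpha> \<bullet> \<alpha>)) *\<^sub>R \<alpha>"

definition coroot :: "'a::euclidean_space \<Rightarrow> 'a" where
  "coroot \<alpha> = (2 / (\<alpha> \<bullet> \<alpha>)) *\<^sub>R \<alpha>"

definition root_system :: "'a::euclidean_space set \<Rightarrow> bool" where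
  "root_system R \<longleftrightarrow> finite R \<and> 0 \<notin> R
     \<and> (\<forall>\<alpha>\<in>R. \<forall>\<beta>\<in>R. refl \<alpha> \<beta> \<in> R)
     \<and> (\<forall>\<alpha>\<in>R. \<forall>\<beta>\<in>R. coroot \<alpha> \<bullet> \<beta> \<in> \<int>)
     \<and> (\<forall>\<alpha>\<in>R. \<forall>c::real. c *\<^sub>R \<alpha> \<in> R \<longrightarrow> c = 1 \<or> c = -1)"

definition root_basis :: "'a::euclidean_space set \<Rightarrow> 'a set \<Rightarrow> bool" where
  "root_basis R \<Delta> \<longleftrightarrow> \<Delta> \<subseteq> R \<and> independent \<Delta>
     \<and> (\<forall>\<beta>\<in>R. \<exists>c::'a \<Rightarrow> int. ((\<forall>\<alpha>\<in>\<Delta>. c \<alpha> \<ge> 0) \<or> (\<forall>\<alpha>\<in>\<Delta>. c \<alpha> \<le> 0))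
                 \<and> \<beta> = (\<Sum>\<alpha>\<in>\<Delta>. of_int (c \<alpha>) *\<^sub>R \<alpha>))"

definition pos_roots :: "'a::euclidean_space set \<Rightarrow> 'a set \<Rightarrow> 'a set" where
  "pos_roots R \<Delta> = {\<beta>\<in>R. \<exists>c::'a \<Rightarrow> int. (\<forall>\<alpha>\<in>\<Delta>. c \<alpha> \<ge> 0)
                 \<and> \<beta> = (\<Sum>\<alpha>\<in>\<Delta>. of_int (c \<alpha>) *\<^sub>R \<alpha>)}"

definition ind_pos :: "'a::euclidean_space set \<Rightarrow> 'a set \<Rightarrow> 'a \<Rightarrow> int" where
  "ind_pos R \<Delta> \<alpha> = (if \<alpha> \<in> pos_roots R \<Delta> then 1 else 0)"

definition sub_roots :: "'a::euclidean_space set \<Rightarrow> 'a set \<Rightarrow> 'a set" where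
  "sub_roots R J = R \<inter> span J"

definition rword :: "'a::euclidean_space list \<Rightarrow> 'a \<Rightarrow> 'a" where
  "rword as = foldr (\<lambda>\<alpha> f. refl \<alpha> \<circ> f) as id"

definition weyl :: "'a::euclidean_space set \<Rightarrow> ('a \<Rightarrow> 'a) set" where
  "weyl R = {rword as | as. set as \<subseteq> R}"

definition wlen :: "'a::euclidean_space set \<Rightarrow> ('a \<Rightarrow> 'a) \<Rightarrow> nat" where
  "wlen \<Delta> w = (LEAST n. \<exists>as. set as \<subseteq> \<Delta> \<and> length as = n \<and> w = rword as)"

text \<open>X_* is an abelian group 'x; emb embeds the coroot lattice (a lattice in 'a)
  into X_*, and pair is the pairing X_* \<times> Z\<Phi> \<rightarrow> Z.\<close>
definition cochar_datum :: "'a::euclidean_space set \<Rightarrow> ('a \<Rightarrow> 'x::ab_group_add)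
     \<Rightarrow> ('x \<Rightarrow> 'a \<Rightarrow> int) \<Rightarrow> bool" where
  "cochar_datum R emb pair \<longleftrightarrow>
     (\<forall>l\<in>zspan (coroot ` R). \<forall>\<nu>\<in>zspan (coroot ` R). emb (l + \<nu>) = emb l + emb \<nu>)
   \<and> inj_on emb (zspan (coroot ` R))
   \<and> (\<forall>\<mu> \<nu>. \<forall>\<beta>\<in>zspan R. pair (\<mu> + \<nu>) \<beta> = pair \<mu> \<beta> + pair \<nu> \<beta>)
   \<and> (\<forall>\<mu>. \<forall>\<beta>\<in>zspan R. \<forall>\<gamma>\<in>zspan R. pair \<mu> (\<beta> + \<gamma>) = pair \<mu> \<beta> + pair \<mu> \<gamma>)
   \<and> (\<forall>l\<in>zspan (coroot ` R). \<forall>\<beta>\<in>zspan R. real_of_int (pair (emb l) \<beta>) = l \<bullet> \<beta>)"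

definition xrefl :: "('a::euclidean_space \<Rightarrow> 'x::ab_group_add) \<Rightarrow> ('x \<Rightarrow> 'a \<Rightarrow> int)
     \<Rightarrow> 'a \<Rightarrow> 'x \<Rightarrow> 'x" where
  "xrefl emb pair \<alpha> \<mu> = \<mu> - emb (real_of_int (pair \<mu> \<alpha>) *\<^sub>R coroot \<alpha>)"

definition xact :: "'a::euclidean_space set \<Rightarrow> ('a \<Rightarrow> 'x::ab_group_add) \<Rightarrow> ('x \<Rightarrow> 'a \<Rightarrow> int)
     \<Rightarrow> ('a \<Rightarrow> 'a) \<Rightarrow> 'x \<Rightarrow> 'x" where
  "xact R emb pair w \<mu> =
     foldr (xrefl emb pair) (SOME as. set as \<subseteq> R \<and> w = rword as) \<mu>"

definition leq_mod :: "'a::euclidean_space set \<Rightarrow> 'a set \<Rightarrow> ('a \<Rightarrow> 'x::ab_group_add)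
     \<Rightarrow> 'a set \<Rightarrow> 'x \<Rightarrow> 'x \<Rightarrow> bool" where
  "leq_mod R \<Delta> emb J \<mu> \<mu>' \<longleftrightarrow>
     (\<exists>l1 l2. l1 \<in> nspan (coroot ` pos_roots R \<Delta>) \<and> l2 \<in> zspan (coroot ` sub_roots R J)
        \<and> \<mu>' - \<mu> = emb (l1 + l2))"

text \<open>An element (w, mu) stands for w \<epsilon>^mu.\<close>
type_synonym ('a, 'x) eaw = "('a \<Rightarrow> 'a) \<times> 'x"

definition eaw_mult :: "'a::euclidean_space set \<Rightarrow> ('a \<Rightarrow> 'x::ab_group_add) \<Rightarrow> ('x \<Rightarrow> 'a \<Rightarrow> int)
     \<Rightarrow> ('a, 'x) eaw \<Rightarrow> ('a, 'x) eaw \<Rightarrow> ('a, 'x) eaw" where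
  "eaw_mult R emb pair x y =
     (fst x \<circ> fst y, xact R emb pair (inv (fst y)) (snd x) + snd y)"

definition af_act :: "('x \<Rightarrow> 'a::euclidean_space \<Rightarrow> int) \<Rightarrow> ('a, 'x) eaw \<Rightarrow> 'a \<times> int \<Rightarrow> 'a \<times> int" where
  "af_act pair x a = (fst x (fst a), snd a - pair (snd x) (fst a))"

definition af_pos :: "'a::euclidean_space set \<Rightarrow> 'a set \<Rightarrow> 'a \<times> int \<Rightarrow> bool" where
  "af_pos R \<Delta> a \<longleftrightarrow> fst a \<in> R \<and> snd a \<ge> ind_pos R \<Delta> (- fst a)"

definition af_len :: "'a::euclidean_space set \<Rightarrow> 'a set \<Rightarrow> ('x \<Rightarrow> 'a \<Rightarrow> int) \<Rightarrow> ('a, 'x) eaw \<Rightarrow> nat" where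
  "af_len R \<Delta> pair x = card {a \<in> R \<times> UNIV. af_pos R \<Delta> a \<and> \<not> af_pos R \<Delta> (af_act pair x a)}"

definition af_refl :: "('a::euclidean_space \<Rightarrow> 'x) \<Rightarrow> 'a \<times> int \<Rightarrow> ('a, 'x) eaw" where
  "af_refl emb a = (refl (fst a), emb (real_of_int (snd a) *\<^sub>R coroot (fst a)))"

definition bruhat_step :: "'a::euclidean_space set \<Rightarrow> 'a set \<Rightarrow> ('a \<Rightarrow> 'x::ab_group_add)
     \<Rightarrow> ('x \<Rightarrow> 'a \<Rightarrow> int) \<Rightarrow> ('a, 'x) eaw \<Rightarrow> ('a, 'x) eaw \<Rightarrow> bool" where
  "bruhat_step R \<Delta> emb pair x y \<longleftrightarrow> fst x \<in> weyl R \<and>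
     (\<exists>a \<in> R \<times> UNIV. y = eaw_mult R emb pair x (af_refl emb a)
                     \<and> af_len R \<Delta> pair x < af_len R \<Delta> pair y)"

definition bruhat_le :: "'a::euclidean_space set \<Rightarrow> 'a set \<Rightarrow> ('a \<Rightarrow> 'x::ab_group_add)
     \<Rightarrow> ('x \<Rightarrow> 'a \<Rightarrow> int) \<Rightarrow> ('a, 'x) eaw \<Rightarrow> ('a, 'x) eaw \<Rightarrow> bool" where
  "bruhat_le R \<Delta> emb pair = (bruhat_step R \<Delta> emb pair)\<^sup>*\<^sup>*"

definition len_fun :: "'a::euclidean_space set \<Rightarrow> 'a set \<Rightarrow> ('x \<Rightarrow> 'a \<Rightarrow> int)
     \<Rightarrow> ('a, 'x) eaw \<Rightarrow> 'a \<Rightarrow> int" where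
  "len_fun R \<Delta> pair x \<alpha> = pair (snd x) \<alpha> + ind_pos R \<Delta> \<alpha> - ind_pos R \<Delta> (fst x \<alpha>)"

definition LP :: "'a::euclidean_space set \<Rightarrow> 'a set \<Rightarrow> ('x \<Rightarrow> 'a \<Rightarrow> int)
     \<Rightarrow> ('a, 'x) eaw \<Rightarrow> ('a \<Rightarrow> 'a) set" where
  "LP R \<Delta> pair x = {v \<in> weyl R. \<forall>\<alpha>\<in>pos_roots R \<Delta>. len_fun R \<Delta> pair x (v \<alpha>) \<ge> 0}"

definition bruhat_deciding :: "'a::euclidean_space set \<Rightarrow> 'a set \<Rightarrow> ('x \<Rightarrow> 'a \<Rightarrow> int)
     \<Rightarrow> ('a, 'x) eaw \<Rightarrow> ('a \<Rightarrow> 'a) \<Rightarrow> 'a set list \<Rightarrow> bool" where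
  "bruhat_deciding R \<Delta> pair x v Js \<longleftrightarrow> Js \<noteq> [] \<and> (\<forall>J\<in>set Js. J \<subseteq> \<Delta>)
     \<and> v \<in> LP R \<Delta> pair x
     \<and> (\<forall>\<alpha>\<in>sub_roots R (\<Inter>(set Js)). len_fun R \<Delta> pair x (v \<alpha>) = 0)"

definition two_rho_pair :: "'a::euclidean_space set \<Rightarrow> 'a set \<Rightarrow> 'a \<Rightarrow> real" where
  "two_rho_pair R \<Delta> \<alpha> = (\<Sum>\<beta>\<in>pos_roots R \<Delta>. coroot \<alpha> \<bullet> \<beta>)"

definition qb_bruhat_edge :: "'a::euclidean_space set \<Rightarrow> 'a set \<Rightarrow> ('a \<Rightarrow> 'a) \<Rightarrow> 'a \<Rightarrow> bool" where
  "qb_bruhat_edge R \<Delta> w \<alpha> \<longleftrightarrow> \<alpha> \<in> pos_roots R \<Delta> \<and> wlen \<Delta> (w \<circ> refl \<alpha>) = wlen \<Delta> w + 1"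

definition qb_quantum_edge :: "'a::euclidean_space set \<Rightarrow> 'a set \<Rightarrow> ('a \<Rightarrow> 'a) \<Rightarrow> 'a \<Rightarrow> bool" where
  "qb_quantum_edge R \<Delta> w \<alpha> \<longleftrightarrow> \<alpha> \<in> pos_roots R \<Delta> \<and>
     real (wlen \<Delta> (w \<circ> refl \<alpha>)) = real (wlen \<Delta> w) + 1 - two_rho_pair R \<Delta> \<alpha>"

definition qb_edge :: "'a::euclidean_space set \<Rightarrow> 'a set \<Rightarrow> ('a \<Rightarrow> 'a) \<Rightarrow> 'a \<Rightarrow> bool" where
  "qb_edge R \<Delta> w \<alpha> \<longleftrightarrow> qb_bruhat_edge R \<Delta> w \<alpha> \<or> qb_quantum_edge R \<Delta> w \<alpha>"

definition qb_edge_wt :: "'a::euclidean_space set \<Rightarrow> 'a set \<Rightarrow> ('a \<Rightarrow> 'a) \<Rightarrow> 'a \<Rightarrow> 'a" where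
  "qb_edge_wt R \<Delta> w \<alpha> = (if qb_quantum_edge R \<Delta> w \<alpha> then coroot \<alpha> else 0)"

fun qb_path :: "'a::euclidean_space set \<Rightarrow> 'a set \<Rightarrow> ('a \<Rightarrow> 'a) \<Rightarrow> 'a list \<Rightarrow> ('a \<Rightarrow> 'a) \<Rightarrow> bool" where
  "qb_path R \<Delta> w [] w' \<longleftrightarrow> w = w'"
| "qb_path R \<Delta> w (\<alpha> # as) w' \<longleftrightarrow> qb_edge R \<Delta> w \<alpha> \<and> qb_path R \<Delta> (w \<circ> refl \<alpha>) as w'"

fun qb_path_wt :: "'a::euclidean_space set \<Rightarrow> 'a set \<Rightarrow> ('a \<Rightarrow> 'a) \<Rightarrow> 'a list \<Rightarrow> 'a" where
  "qb_path_wt R \<Delta> w [] = 0"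
| "qb_path_wt R \<Delta> w (\<alpha> # as) = qb_edge_wt R \<Delta> w \<alpha> + qb_path_wt R \<Delta> (w \<circ> refl \<alpha>) as"

definition qb_dist :: "'a::euclidean_space set \<Rightarrow> 'a set \<Rightarrow> ('a \<Rightarrow> 'a) \<Rightarrow> ('a \<Rightarrow> 'a) \<Rightarrow> nat" where
  "qb_dist R \<Delta> w w' = (LEAST n. \<exists>as. length as = n \<and> qb_path R \<Delta> w as w')"

text \<open>wt(w \<Rightarrow> w'): weight of a shortest path (all shortest paths have the same weight).\<close>
definition qb_wt :: "'a::euclidean_space set \<Rightarrow> 'a set \<Rightarrow> ('a \<Rightarrow> 'a) \<Rightarrow> ('a \<Rightarrow> 'a) \<Rightarrow> 'a" where
  "qb_wt R \<Delta> w w' = qb_path_wt R \<Delta> w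
     (SOME as. qb_path R \<Delta> w as w' \<and> length as = qb_dist R \<Delta> w w')"

end

theory Submission
  imports Defs
begin

text \<open>Elements of the extended affine Weyl group act linearly on affine roots, and \<open>z \<circ> arefl a\<close> is
  above \<open>z\<close> in the Bruhat order when \<open>a\<close> and \<open>z a\<close> are positive. Requiring instead that the finite
  part of \<open>a\<close> is positive gives the semi-infinite order, whose coverings are the edges of the quantum
  Bruhat graph; since left multiplication by a simple affine reflection raises or lowers elements
  compatibly with this order, \<open>u \<epsilon>\<^sup>m\<close> is below \<open>u' \<epsilon>\<^sup>n\<close> exactly if \<open>m + wt(u \<Rightarrow> u') \<le> n\<close>. The criterion
  thus asks for some \<open>z'\<close> semi-infinitely below \<open>v\<close> such that \<open>x v\<close> is below \<open>x' z'\<close> modulo \<open>\<Phi>\<^sub>J\<^sup>\<or>\<close>.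

  A single Bruhat step from \<open>x\<close> to \<open>x r\<^sub>a\<close> satisfies it, with \<open>z' = v\<close> or \<open>z' = r\<^sub>a v\<close>. Conversely, the
  elements \<open>x' z'\<close> have a greatest one, so a single \<open>z'\<close> serves all \<open>J\<^sub>i\<close> and hence their
  intersection \<open>J\<close>. By the choice of \<open>v\<close>, after passing to minimal coset representatives for \<open>J\<close>
  and translating on the right by a coweight \<open>\<nu>\<close> orthogonal to \<open>J\<close> and very dominant elsewhere,
  both semi-infinite relations become Bruhat relations \<open>x c \<le> x' c'\<close> and \<open>c' \<le> c\<close> in which
  \<open>\<ell>(x c) = \<ell>(x) + \<ell>(c)\<close>; cancelling \<open>c\<close> and \<open>c'\<close> one simple reflection at a time gives \<open>x \<le> x'\<close>.\<close>

section \<open>Coroots, lattices and root systems\<close>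

text \<open>The group \<open>X_*\<close> may have torsion, and it may contain no coweight that
  vanishes exactly on a given parabolic subsystem. The combinatorics therefore takes place in a
  Euclidean model \<open>G\<close>, whose translation parts are all vectors pairing integrally with
  the roots. Only the coset \<open>\<mu> + emb Q\<close> is carried over at the end, since
  reflections move a cocharacter by a combination of coroots. All orders are read off from signs: an
  affine root is positive iff its value at a fixed interior point of the fundamental alcove is.
  Coverings defined through length would be hard to control under left multiplication. A covering is
  instead defined by the absence of other affine roots in between, a condition that simple
  reflections respect up to one explicit exception; a count later identifies coverings with edges of
  the quantum Bruhat graph. The conditions for several \<open>J\<close> can be intersected only for
  one fixed vector, because the argument compares its coefficients on simple coroots; this is what
  the greatest element \<open>z0\<close>, replacing all the \<open>v'\<close>, achieves.\<close>

lemma coroot_scale: "(v \<bullet> coroot \<alpha>) *\<^sub>R \<alpha> = (v \<bullet> \<alpha>) *\<^sub>R coroot \<alpha>"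
  by (simp add: coroot_def)

lemma refl_coroot: "refl \<alpha> v = v - (v \<bullet> coroot \<alpha>) *\<^sub>R \<alpha>"
  by (simp add: refl_def coroot_def)

lemma refl_coroot': "refl \<alpha> v = v - (v \<bullet> \<alpha>) *\<^sub>R coroot \<alpha>"
  by (simp add: refl_coroot coroot_scale)

lemma linear_refl: "linear (refl \<alpha>)"
  by (rule linearI) (simp_all add: refl_coroot inner_add_left algebra_simps)

lemma coroot_inner_self: "\<alpha> \<noteq> 0 \<Longrightarrow> \<alpha> \<bullet> coroot \<alpha> = 2"
  by (simp add: coroot_def)

lemma refl_self: "refl \<alpha> \<alpha> = - \<alpha>"
  by (cases "\<alpha> = 0") (simp_all add: refl_coroot coroot_inner_self scaleR_2)

lemma refl_inner: "refl \<alpha> u \<bullet> refl \<alpha> v = u \<bullet> v"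
  by (cases "\<alpha> = 0")
    (auto simp: refl_def inner_diff_left inner_diff_right inner_commute field_simps)

lemma refl_refl [simp]: "refl \<alpha> (refl \<alpha> v) = v"
  by (cases "\<alpha> = 0") (simp_all add: refl_coroot inner_diff_left coroot_inner_self scaleR_2)

lemma refl_o_refl [simp]: "refl \<alpha> \<circ> refl \<alpha> = id"
  by auto

lemma refl_uminus: "refl (- \<alpha>) = refl \<alpha>"
  by (rule ext) (simp add: refl_def)

lemma coroot_uminus [simp]: "coroot (- \<alpha>) = - coroot \<alpha>"
  by (simp add: coroot_def)

lemma rword_Nil [simp]: "rword [] = id"
  and rword_Cons [simp]: "rword (\<alpha> # as) = refl \<alpha> \<circ> rword as"
  by (simp_all add: rword_def)

lemma rword_append: "rword (as @ bs) = rword as \<circ> rword bs"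
  by (induction as) (simp_all add: o_assoc)

lemma rword_linear: "linear (rword as)"
proof (induction as)
  case (Cons \<alpha> as)
  show ?case unfolding rword_Cons by (rule linear_compose[OF Cons linear_refl])
qed (simp add: linear_iff)

lemma rword_inner: "rword as u \<bullet> rword as v = u \<bullet> v"
  by (induction as) (simp_all add: refl_inner)

lemma rword_rev: "rword (rev as) \<circ> rword as = id"
proof (induction as)
  case (Cons \<alpha> as)
  then show ?case by (simp add: rword_append fun_eq_iff)
qed simp

lemma rword_rev': "rword as \<circ> rword (rev as) = id"
  using rword_rev[of "rev as"] by simp

lemma nspan_plus: assumes "x \<in> nspan S" "y \<in> nspan S" shows "x + y \<in> nspan S"
  using assms(2,1)
  by (induction y rule: nspan.induct) (auto simp: add.assoc[symmetric] intro: nspan.intros)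

lemma zspan_plus: assumes "x \<in> zspan S" "y \<in> zspan S" shows "x + y \<in> zspan S"
  using assms(2,1)
  by (induction y rule: zspan.induct)
    (auto simp: add.assoc[symmetric] add_diff_eq intro: zspan.intros)

lemma zspan_uminus: "x \<in> zspan S \<Longrightarrow> - x \<in> zspan S"
proof (induction x rule: zspan.induct)
  case (zspan_add v a)
  then show ?case using zspan.zspan_diff[of "-v" S a] by simp
next
  case (zspan_diff v a)
  then show ?case using zspan.zspan_add[of "-v" S a] by (simp add: algebra_simps)
qed (auto intro: zspan.intros)

lemma zspan_minus: "x \<in> zspan S \<Longrightarrow> y \<in> zspan S \<Longrightarrow> x - y \<in> zspan S"
  using zspan_plus[of x S "-y"] zspan_uminus[of y S] by simp

lemma nspan_base: "a \<in> S \<Longrightarrow> a \<in> nspan S"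
  using nspan_add[OF nspan_zero, of a S] by simp

lemma zspan_base: "a \<in> S \<Longrightarrow> a \<in> zspan S"
  using zspan_add[OF zspan_zero, of a S] by simp

lemma nspan_nat: "x \<in> nspan S \<Longrightarrow> of_nat n *\<^sub>R x \<in> nspan S"
  by (induction n) (auto simp: algebra_simps intro: nspan.intros nspan_plus)

lemma zspan_int: assumes "x \<in> zspan S" shows "of_int k *\<^sub>R x \<in> zspan S"
proof -
  have "of_nat n *\<^sub>R x \<in> zspan S" for n
    by (induction n) (use assms in \<open>auto simp: algebra_simps intro: zspan.intros zspan_plus\<close>)
  then show ?thesis
    by (cases k rule: int_cases2) (auto dest: zspan_uminus)
qed

lemma nspan_mono: "x \<in> nspan S \<Longrightarrow> S \<subseteq> T \<Longrightarrow> x \<in> nspan T"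
  by (induction x rule: nspan.induct) (auto intro: nspan.intros)

lemma zspan_mono: "x \<in> zspan S \<Longrightarrow> S \<subseteq> T \<Longrightarrow> x \<in> zspan T"
  by (induction x rule: zspan.induct) (auto intro: zspan.intros)

lemma nspan_sub_zspan: "x \<in> nspan S \<Longrightarrow> x \<in> zspan S"
  by (induction x rule: nspan.induct) (auto intro: zspan.intros)

lemma nspan_nspan: "x \<in> nspan S \<Longrightarrow> S \<subseteq> nspan T \<Longrightarrow> x \<in> nspan T"
  by (induction x rule: nspan.induct) (auto intro: nspan.intros nspan_plus)

lemma zspan_zspan: "x \<in> zspan S \<Longrightarrow> S \<subseteq> zspan T \<Longrightarrow> x \<in> zspan T"
  by (induction x rule: zspan.induct) (auto intro: zspan.intros zspan_plus zspan_minus)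

lemma nspan_sum: "(\<And>i. i \<in> I \<Longrightarrow> f i \<in> nspan S) \<Longrightarrow> sum f I \<in> nspan S"
  by (induction I rule: infinite_finite_induct) (auto intro: nspan.intros nspan_plus)

lemma zspan_sum: "(\<And>i. i \<in> I \<Longrightarrow> f i \<in> zspan S) \<Longrightarrow> sum f I \<in> zspan S"
  by (induction I rule: infinite_finite_induct) (auto intro: zspan.intros zspan_plus)

lemma independent_dual:
  fixes B :: "'a::euclidean_space set"
  assumes "independent B"
  obtains d where "\<And>a b. a \<in> B \<Longrightarrow> b \<in> B \<Longrightarrow> d a \<bullet> b = (if a = b then 1 else 0)"
proof -
  obtain e :: 'a where e: "e \<in> Basis" using nonempty_Basis by blast
  have "\<exists>u. \<forall>b\<in>B. u \<bullet> b = (if a = b then 1 else 0)" for a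
  proof -
    obtain f :: "'a \<Rightarrow> 'a" where f: "linear f" "\<And>b. b \<in> B \<Longrightarrow> f b = (if a = b then e else 0)"
      using linear_independent_extend[OF assms, where f="\<lambda>b. if a = b then e else 0"] by blast
    have "adjoint f e \<bullet> b = e \<bullet> f b" for b
      using adjoint_works[OF f(1), of b e] by (simp add: inner_commute)
    with f(2) e show ?thesis by (intro exI[of _ "adjoint f e"]) (auto simp: inner_Basis)
  qed
  then show thesis using that by metis
qed

locale root_datum =
  fixes R \<Delta> :: "'a::euclidean_space set"
  assumes rs: "root_system R" and rb: "root_basis R \<Delta>"
begin

abbreviation "W \<equiv> weyl R"
abbreviation "Pos \<equiv> pos_roots R \<Delta>"

lemma finR: "finite R" and zero_R: "0 \<notin> R"
  and refl_R: "\<alpha> \<in> R \<Longrightarrow> \<beta> \<in> R \<Longrightarrow> refl \<alpha> \<beta> \<in> R"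
  and coroot_int': "\<alpha> \<in> R \<Longrightarrow> \<beta> \<in> R \<Longrightarrow> coroot \<alpha> \<bullet> \<beta> \<in> \<int>"
  and reduced: "\<alpha> \<in> R \<Longrightarrow> c *\<^sub>R \<alpha> \<in> R \<Longrightarrow> c = 1 \<or> c = -1"
  using rs unfolding root_system_def by blast+

lemma coroot_int: "\<alpha> \<in> R \<Longrightarrow> \<beta> \<in> R \<Longrightarrow> \<beta> \<bullet> coroot \<alpha> \<in> \<int>"
  using coroot_int' by (simp add: inner_commute)

lemma DR: "\<Delta> \<subseteq> R" and indD: "independent \<Delta>"
  using rb unfolding root_basis_def by blast+

lemma finD: "finite \<Delta>" using DR finR finite_subset by blast

lemma uminus_R: "\<alpha> \<in> R \<Longrightarrow> - \<alpha> \<in> R"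
  using refl_R[of \<alpha> \<alpha>] by (simp add: refl_self)

lemma uminus_R_iff [simp]: "- \<alpha> \<in> R \<longleftrightarrow> \<alpha> \<in> R"
  using uminus_R[of \<alpha>] uminus_R[of "-\<alpha>"] by auto

lemma coroot_self: "\<alpha> \<in> R \<Longrightarrow> \<alpha> \<bullet> coroot \<alpha> = 2"
  using zero_R by (intro coroot_inner_self) auto

lemma weyl_rword: "w \<in> W \<Longrightarrow> \<exists>as. set as \<subseteq> R \<and> w = rword as"
  by (auto simp: weyl_def)

lemma W_linear: "w \<in> W \<Longrightarrow> linear w"
  using weyl_rword rword_linear by blast

lemma W_inner: "w \<in> W \<Longrightarrow> w u \<bullet> w v = u \<bullet> v"
  using weyl_rword rword_inner by metis

lemma W_id: "id \<in> W"
  unfolding weyl_def by (auto intro: exI[of _ "[]"])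

lemma W_refl: "\<alpha> \<in> R \<Longrightarrow> refl \<alpha> \<in> W"
  unfolding weyl_def by (auto intro!: exI[of _ "[\<alpha>]"])

lemma W_comp: assumes "u \<in> W" "v \<in> W" shows "u \<circ> v \<in> W"
proof -
  from assms obtain as bs where "set as \<subseteq> R" "set bs \<subseteq> R" "u = rword as" "v = rword bs"
    using weyl_rword by metis
  then show ?thesis unfolding weyl_def by (auto intro!: exI[of _ "as @ bs"] simp: rword_append)
qed

lemma W_inv_ex: assumes "w \<in> W" shows "bij w" "inv w \<in> W"
proof -
  from assms obtain as where as: "set as \<subseteq> R" "w = rword as" using weyl_rword by blast
  show "bij w" using rword_rev[of as] rword_rev'[of as] as(2) o_bij by metis
  have "inv w = rword (rev as)" using rword_rev[of as] rword_rev'[of as] as(2)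
    by (metis inv_unique_comp)
  with as show "inv w \<in> W" by (auto simp: weyl_def intro!: exI[of _ "rev as"])
qed

lemma W_inv_l: "w \<in> W \<Longrightarrow> inv w (w p) = p" and W_inv_r: "w \<in> W \<Longrightarrow> w (inv w p) = p"
  using W_inv_ex(1) by (simp_all add: bij_is_inj bij_is_surj surj_f_inv_f)

lemma W_inv_comp: "w \<in> W \<Longrightarrow> inv w \<circ> w = id" "w \<in> W \<Longrightarrow> w \<circ> inv w = id"
  by (auto simp: W_inv_l W_inv_r)

lemma W_R: "w \<in> W \<Longrightarrow> \<alpha> \<in> R \<Longrightarrow> w \<alpha> \<in> R"
proof -
  have "set as \<subseteq> R \<Longrightarrow> \<alpha> \<in> R \<Longrightarrow> rword as \<alpha> \<in> R" for as
    by (induction as) (auto intro: refl_R)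
  then show "w \<in> W \<Longrightarrow> \<alpha> \<in> R \<Longrightarrow> w \<alpha> \<in> R" using weyl_rword by metis
qed

lemma W_inner_inv: "w \<in> W \<Longrightarrow> u \<bullet> w v = inv w u \<bullet> v"
  using W_inner[of "inv w" u "w v"] W_inv_ex by (simp add: W_inv_l)

lemma W_uminus: "w \<in> W \<Longrightarrow> w (- v) = - w v"
  using W_linear linear_neg by blast

lemma W_scale: "w \<in> W \<Longrightarrow> w (c *\<^sub>R v) = c *\<^sub>R w v"
  using W_linear linear_cmul by blast

lemma W_add: "w \<in> W \<Longrightarrow> w (u + v) = w u + w v"
  using W_linear linear_add by blast

lemma W_diff: "w \<in> W \<Longrightarrow> w (u - v) = w u - w v"
  using W_linear linear_diff by blast

lemma W_coroot: "w \<in> W \<Longrightarrow> w (coroot \<alpha>) = coroot (w \<alpha>)"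
  by (simp add: coroot_def W_scale W_inner)

text \<open>Fundamental coweights, determined only up to vectors orthogonal to all roots.\<close>

definition fd :: "'a \<Rightarrow> 'a" where
  "fd = (SOME d. \<forall>a\<in>\<Delta>. \<forall>b\<in>\<Delta>. d a \<bullet> b = (if a = b then 1 else 0))"

lemma fd: "a \<in> \<Delta> \<Longrightarrow> b \<in> \<Delta> \<Longrightarrow> fd a \<bullet> b = (if a = b then 1 else 0)"
proof -
  have "\<exists>d. \<forall>a\<in>\<Delta>. \<forall>b\<in>\<Delta>. d a \<bullet> b = (if a = b then 1 else (0::real))"
    using independent_dual[OF indD] by metis
  from someI_ex[OF this] show "a \<in> \<Delta> \<Longrightarrow> b \<in> \<Delta> \<Longrightarrow> fd a \<bullet> b = (if a = b then 1 else 0)"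
    unfolding fd_def by blast
qed

lemma fd_sum: "a \<in> \<Delta> \<Longrightarrow> fd a \<bullet> (\<Sum>b\<in>\<Delta>. f b *\<^sub>R b) = f a"
  using finD by (simp add: inner_sum_right fd if_distrib[of "\<lambda>x. _ * x"] sum.delta cong: sum.cong if_cong)

lemma root_expand: assumes "\<beta> \<in> R"
  shows "\<beta> = (\<Sum>a\<in>\<Delta>. (fd a \<bullet> \<beta>) *\<^sub>R a)" (is ?A)
    and "a \<in> \<Delta> \<Longrightarrow> fd a \<bullet> \<beta> \<in> \<int>" (is "_ \<Longrightarrow> ?B")
    and "(\<forall>a\<in>\<Delta>. fd a \<bullet> \<beta> \<ge> 0) \<or> (\<forall>a\<in>\<Delta>. fd a \<bullet> \<beta> \<le> 0)" (is ?C)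
proof -
  obtain c :: "'a \<Rightarrow> int" where c: "(\<forall>\<alpha>\<in>\<Delta>. c \<alpha> \<ge> 0) \<or> (\<forall>\<alpha>\<in>\<Delta>. c \<alpha> \<le> 0)"
    "\<beta> = (\<Sum>\<alpha>\<in>\<Delta>. of_int (c \<alpha>) *\<^sub>R \<alpha>)" using rb assms unfolding root_basis_def by blast
  have e: "fd a \<bullet> \<beta> = of_int (c a)" if "a \<in> \<Delta>" for a
    unfolding c(2) by (rule fd_sum[OF that])
  show ?A using c(2) e by (metis (no_types, lifting) sum.cong)
  show "a \<in> \<Delta> \<Longrightarrow> ?B" by (simp add: e)
  show ?C using c(1) by (auto simp: e)
qed

lemma Pos_iff: "\<beta> \<in> Pos \<longleftrightarrow> \<beta> \<in> R \<and> (\<forall>a\<in>\<Delta>. fd a \<bullet> \<beta> \<ge> 0)"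
proof
  assume "\<beta> \<in> Pos"
  then obtain c :: "'a \<Rightarrow> int" where c: "\<beta> \<in> R" "\<forall>\<alpha>\<in>\<Delta>. c \<alpha> \<ge> 0"
    "\<beta> = (\<Sum>\<alpha>\<in>\<Delta>. of_int (c \<alpha>) *\<^sub>R \<alpha>)" unfolding pos_roots_def by blast
  have "fd a \<bullet> \<beta> = of_int (c a)" if "a \<in> \<Delta>" for a
    unfolding c(3) by (rule fd_sum[OF that])
  with c show "\<beta> \<in> R \<and> (\<forall>a\<in>\<Delta>. fd a \<bullet> \<beta> \<ge> 0)" by simp
next
  assume b: "\<beta> \<in> R \<and> (\<forall>a\<in>\<Delta>. fd a \<bullet> \<beta> \<ge> 0)"
  have "\<forall>a\<in>\<Delta>. \<lfloor>fd a \<bullet> \<beta>\<rfloor> \<ge> 0" using b by auto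
  moreover have "\<beta> = (\<Sum>a\<in>\<Delta>. of_int \<lfloor>fd a \<bullet> \<beta>\<rfloor> *\<^sub>R a)"
  proof -
    have "(\<Sum>a\<in>\<Delta>. of_int \<lfloor>fd a \<bullet> \<beta>\<rfloor> *\<^sub>R a) = (\<Sum>a\<in>\<Delta>. (fd a \<bullet> \<beta>) *\<^sub>R a)"
      using root_expand(2) b by (intro sum.cong) auto
    then show ?thesis using root_expand(1) b by metis
  qed
  ultimately show "\<beta> \<in> Pos" using b unfolding pos_roots_def by (auto intro!: exI[of _ "\<lambda>a. \<lfloor>fd a \<bullet> \<beta>\<rfloor>"])
qed

text \<open>On a root this vector takes the height, so its sign tells positive roots from negative
  ones.\<close>

definition p1 :: 'a where "p1 = (\<Sum>a\<in>\<Delta>. fd a)"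

lemma p1_root: assumes "\<beta> \<in> R" shows "\<beta> \<bullet> p1 \<noteq> 0" "\<beta> \<in> Pos \<longleftrightarrow> \<beta> \<bullet> p1 > 0"
proof -
  have e: "\<beta> \<bullet> p1 = (\<Sum>a\<in>\<Delta>. fd a \<bullet> \<beta>)" by (simp add: p1_def inner_sum_right inner_commute)
  have nz: "\<exists>a\<in>\<Delta>. fd a \<bullet> \<beta> \<noteq> 0"
  proof (rule ccontr)
    assume "\<not> ?thesis"
    then have "\<beta> = 0" using root_expand(1)[OF assms] by simp
    with assms zero_R show False by simp
  qed
  have pos: "\<beta> \<bullet> p1 > 0" if "\<forall>a\<in>\<Delta>. fd a \<bullet> \<beta> \<ge> 0"
    unfolding e using that nz finD by (metis (no_types, lifting) order_le_less sum_nonneg sum_pos2)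
  have neg: "\<beta> \<bullet> p1 < 0" if "\<forall>a\<in>\<Delta>. fd a \<bullet> \<beta> \<le> 0"
  proof -
    have "(\<Sum>a\<in>\<Delta>. - (fd a \<bullet> \<beta>)) > 0"
      using that nz finD by (metis (no_types, lifting) neg_0_less_iff_less neg_0_le_iff_le order_le_less sum_pos2 order_less_le)
    then show ?thesis unfolding e by (simp add: sum_negf)
  qed
  show "\<beta> \<bullet> p1 \<noteq> 0" using pos neg root_expand(3)[OF assms] by fastforce
  show "\<beta> \<in> Pos \<longleftrightarrow> \<beta> \<bullet> p1 > 0" using pos neg root_expand(3)[OF assms] assms unfolding Pos_iff by fastforce
qed

text \<open>The scaling puts the point inside the fundamental alcove: root values become smaller
  than 1 in absolute value. The summand 1 keeps the denominator positive and the bound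
  strict.\<close>

definition p0 :: 'a where "p0 = (1 / (1 + (\<Sum>\<beta>\<in>R. \<bar>\<beta> \<bullet> p1\<bar>))) *\<^sub>R p1"

lemma p0_root: assumes "\<beta> \<in> R"
  shows "\<beta> \<bullet> p0 \<noteq> 0" "\<beta> \<in> Pos \<longleftrightarrow> \<beta> \<bullet> p0 > 0" "\<bar>\<beta> \<bullet> p0\<bar> < 1"
proof -
  let ?s = "1 + (\<Sum>\<beta>\<in>R. \<bar>\<beta> \<bullet> p1\<bar>)"
  have s: "?s > 0" by (simp add: add_pos_nonneg sum_nonneg)
  have "\<bar>\<beta> \<bullet> p1\<bar> \<le> (\<Sum>\<beta>\<in>R. \<bar>\<beta> \<bullet> p1\<bar>)"
    using assms finR by (intro member_le_sum) auto
  then have "\<bar>\<beta> \<bullet> p1\<bar> < ?s" by simp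
  with s show "\<bar>\<beta> \<bullet> p0\<bar> < 1" by (simp add: p0_def abs_divide)
  show "\<beta> \<bullet> p0 \<noteq> 0" "\<beta> \<in> Pos \<longleftrightarrow> \<beta> \<bullet> p0 > 0"
    using p1_root[OF assms] s by (simp_all add: p0_def zero_less_divide_iff)
qed

lemma Pos_R: "\<alpha> \<in> Pos \<Longrightarrow> \<alpha> \<in> R" by (simp add: Pos_iff)

lemma finPos: "finite Pos"
  using finR finite_subset[of Pos R] Pos_R by blast

lemma Pos_uminus: "\<alpha> \<in> R \<Longrightarrow> - \<alpha> \<in> Pos \<longleftrightarrow> \<alpha> \<notin> Pos"
  using p0_root[of \<alpha>] p0_root[of "-\<alpha>"] by auto

lemma D_Pos: "\<Delta> \<subseteq> Pos"
  using DR by (auto simp: Pos_iff fd)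

text \<open>The product of the two Cartan integers is 4 times a squared cosine, so it is less than 4
  unless the roots are proportional, in which case reducedness and the sign leave only
  equality.\<close>

lemma cartan_cases:
  assumes "\<alpha> \<in> R" "\<beta> \<in> R" "\<beta> \<bullet> coroot \<alpha> > 0"
  shows "\<beta> = \<alpha> \<or> (\<beta> \<bullet> coroot \<alpha> = 1 \<and> \<alpha> \<bullet> coroot \<beta> \<ge> 1) \<or>
    (\<alpha> \<bullet> coroot \<beta> = 1 \<and> (\<beta> \<bullet> coroot \<alpha> = 2 \<or> \<beta> \<bullet> coroot \<alpha> = 3))"
proof -
  have nz: "\<alpha> \<noteq> 0" "\<beta> \<noteq> 0" using assms zero_R by auto
  then have pp: "\<alpha> \<bullet> \<alpha> > 0" "\<beta> \<bullet> \<beta> > 0" by auto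
  have ab: "\<alpha> \<bullet> \<beta> > 0"
    using assms(3) pp by (simp add: coroot_def inner_commute zero_less_divide_iff)
  obtain k where k: "\<beta> \<bullet> coroot \<alpha> = real_of_int k" using coroot_int assms Ints_cases by blast
  obtain d where d: "\<alpha> \<bullet> coroot \<beta> = real_of_int d" using coroot_int assms Ints_cases by blast
  have kp: "k > 0" using assms(3) k by simp
  have "real_of_int d > 0" using ab pp by (simp add: d[symmetric] coroot_def)
  then have dp: "d > 0" by simp
  have kd: "real_of_int (k * d) = 4 * (\<alpha> \<bullet> \<beta>)\<^sup>2 / ((\<alpha> \<bullet> \<alpha>) * (\<beta> \<bullet> \<beta>))"
    by (simp add: k[symmetric] d[symmetric] coroot_def inner_commute power2_eq_square)
  show ?thesis
  proof (cases "(\<alpha> \<bullet> \<beta>)\<^sup>2 = (\<alpha> \<bullet> \<alpha>) * (\<beta> \<bullet> \<beta>)")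
    case True
    define c where "c = (\<alpha> \<bullet> \<beta>) / (\<alpha> \<bullet> \<alpha>)"
    have "(\<beta> - c *\<^sub>R \<alpha>) \<bullet> (\<beta> - c *\<^sub>R \<alpha>) = \<beta> \<bullet> \<beta> - 2 * c * (\<alpha> \<bullet> \<beta>) + c\<^sup>2 * (\<alpha> \<bullet> \<alpha>)"
      by (simp add: algebra_simps inner_diff_left inner_diff_right inner_commute power2_eq_square)
    also have "\<dots> = \<beta> \<bullet> \<beta> - (\<alpha> \<bullet> \<beta>)\<^sup>2 / (\<alpha> \<bullet> \<alpha>)"
      using pp by (simp add: c_def field_simps power2_eq_square)
    also have "\<dots> = 0" using True pp by simp
    finally have "\<beta> = c *\<^sub>R \<alpha>" by simp
    moreover from this have "c = 1 \<or> c = -1" using reduced assms by blast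
    moreover have "c > 0" using ab pp by (simp add: c_def)
    ultimately have "\<beta> = \<alpha>" by auto
    then show ?thesis by simp
  next
    case False
    then have "(\<alpha> \<bullet> \<beta>)\<^sup>2 < (\<alpha> \<bullet> \<alpha>) * (\<beta> \<bullet> \<beta>)"
      using Cauchy_Schwarz_ineq[of \<alpha> \<beta>] by simp
    then have "4 * (\<alpha> \<bullet> \<beta>)\<^sup>2 / ((\<alpha> \<bullet> \<alpha>) * (\<beta> \<bullet> \<beta>)) < 4"
      using pp by (simp add: divide_less_eq)
    then have "real_of_int (k * d) < 4" using kd by simp
    then have lt: "k * d < 4" by linarith
    have "k < 4" using lt dp kp mult_left_mono[of 1 d k] by linarith
    moreover have "d < 4" using lt dp kp mult_right_mono[of 1 k d] by linarith
    ultimately have kc: "k = 1 \<or> k = 2 \<or> k = 3" and dc: "d = 1 \<or> d = 2 \<or> d = 3"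
      using kp dp by auto
    have "k = 1 \<or> d = 1" using kc dc lt by fastforce
    then show ?thesis using kc dp k d by auto
  qed
qed

end

section \<open>Affine roots and reflections\<close>

definition arefl :: "'a::euclidean_space \<times> real \<Rightarrow> 'a \<times> real \<Rightarrow> 'a \<times> real" where
  "arefl a b = b - (fst b \<bullet> coroot (fst a)) *\<^sub>R a"

text \<open>\<open>aff w m\<close> is the action of \<open>w \<epsilon>\<^sup>m\<close> on affine roots \<open>(\<alpha>, k)\<close>, viewed as vectors, so that products in
  the extended affine Weyl group become compositions of linear maps.\<close>

definition aff :: "('a::euclidean_space \<Rightarrow> 'a) \<Rightarrow> 'a \<Rightarrow> 'a \<times> real \<Rightarrow> 'a \<times> real" where
  "aff w m a = (w (fst a), snd a - m \<bullet> fst a)"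

definition aword :: "('a::euclidean_space \<times> real) list \<Rightarrow> 'a \<times> real \<Rightarrow> 'a \<times> real" where
  "aword as = foldr (\<lambda>a f. arefl a \<circ> f) as id"

lemma aword_Nil [simp]: "aword [] = id"
  and aword_Cons [simp]: "aword (a # as) = arefl a \<circ> aword as"
  by (simp_all add: aword_def)

lemma aword_append: "aword (as @ bs) = aword as \<circ> aword bs"
  by (induction as) (simp_all add: o_assoc)

lemma arefl_aff: "arefl a = aff (refl (fst a)) (snd a *\<^sub>R coroot (fst a))"
  by (rule ext) (auto simp: arefl_def aff_def refl_coroot inner_commute prod_eq_iff)

lemma arefl_self: "fst a \<noteq> 0 \<Longrightarrow> arefl a a = - a"
  by (simp add: arefl_def coroot_inner_self scaleR_2)

lemma arefl_arefl [simp]: "arefl a (arefl a b) = b"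
  by (cases "fst a = 0")
    (auto simp: arefl_def coroot_inner_self inner_diff_left scaleR_2 coroot_def)

lemma arefl_o_arefl [simp]: "arefl a \<circ> arefl a = id"
  by auto

lemma arefl_uminus: "arefl (- a) = arefl a"
  by (rule ext) (simp add: arefl_def)

context root_datum
begin

text \<open>Every vector that pairs integrally with the roots counts as a coweight, so fundamental
  coweights are available as translations.\<close>

definition CW :: "'a set" where "CW = {m. \<forall>\<beta>\<in>R. m \<bullet> \<beta> \<in> \<int>}"
definition AR :: "('a \<times> real) set" where "AR = R \<times> \<int>"
definition G :: "('a \<times> real \<Rightarrow> 'a \<times> real) set" where "G = {aff w m | w m. w \<in> W \<and> m \<in> CW}"
text \<open>The value of an affine root at the point \<open>p0\<close> of the fundamental alcove: an affine root is
  positive iff its level is.\<close>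

definition lev :: "'a \<times> real \<Rightarrow> real" where "lev a = fst a \<bullet> p0 + snd a"
definition N :: "('a \<times> real \<Rightarrow> 'a \<times> real) \<Rightarrow> ('a \<times> real) set" where
  "N g = {a \<in> AR. lev a > 0 \<and> lev (g a) < 0}"

lemma CW_zero: "0 \<in> CW" and CW_add: "m \<in> CW \<Longrightarrow> n \<in> CW \<Longrightarrow> m + n \<in> CW"
  and CW_uminus: "m \<in> CW \<Longrightarrow> - m \<in> CW"
  and CW_diff: "m \<in> CW \<Longrightarrow> n \<in> CW \<Longrightarrow> m - n \<in> CW"
  and CW_int: "c \<in> \<int> \<Longrightarrow> m \<in> CW \<Longrightarrow> c *\<^sub>R m \<in> CW"
  by (auto simp: CW_def inner_add_left inner_diff_left)

lemma CW_W: assumes "w \<in> W" "m \<in> CW" shows "w m \<in> CW"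
proof -
  have "w m \<bullet> \<beta> = m \<bullet> inv w \<beta>" for \<beta>
    using W_inner_inv[OF assms(1), of \<beta> m] by (simp add: inner_commute)
  then show ?thesis using assms W_R W_inv_ex by (simp add: CW_def)
qed

lemma CW_inv: "w \<in> W \<Longrightarrow> m \<in> CW \<Longrightarrow> inv w m \<in> CW"
  using CW_W W_inv_ex by blast

lemma CW_coroot: "\<alpha> \<in> R \<Longrightarrow> coroot \<alpha> \<in> CW"
  using coroot_int' by (auto simp: CW_def)

lemma CW_zspan: "x \<in> zspan (coroot ` R) \<Longrightarrow> x \<in> CW"
  by (induction x rule: zspan.induct) (auto intro: CW_zero CW_add CW_diff CW_coroot)

lemma aff_G: "w \<in> W \<Longrightarrow> m \<in> CW \<Longrightarrow> aff w m \<in> G"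
  by (auto simp: G_def)

lemma GE: assumes "g \<in> G" obtains w m where "g = aff w m" "w \<in> W" "m \<in> CW"
  using assms by (auto simp: G_def)

lemma aff_id: "aff id 0 = id"
  by (auto simp: aff_def)

lemma aff_comp: "w' \<in> W \<Longrightarrow> aff w m \<circ> aff w' m' = aff (w \<circ> w') (inv w' m + m')"
  by (auto simp: aff_def fun_eq_iff W_inner_inv inner_add_left)

lemma aff_transl: "aff w (m :: 'a) \<circ> aff id m' = aff w (m + m')"
  using aff_comp[OF W_id, of w m m'] by simp

lemma G_id: "id \<in> G" using aff_G[OF W_id CW_zero] by (simp add: aff_id)

lemma G_comp: "g \<in> G \<Longrightarrow> h \<in> G \<Longrightarrow> g \<circ> h \<in> G"
  by (auto elim!: GE simp: aff_comp intro!: aff_G W_comp CW_add CW_inv)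

lemma G_inv: assumes "g \<in> G" shows "bij g" "inv g \<in> G"
proof -
  from assms obtain w m where g: "g = aff w m" "w \<in> W" "m \<in> CW" by (rule GE)
  let ?h = "aff (inv w) (- w m)"
  have h: "?h \<in> G" using g by (simp add: aff_G W_inv_ex CW_uminus CW_W)
  have "g \<circ> ?h = id" "?h \<circ> g = id"
    unfolding g(1) using g W_inv_ex[OF g(2)]
    by (simp_all add: aff_comp W_inv_comp inv_inv_eq W_uminus W_inv_l aff_id)
  then show "bij g" "inv g \<in> G" using o_bij h inv_unique_comp by metis+
qed

lemma G_inv_l: "g \<in> G \<Longrightarrow> inv g (g a) = a" and G_inv_r: "g \<in> G \<Longrightarrow> g (inv g a) = a"
  using G_inv(1) by (simp_all add: bij_is_inj bij_is_surj surj_f_inv_f)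

lemma G_inv_comp: "g \<in> G \<Longrightarrow> inv g \<circ> g = id" "g \<in> G \<Longrightarrow> g \<circ> inv g = id"
  by (auto simp: G_inv_l G_inv_r)

lemma G_inv_cancel: "g \<in> G \<Longrightarrow> inv g \<circ> (g \<circ> h) = h" "g \<in> G \<Longrightarrow> g \<circ> (inv g \<circ> h) = h"
  by (auto simp: G_inv_l G_inv_r)

lemma G_inv_o: "g \<in> G \<Longrightarrow> h \<in> G \<Longrightarrow> inv (g \<circ> h) = inv h \<circ> inv g"
  using G_inv(1) by (simp add: o_inv_distrib)

lemma G_linear: "g \<in> G \<Longrightarrow> linear g"
  by (auto elim!: GE intro!: linearI simp: aff_def W_add W_scale inner_add_right algebra_simps)

lemma G_neg: "g \<in> G \<Longrightarrow> g (- a) = - g a"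
  and G_add: "g \<in> G \<Longrightarrow> g (a + b) = g a + g b"
  and G_diff: "g \<in> G \<Longrightarrow> g (a - b) = g a - g b"
  and G_scale: "g \<in> G \<Longrightarrow> g (c *\<^sub>R a) = c *\<^sub>R g a"
  using G_linear linear_neg linear_add linear_diff linear_cmul by blast+

lemma G_delta: "g \<in> G \<Longrightarrow> g (0, t) = (0, t)"
  by (auto elim!: GE simp: aff_def W_linear linear_0)

lemma G_AR: "g \<in> G \<Longrightarrow> a \<in> AR \<Longrightarrow> g a \<in> AR"
  by (auto elim!: GE simp: aff_def AR_def W_R CW_def)

lemma G_fst: assumes "g \<in> G"
  shows "fst (g b) \<bullet> coroot (fst (g a)) = fst b \<bullet> coroot (fst a)"
proof -
  from assms obtain w m where g: "g = aff w m" "w \<in> W" "m \<in> CW" by (rule GE)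
  then show ?thesis by (simp add: aff_def W_coroot[symmetric] W_inner)
qed

lemma G_conj': "g \<in> G \<Longrightarrow> g (arefl a b) = arefl (g a) (g b)"
  by (simp add: arefl_def G_diff G_scale G_fst)

lemma G_conj: "g \<in> G \<Longrightarrow> g \<circ> arefl a = arefl (g a) \<circ> g"
  by (rule ext) (simp add: G_conj')

lemma G_conj_inv: "g \<in> G \<Longrightarrow> arefl a \<circ> g = g \<circ> arefl (inv g a)"
  by (simp add: G_conj G_inv_r)

lemma arefl_G: "a \<in> AR \<Longrightarrow> arefl a \<in> G"
  unfolding arefl_aff by (intro aff_G W_refl CW_int CW_coroot) (auto simp: AR_def)

lemma AR_nz: "a \<in> AR \<Longrightarrow> fst a \<noteq> 0"
  using zero_R by (auto simp: AR_def)

lemma AR_neg: "a \<in> AR \<Longrightarrow> - a \<in> AR"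
  by (auto simp: AR_def)

lemma AR_refl: "a \<in> AR \<Longrightarrow> b \<in> AR \<Longrightarrow> arefl a b \<in> AR"
  using arefl_G G_AR by blast

lemma arefl_self': "a \<in> AR \<Longrightarrow> arefl a a = - a"
  using arefl_self AR_nz by blast

lemma lev_linear: "lev (a + b) = lev a + lev b" "lev (a - b) = lev a - lev b" "lev (- a) = - lev a"
  "lev (c *\<^sub>R a) = c * lev a" "lev 0 = 0"
  by (simp_all add: lev_def inner_add_left inner_diff_left algebra_simps)

lemma lev_arefl: "lev (arefl a b) = lev b - (fst b \<bullet> coroot (fst a)) * lev a"
  by (simp add: arefl_def lev_linear)

text \<open>The finite part contributes a nonzero number strictly between -1 and 1, which cannot
  cancel an integer.\<close>

lemma lev_nz: assumes "a \<in> AR" shows "lev a \<noteq> 0"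
proof
  assume "lev a = 0"
  obtain k where k: "fst a \<in> R" "snd a = of_int k" using assms by (auto simp: AR_def elim: Ints_cases)
  have "fst a \<bullet> p0 = of_int (- k)" using \<open>lev a = 0\<close> k by (simp add: lev_def)
  then show False using p0_root(1,3)[OF k(1)] by (cases "k = 0") auto
qed

lemma lev_pos_iff: assumes "\<alpha> \<in> R"
  shows "lev (\<alpha>, of_int k) > 0 \<longleftrightarrow> k \<ge> (if \<alpha> \<in> Pos then 0 else 1)"
  using p0_root[OF assms] by (auto simp: lev_def)

lemma finite_lev: "finite {a \<in> AR. 0 < lev a \<and> lev a < C}"
proof (rule finite_subset)
  show "{a \<in> AR. 0 < lev a \<and> lev a < C} \<subseteq> R \<times> (real_of_int ` {-2..\<lceil>C\<rceil> + 2})"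
  proof
    fix a assume "a \<in> {a \<in> AR. 0 < lev a \<and> lev a < C}"
    then obtain \<alpha> k where a: "a = (\<alpha>, of_int k)" "\<alpha> \<in> R" "0 < lev a" "lev a < C"
      by (auto simp: AR_def elim!: Ints_cases)
    then have "-2 \<le> k \<and> k \<le> \<lceil>C\<rceil> + 2" using p0_root(3)[OF a(2)] unfolding a(1) lev_def
      by (simp, linarith)
    then show "a \<in> R \<times> (real_of_int ` {-2..\<lceil>C\<rceil> + 2})" using a by auto
  qed
qed (simp add: finR)

lemma finite_N: assumes "g \<in> G" shows "finite (N g)"
proof -
  from assms obtain w m where g: "g = aff w m" "w \<in> W" "m \<in> CW" by (rule GE)
  define C where "C = 2 + (\<Sum>\<beta>\<in>R. \<bar>m \<bullet> \<beta>\<bar>)"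
  have "N g \<subseteq> {a \<in> AR. 0 < lev a \<and> lev a < C}"
  proof
    fix a assume "a \<in> N g"
    then have a: "a \<in> AR" "lev a > 0" "lev (g a) < 0" by (auto simp: N_def)
    then have R: "fst a \<in> R" "w (fst a) \<in> R" using g W_R by (auto simp: AR_def)
    have "\<bar>m \<bullet> fst a\<bar> \<le> (\<Sum>\<beta>\<in>R. \<bar>m \<bullet> \<beta>\<bar>)" using R finR by (intro member_le_sum) auto
    with a(3) p0_root(3)[OF R(1)] p0_root(3)[OF R(2)] have "lev a < C"
      by (simp add: g(1) aff_def lev_def C_def)
    with a show "a \<in> {a \<in> AR. 0 < lev a \<and> lev a < C}" by simp
  qed
  then show ?thesis using finite_lev finite_subset by blast
qed

section \<open>Reflection-closed sets of affine roots and their simple roots\<close>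

definition rclosed :: "('a \<times> real) set \<Rightarrow> bool" where
  "rclosed P \<longleftrightarrow> P \<subseteq> AR \<and> (\<forall>a\<in>P. \<forall>b\<in>P. arefl a b \<in> P)"

text \<open>Simplicity is expressed by the effect of the reflection on signs, the form that exchange
  and lifting arguments use. It makes sense uniformly for all affine roots, for the finite system
  \<open>P0\<close> and for the subsystem \<open>JR \<nu>\<close>.\<close>

definition simple_in :: "('a \<times> real) set \<Rightarrow> 'a \<times> real \<Rightarrow> bool" where
  "simple_in P s \<longleftrightarrow> s \<in> P \<and> lev s > 0 \<and> (\<forall>b\<in>P. lev b > 0 \<longrightarrow> b \<noteq> s \<longrightarrow> lev (arefl s b) > 0)"

lemma rclosed_AR: "rclosed AR" by (auto simp: rclosed_def AR_refl)

lemma rclosed_neg: "rclosed P \<Longrightarrow> a \<in> P \<Longrightarrow> - a \<in> P"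
  unfolding rclosed_def using arefl_self' by (metis subsetD)

lemma lev_cases: "a \<in> AR \<Longrightarrow> lev a > 0 \<or> lev (- a) > 0"
  using lev_nz[of a] by (auto simp: lev_linear)

text \<open>A root of minimal level among those made negative by \<open>g\<close> is simple: were its reflection to
  make another positive root \<open>b\<close> negative, it could be split into two positive roots of
  smaller level.\<close>

lemma simple_ex:
  assumes P: "rclosed P" and g: "g \<in> G" and b0: "b0 \<in> P" "lev b0 > 0" "lev (g b0) < 0"
  shows "\<exists>s. simple_in P s \<and> lev (g s) < 0"
proof -
  let ?N = "{a \<in> P. lev a > 0 \<and> lev (g a) < 0}"
  have PA: "P \<subseteq> AR" using P by (simp add: rclosed_def)
  have "finite ?N" using PA by (intro finite_subset[OF _ finite_N[OF g]]) (auto simp: N_def)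
  moreover have "?N \<noteq> {}" using b0 by blast
  ultimately obtain a where a: "a \<in> ?N" and amin: "\<And>e. e \<in> ?N \<Longrightarrow> lev a \<le> lev e"
    using arg_min_if_finite[of ?N lev] that[of "arg_min_on lev ?N"] by (meson not_le)
  have M: "lev (g e) > 0" if "e \<in> P" "0 < lev e" "lev e < lev a" for e
    using amin[of e] that lev_nz[OF G_AR[OF g, of e]] PA by fastforce
  have noadd: False if "e \<in> P" "f \<in> P" "0 < lev e" "0 < lev f" "a = e + f" for e f
    using M[of e] M[of f] that a by (simp add: lev_linear G_add[OF g])
  have aA: "a \<in> AR" "a \<in> P" "lev a > 0" "lev (g a) < 0" using a PA by auto
  have "lev (arefl a b) > 0" if b: "b \<in> P" "lev b > 0" "b \<noteq> a" for b
  proof (rule ccontr)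
    assume neg: "\<not> lev (arefl a b) > 0"
    have bA: "b \<in> AR" using b PA by auto
    define c where "c = - arefl a b"
    define k where "k = fst b \<bullet> coroot (fst a)"
    define d where "d = fst a \<bullet> coroot (fst b)"
    have cP: "c \<in> P" using P aA b by (auto simp: c_def rclosed_def intro!: rclosed_neg[OF P])
    have cA: "c \<in> AR" using cP PA by auto
    have cl: "lev c > 0" using neg lev_nz[OF cA] by (simp add: c_def lev_linear)
    have c_eq: "c = k *\<^sub>R a - b" by (simp add: c_def arefl_def k_def)
    have "k * lev a > 0" using cl b(2) by (simp add: c_eq lev_linear)
    then have kp: "k > 0" using aA(3) zero_less_mult_pos2 by blast
    have d': "fst a \<bullet> coroot (fst c) = d"
    proof -
      have "arefl a (- a) = a" using arefl_arefl[of a a] by (simp add: arefl_self'[OF aA(1)])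
      then have "fst a \<bullet> coroot (fst (arefl a b)) = - d"
        using G_fst[OF arefl_G[OF aA(1)], of "- a" b] by (simp add: d_def)
      then show ?thesis unfolding c_def fst_uminus coroot_uminus by simp
    qed
    have fR: "fst a \<in> R" "fst b \<in> R" using aA bA by (auto simp: AR_def)
    consider "fst b = fst a" | "k = 1" | "d = 1" "k = 2 \<or> k = 3"
      using cartan_cases[OF fR] kp by (auto simp: k_def d_def)
    then show False
    proof cases
      \<comment> \<open>Here \<open>b\<close> and \<open>c\<close> are \<open>a\<close> shifted by
        opposite multiples of the imaginary root. The lower one lies below \<open>a\<close>, so
        \<open>M\<close> makes its image positive, although that image lies below the negative image
        of \<open>a\<close>.\<close>
      case 1
      then have "k = 2" using coroot_self fR by (simp add: k_def)
      then have c2: "c = a - (b - a)" by (simp add: c_eq scaleR_2)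
      have ba: "b - a = (0, lev b - lev a)" using 1 by (simp add: prod_eq_iff lev_def)
      have "lev b \<noteq> lev a" using ba b(3) by (metis diff_self eq_iff_diff_eq_0 zero_prod_def)
      have gb: "lev (g b) = lev (g a) + (lev b - lev a)"
      proof -
        have "g b - g a = (0, lev b - lev a)" using G_diff[OF g, of b a] G_delta[OF g] ba by simp
        then have "lev (g b - g a) = lev b - lev a" by (simp add: lev_def[of "(0, _)"])
        then show ?thesis by (simp add: lev_linear)
      qed
      have gc: "lev (g c) = lev (g a) - (lev b - lev a)"
        using gb by (simp add: c2 G_diff[OF g] lev_linear)
      have lc: "lev c = lev a - (lev b - lev a)" by (simp add: c2 lev_linear)
      show False using M[OF b(1,2)] M[OF cP cl] gb gc lc \<open>lev b \<noteq> lev a\<close> aA by argo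
    next
      case 2
      then show False using noadd[OF b(1) cP b(2) cl] by (simp add: c_eq)
    next
      \<comment> \<open>Reflecting \<open>a\<close> in \<open>b\<close> and in \<open>c\<close>
        gives \<open>a - b\<close> and \<open>a - c\<close>. Both are negative since
        \<open>a\<close> does not split, but their negatives add up to \<open>(k - 2) a\<close>,
        which is 0 or a forbidden splitting of \<open>a\<close>.\<close>
      case 3
      have e1: "a - b \<in> P"
      proof -
        have "arefl b a \<in> P" using P aA b by (auto simp: rclosed_def)
        then show ?thesis using 3 by (simp add: arefl_def d_def)
      qed
      have e2: "a - c \<in> P"
      proof -
        have "arefl c a \<in> P" using P aA cP by (auto simp: rclosed_def)
        then show ?thesis using d' 3 by (simp add: arefl_def)
      qed
      have l1: "lev (b - a) > 0"
        using lev_cases[of "a - b"] noadd[OF e1 b(1) _ b(2)] e1 PA by auto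
      have l2: "lev (c - a) > 0"
        using lev_cases[of "a - c"] noadd[OF e2 cP _ cl] e2 PA by auto
      have m1: "b - a \<in> P" "c - a \<in> P"
        using rclosed_neg[OF P e1] rclosed_neg[OF P e2] by simp_all
      have s: "(b - a) + (c - a) = (k - 2) *\<^sub>R a"
        by (simp add: c_eq algebra_simps scaleR_2)
      from 3(2) show False
      proof
        assume "k = 2" then show False using s l1 l2 lev_linear(1)[of "b - a" "c - a"] by (simp add: lev_linear)
      next
        assume "k = 3" then show False using s noadd[OF m1 l1 l2] by simp
      qed
    qed
  qed
  then show ?thesis using aA unfolding simple_in_def by blast
qed

end

section \<open>Exchange condition, inversions and length\<close>

context root_datum
begin

definition rgen :: "('a \<times> real) set \<Rightarrow> ('a \<times> real \<Rightarrow> 'a \<times> real) set" where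
  "rgen P = {aword as | as. set as \<subseteq> P}"

lemma rgen_id: "id \<in> rgen P"
  unfolding rgen_def by (auto intro: exI[of _ "[]"])

lemma rgen_refl: "a \<in> P \<Longrightarrow> arefl a \<in> rgen P"
  unfolding rgen_def by (auto intro!: exI[of _ "[a]"])

lemma rgen_comp: assumes "g \<in> rgen P" "h \<in> rgen P" shows "g \<circ> h \<in> rgen P"
proof -
  from assms obtain as bs where "set as \<subseteq> P" "set bs \<subseteq> P" "g = aword as" "h = aword bs"
    by (auto simp: rgen_def)
  then show ?thesis unfolding rgen_def by (auto intro!: exI[of _ "as @ bs"] simp: aword_append)
qed

lemma aword_rev: "aword (rev as) \<circ> aword as = id"
  by (induction as) (simp_all add: aword_append fun_eq_iff)

lemma rgen_inv: assumes "g \<in> rgen P" shows "inv g \<in> rgen P"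
proof -
  from assms obtain as where as: "set as \<subseteq> P" "g = aword as" by (auto simp: rgen_def)
  have "inv g = aword (rev as)"
    using aword_rev[of as] aword_rev[of "rev as"] as(2) by (metis inv_unique_comp rev_rev_ident)
  with as show ?thesis by (auto simp: rgen_def intro!: exI[of _ "rev as"])
qed

lemma rgen_G: "P \<subseteq> AR \<Longrightarrow> g \<in> rgen P \<Longrightarrow> g \<in> G"
proof -
  have "set as \<subseteq> AR \<Longrightarrow> aword as \<in> G" for as
    by (induction as) (auto simp: G_id intro: G_comp[OF arefl_G])
  then show "P \<subseteq> AR \<Longrightarrow> g \<in> rgen P \<Longrightarrow> g \<in> G" by (auto simp: rgen_def)
qed

lemma rgen_stable: assumes "rclosed P" "g \<in> rgen P" "a \<in> P" shows "g a \<in> P"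
proof -
  have "set as \<subseteq> P \<Longrightarrow> aword as a \<in> P" for as
    by (induction as) (use assms in \<open>auto simp: rclosed_def\<close>)
  with assms show ?thesis by (auto simp: rgen_def)
qed

lemma simple_inD: assumes "rclosed P" "simple_in P s"
  shows "s \<in> P" "s \<in> AR" "lev s > 0" "b \<in> P \<Longrightarrow> lev b > 0 \<Longrightarrow> b \<noteq> s \<Longrightarrow> lev (arefl s b) > 0"
  using assms by (auto simp: simple_in_def rclosed_def)

lemma cartan_sign_sym: assumes "a \<in> AR" "b \<in> AR"
  shows "fst a \<bullet> coroot (fst b) > 0 \<longleftrightarrow> fst b \<bullet> coroot (fst a) > 0"
proof -
  define A where "A = fst a \<bullet> fst a"
  define B where "B = fst b \<bullet> fst b"
  have "A > 0" "B > 0" using AR_nz assms by (auto simp: A_def B_def)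
  then show ?thesis
    by (simp add: coroot_def A_def[symmetric] B_def[symmetric] inner_commute zero_less_divide_iff)
qed

text \<open>A reflection negates its own root, so it makes some simple root \<open>s\<close>
  negative. Then \<open>s\<close> and \<open>a\<close> pair positively, and reflecting
  \<open>a\<close> in \<open>s\<close> lowers its level.\<close>

lemma simple_descent:
  assumes P: "rclosed P" and a: "a \<in> P" "lev a > 0"
  obtains s where "simple_in P s" "lev (arefl a s) < 0"
    "s \<noteq> a \<Longrightarrow> lev (arefl s a) > 0 \<and> lev (arefl s a) < lev a"
proof -
  have aA: "a \<in> AR" using P a by (auto simp: rclosed_def)
  obtain s where s: "simple_in P s" "lev (arefl a s) < 0"
    using simple_ex[OF P arefl_G[OF aA] a] a by (auto simp: arefl_self'[OF aA] lev_linear)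
  note sD = simple_inD[OF P s(1)]
  have "(fst s \<bullet> coroot (fst a)) * lev a > 0" using s(2) sD(3) by (simp add: lev_arefl)
  then have "fst s \<bullet> coroot (fst a) > 0" using a(2) zero_less_mult_pos2 by blast
  then have "fst a \<bullet> coroot (fst s) > 0" using cartan_sign_sym[OF aA sD(2)] by simp
  then have "lev (arefl s a) < lev a" using sD(3) by (simp add: lev_arefl)
  with s sD(4)[OF a] show ?thesis by (intro that[of s]) auto
qed

text \<open>Conjugation by the simple reflection from \<open>simple_descent\<close> replaces
  \<open>a\<close> by a lower root. The induction terminates because only finitely many positive
  roots lie below a given level.\<close>

lemma refl_simple_word:
  assumes P: "rclosed P"
  shows "a \<in> P \<Longrightarrow> \<exists>as. set as \<subseteq> Collect (simple_in P) \<and> arefl a = aword as"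
proof -
  have pos: "\<exists>as. set as \<subseteq> Collect (simple_in P) \<and> arefl a = aword as" if "a \<in> P" "lev a > 0" for a
    using that
  proof (induction "card {b \<in> AR. 0 < lev b \<and> lev b < lev a}" arbitrary: a rule: less_induct)
    case less
    then have aA: "a \<in> AR" using P by (auto simp: rclosed_def)
    obtain s where s: "simple_in P s" "s \<noteq> a \<Longrightarrow> lev (arefl s a) > 0 \<and> lev (arefl s a) < lev a"
      using simple_descent[OF P less.prems] by metis
    note sD = simple_inD[OF P s(1)]
    show ?case
    proof (cases "s = a")
      case True
      then show ?thesis using s by (intro exI[of _ "[a]"]) auto
    next
      case False
      let ?b = "arefl s a"
      have b: "?b \<in> P" "lev ?b > 0" "lev ?b < lev a" "?b \<in> AR"
        using s(2)[OF False] P sD less.prems by (auto simp: rclosed_def)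
      have "{c \<in> AR. 0 < lev c \<and> lev c < lev ?b} \<subset> {c \<in> AR. 0 < lev c \<and> lev c < lev a}"
        using b by fastforce
      then have "card {c \<in> AR. 0 < lev c \<and> lev c < lev ?b} < card {c \<in> AR. 0 < lev c \<and> lev c < lev a}"
        by (intro psubset_card_mono finite_lev)
      from less.hyps[OF this b(1,2)] obtain as where
        as: "set as \<subseteq> Collect (simple_in P)" "arefl ?b = aword as" by blast
      have "arefl a \<circ> arefl s = arefl s \<circ> arefl ?b"
        using G_conj[OF arefl_G[OF sD(2)], of ?b] by simp
      then have "arefl a = arefl s \<circ> arefl ?b \<circ> arefl s"
        by (metis arefl_o_arefl comp_assoc comp_id)
      also have "\<dots> = aword ((s # as) @ [s])" by (simp only: aword_append as(2) aword_Cons) simp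
      finally show ?thesis using as s by (intro exI[of _ "(s # as) @ [s]"]) auto
    qed
  qed
  show "a \<in> P \<Longrightarrow> \<exists>as. set as \<subseteq> Collect (simple_in P) \<and> arefl a = aword as"
    using pos[of a] pos[of "-a"] lev_cases[of a] rclosed_neg[OF P, of a] P
    by (auto simp: rclosed_def arefl_uminus)
qed

lemma rgen_simple_word:
  assumes P: "rclosed P" and "g \<in> rgen P"
  shows "\<exists>as. set as \<subseteq> Collect (simple_in P) \<and> g = aword as"
proof -
  have "set as \<subseteq> P \<Longrightarrow> \<exists>bs. set bs \<subseteq> Collect (simple_in P) \<and> aword as = aword bs" for as
  proof (induction as)
    case (Cons a as)
    then obtain bs cs where "set bs \<subseteq> Collect (simple_in P)" "aword as = aword bs"
      "set cs \<subseteq> Collect (simple_in P)" "arefl a = aword cs"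
      using refl_simple_word[OF P, of a] by auto
    then show ?case by (intro exI[of _ "cs @ bs"]) (auto simp: aword_append)
  qed (auto intro: exI[of _ "[]"])
  with assms show ?thesis by (auto simp: rgen_def)
qed

text \<open>Applied letter by letter from the right, the word turns \<open>s\<close> negative at
  some letter. Just before, the root equals that letter, which therefore cancels against the added
  \<open>s\<close>.\<close>

lemma exchange:
  assumes P: "rclosed P" and s: "simple_in P s"
  shows "set as \<subseteq> Collect (simple_in P) \<Longrightarrow> lev (aword as s) < 0 \<Longrightarrow>
    \<exists>bs. set bs \<subseteq> Collect (simple_in P) \<and> length bs < length as \<and> aword as \<circ> arefl s = aword bs"
proof (induction as)
  case Nil
  then show ?case using simple_inD(3)[OF P s] by simp
next
  case (Cons a as)
  have a: "simple_in P a" using Cons by auto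
  have asG: "aword as \<in> rgen P" "aword as \<in> G"
    using Cons.prems P by (auto simp: rgen_def simple_in_def rclosed_def intro!: exI[of _ as] rgen_G[of P])
  have asP: "aword as s \<in> P" using rgen_stable[OF P asG(1)] s by (simp add: simple_in_def)
  show ?case
  proof (cases "lev (aword as s) < 0")
    case True
    from Cons.IH[OF _ this] Cons.prems obtain bs where "set bs \<subseteq> Collect (simple_in P)"
      "length bs < length as" "aword as \<circ> arefl s = aword bs" by (metis insert_subset list.set(2))
    then show ?thesis using a by (intro exI[of _ "a # bs"]) (simp add: fun_eq_iff)
  next
    case False
    then have "lev (aword as s) > 0" using lev_nz[of "aword as s"] asP P by (force simp: rclosed_def)
    then have "aword as s = a"
      using simple_inD(4)[OF P a asP] Cons.prems by fastforce
    then have "aword as \<circ> arefl s = arefl a \<circ> aword as" using G_conj[OF asG(2)] by simp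
    then have "aword (a # as) \<circ> arefl s = aword as"
      by (simp add: comp_assoc) (simp add: fun_eq_iff)
    then show ?thesis using Cons.prems by (metis insert_subset length_Cons lessI list.set(2))
  qed
qed

text \<open>If the product keeps the last letter of a nonempty word positive, the exchange condition
  yields a shorter word; descending ends at the empty word. This serves both for the finite Weyl
  group and for the uniqueness of minimal coset representatives.\<close>

lemma no_inversion_id:
  assumes P: "rclosed P" and g: "g \<in> rgen P" and pos: "\<And>a. a \<in> P \<Longrightarrow> lev a > 0 \<Longrightarrow> lev (g a) > 0"
  shows "g = id"
proof -
  have "set as \<subseteq> Collect (simple_in P) \<Longrightarrow> g = aword as \<Longrightarrow> g = id" for as
  proof (induction as rule: length_induct)
    case (1 as)
    show ?case
    proof (cases as rule: rev_cases)
      case Nil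
      with 1 show ?thesis by simp
    next
      case (snoc bs s)
      have s: "simple_in P s" and bs: "set bs \<subseteq> Collect (simple_in P)" using 1 snoc by auto
      note sD = simple_inD[OF P s]
      have bsG: "aword bs \<in> G"
        using bs P by (intro rgen_G[of P]) (auto simp: rgen_def rclosed_def simple_in_def intro!: exI[of _ bs])
      have geq: "g = aword bs \<circ> arefl s" using 1(3) snoc by (simp add: aword_append fun_eq_iff)
      have "lev (g s) > 0" using pos sD by blast
      then have "lev (aword bs s) < 0"
        unfolding geq by (simp add: arefl_self'[OF sD(2)] G_neg[OF bsG] lev_linear)
      from exchange[OF P s bs this] obtain cs where
        "set cs \<subseteq> Collect (simple_in P)" "length cs < length bs" "g = aword cs"
        using geq by auto
      then show ?thesis using 1(1) snoc by auto
    qed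
  qed
  then show ?thesis using rgen_simple_word[OF P g] by blast
qed

lemma N_D: "a \<in> N g \<Longrightarrow> a \<in> AR" "a \<in> N g \<Longrightarrow> lev a > 0" "a \<in> N g \<Longrightarrow> lev (g a) < 0"
  by (auto simp: N_def)

lemma lev_neg_iff: "a \<in> AR \<Longrightarrow> \<not> lev a > 0 \<longleftrightarrow> lev a < 0"
  using lev_nz[of a] by auto

text \<open>The injection sends an inversion \<open>b\<close> of \<open>g\<close> to its reflection when that is positive
  and to \<open>b\<close> itself otherwise; it misses \<open>a\<close>.\<close>

lemma card_N_less:
  assumes g: "g \<in> G" and a: "a \<in> AR" "lev a > 0" "lev (g a) > 0"
  shows "card (N g) < card (N (g \<circ> arefl a))"
proof -
  have raG: "g \<circ> arefl a \<in> G" using g a by (intro G_comp arefl_G)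
  define f where "f b = (if lev (arefl a b) > 0 then arefl a b else b)" for b
  have inj: "inj_on f (N g)"
  proof (rule inj_onI)
    fix b c assume "b \<in> N g" "c \<in> N g" "f b = f c"
    then show "b = c" unfolding f_def N_def by (auto split: if_splits) (metis arefl_arefl)+
  qed
  have sub: "f ` N g \<subseteq> N (g \<circ> arefl a) - {a}"
  proof
    fix c assume "c \<in> f ` N g"
    then obtain b where b: "b \<in> N g" "c = f b" by blast
    note bD = N_D[OF b(1)]
    show "c \<in> N (g \<circ> arefl a) - {a}"
    proof (cases "lev (arefl a b) > 0")
      case True
      have "arefl a b \<noteq> a"
      proof
        assume "arefl a b = a"
        then have "b = - a" using arefl_arefl[of a b] arefl_self'[OF a(1)] by simp
        then show False using bD a by (simp add: lev_linear)
      qed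
      with True b bD a AR_refl show ?thesis by (auto simp: f_def N_def)
    next
      case False
      then have neg: "lev (arefl a b) < 0" using lev_neg_iff AR_refl a bD by blast
      have "(fst b \<bullet> coroot (fst a)) * lev a > 0" using neg bD by (simp add: lev_arefl)
      then have k: "fst b \<bullet> coroot (fst a) > 0" using a(2) zero_less_mult_pos2 by blast
      have "lev (g (arefl a b)) = lev (g b) - (fst b \<bullet> coroot (fst a)) * lev (g a)"
        by (simp add: arefl_def G_diff[OF g] G_scale[OF g] lev_linear)
      then have "lev (g (arefl a b)) < 0" using mult_pos_pos[OF k a(3)] bD(3) by linarith
      moreover have "b \<noteq> a" using bD a by auto
      ultimately show ?thesis using False b bD by (auto simp: f_def N_def)
    qed
  qed
  have aN: "a \<in> N (g \<circ> arefl a)"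
    using a by (simp add: N_def arefl_self' G_neg[OF g] lev_linear)
  have "card (N g) = card (f ` N g)" using inj by (simp add: card_image)
  also have "\<dots> \<le> card (N (g \<circ> arefl a) - {a})"
    using sub finite_N[OF raG] by (intro card_mono) auto
  also have "\<dots> < card (N (g \<circ> arefl a))"
    using aN finite_N[OF raG] by (meson card_Diff1_less)
  finally show ?thesis .
qed

lemma N_simple:
  assumes g: "g \<in> G" and s: "simple_in AR s" "lev (g s) < 0"
  shows "N (g \<circ> arefl s) = arefl s ` (N g - {s})" "s \<in> N g"
    "card (N g) = Suc (card (N (g \<circ> arefl s)))"
proof -
  note sD = simple_inD[OF rclosed_AR s(1)]
  show sN: "s \<in> N g" using sD s by (simp add: N_def)
  show eq: "N (g \<circ> arefl s) = arefl s ` (N g - {s})"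
  proof
    show "arefl s ` (N g - {s}) \<subseteq> N (g \<circ> arefl s)"
      using sD AR_refl[OF sD(2)] by (auto simp: N_def)
    show "N (g \<circ> arefl s) \<subseteq> arefl s ` (N g - {s})"
    proof
      fix b assume b: "b \<in> N (g \<circ> arefl s)"
      have "b \<noteq> s" using b sD s by (auto simp: N_def arefl_self' G_neg[OF g] lev_linear)
      moreover have "arefl s b \<noteq> s"
      proof
        assume "arefl s b = s"
        then have "b = - s" using arefl_arefl[of s b] arefl_self'[OF sD(2)] by simp
        with b sD show False by (simp add: N_def lev_linear)
      qed
      ultimately have "arefl s b \<in> N g - {s}" using b sD AR_refl[OF sD(2)] by (auto simp: N_def)
      then show "b \<in> arefl s ` (N g - {s})" by (metis arefl_arefl imageI)
    qed
  qed
  have "card (N (g \<circ> arefl s)) = card (N g - {s})"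
    unfolding eq by (intro card_image inj_onI) (metis arefl_arefl)
  then show "card (N g) = Suc (card (N (g \<circ> arefl s)))"
    using card_Suc_Diff1[OF finite_N[OF g] sN] by simp
qed

text \<open>An inversion \<open>a\<close> of \<open>g\<close> corresponds to the inversion
  \<open>- g a\<close> of the inverse.\<close>

lemma N_inv_card: assumes "g \<in> G" shows "card (N (inv g)) = card (N g)"
proof (rule bij_betw_same_card)
  show "bij_betw (\<lambda>a. - inv g a) (N (inv g)) (N g)"
  proof (rule bij_betwI[where g="\<lambda>a. - g a"])
    show "(\<lambda>a. - inv g a) \<in> N (inv g) \<rightarrow> N g"
      using G_AR[OF G_inv(2)[OF assms]]
      by (auto simp: N_def G_neg[OF assms] G_inv_r[OF assms] lev_linear AR_neg)
    show "(\<lambda>a. - g a) \<in> N g \<rightarrow> N (inv g)"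
      using G_AR[OF assms]
      by (auto simp: N_def G_neg[OF G_inv(2)[OF assms]] G_inv_l[OF assms] lev_linear AR_neg)
  qed (auto simp: G_neg[OF assms] G_neg[OF G_inv(2)[OF assms]] G_inv_l[OF assms] G_inv_r[OF assms])
qed

definition bstep where
  "bstep z z' \<longleftrightarrow> (\<exists>a\<in>AR. lev a > 0 \<and> lev (z a) > 0 \<and> z' = z \<circ> arefl a)"

text \<open>The roots \<open>a\<close> and \<open>- a\<close> give the same reflection, so one may
  take the positive one. If \<open>z\<close> made it negative, \<open>card_N_less\<close> for the
  reverse step would show that the length drops.\<close>

lemma bstep_iff_card:
  assumes z: "z \<in> G"
  shows "bstep z z' \<longleftrightarrow> (\<exists>a\<in>AR. z' = z \<circ> arefl a \<and> card (N z) < card (N z'))"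
proof
  assume "\<exists>a\<in>AR. z' = z \<circ> arefl a \<and> card (N z) < card (N z')"
  then obtain a where a: "a \<in> AR" "z' = z \<circ> arefl a" "card (N z) < card (N z')" by blast
  have main: "bstep z z'" if b: "b \<in> AR" "z' = z \<circ> arefl b" "lev b > 0" for b
  proof (cases "lev (z b) > 0")
    case False
    then have "lev (z b) < 0" using lev_neg_iff G_AR[OF z] b by blast
    then have "lev (z' b) > 0" by (simp add: b(2) arefl_self'[OF b(1)] G_neg[OF z] lev_linear)
    moreover have "z' \<in> G" unfolding b(2) using b z by (intro G_comp arefl_G)
    moreover have "z = z' \<circ> arefl b" by (simp add: b(2) comp_assoc)
    ultimately have "card (N z') < card (N z)" using card_N_less b by metis
    with a(3) show ?thesis by simp
  qed (use b in \<open>auto simp: bstep_def\<close>)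
  show "bstep z z'" using main[of a] main[of "-a"] lev_cases[OF a(1)] AR_neg a arefl_uminus by metis
qed (use card_N_less[OF z] in \<open>auto simp: bstep_def\<close>)

section \<open>Length in the finite Weyl group as a number of inversions\<close>

definition P0 :: "('a \<times> real) set" where "P0 = R \<times> {0}"
definition Inv :: "('a \<Rightarrow> 'a) \<Rightarrow> 'a set" where "Inv w = {\<alpha> \<in> Pos. w \<alpha> \<notin> Pos}"

lemma P0_closed: "rclosed P0"
  by (auto simp: rclosed_def P0_def AR_def arefl_aff aff_def refl_R)

lemma lev_P0: "\<alpha> \<in> R \<Longrightarrow> lev (\<alpha>, 0) > 0 \<longleftrightarrow> \<alpha> \<in> Pos"
  using p0_root(2) by (simp add: lev_def)

lemma aword_P0: "aword (map (\<lambda>\<alpha>. (\<alpha>, 0)) as) = aff (rword as) 0"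
  by (induction as) (auto simp: aff_id arefl_aff aff_def fun_eq_iff)

lemma aff_rgen_P0: "w \<in> W \<Longrightarrow> aff w 0 \<in> rgen P0"
proof -
  assume "w \<in> W"
  then obtain as where as: "set as \<subseteq> R" "w = rword as" using weyl_rword by blast
  then show ?thesis unfolding rgen_def by (auto simp: P0_def aword_P0 intro!: exI[of _ "map (\<lambda>\<alpha>. (\<alpha>, 0)) as"])
qed

text \<open>With \<open>W\<close> embedded as affine maps without translation, this is
  \<open>no_inversion_id\<close> for \<open>P0\<close>.\<close>

lemma Inv_empty_id: assumes "w \<in> W" "Inv w = {}" shows "w = id"
proof -
  have "aff w 0 = id"
    using no_inversion_id[OF P0_closed aff_rgen_P0[OF assms(1)]] assms
    by (auto simp: P0_def aff_def lev_P0 W_R Inv_def Pos_R)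
  then show ?thesis by (auto simp: aff_def fun_eq_iff)
qed

text \<open>By reducedness \<open>\<beta>\<close> involves a second simple root; its coefficient is
  unchanged by the reflection and determines the sign.\<close>

lemma simple_refl_Pos: assumes "\<alpha> \<in> \<Delta>" "\<beta> \<in> Pos" "\<beta> \<noteq> \<alpha>" shows "refl \<alpha> \<beta> \<in> Pos"
proof -
  have R: "\<beta> \<in> R" "\<alpha> \<in> R" using assms DR Pos_R by auto
  have "\<exists>a\<in>\<Delta>. a \<noteq> \<alpha> \<and> fd a \<bullet> \<beta> \<noteq> 0"
  proof (rule ccontr)
    assume "\<not> ?thesis"
    then have "(\<Sum>a\<in>\<Delta>. (fd a \<bullet> \<beta>) *\<^sub>R a) = (\<Sum>a\<in>\<Delta>. if a = \<alpha> then (fd \<alpha> \<bullet> \<beta>) *\<^sub>R \<alpha> else 0)"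
      by (intro sum.cong) auto
    then have b: "\<beta> = (fd \<alpha> \<bullet> \<beta>) *\<^sub>R \<alpha>" using root_expand(1)[OF R(1)] assms finD by simp
    then have "fd \<alpha> \<bullet> \<beta> = 1 \<or> fd \<alpha> \<bullet> \<beta> = -1" using reduced R by metis
    then show False using b assms Pos_iff[of \<beta>] by force
  qed
  then obtain a where a: "a \<in> \<Delta>" "a \<noteq> \<alpha>" "fd a \<bullet> \<beta> \<noteq> 0" by blast
  then have "fd a \<bullet> \<beta> > 0" using assms(2) by (force simp: Pos_iff)
  then have "fd a \<bullet> refl \<alpha> \<beta> > 0" using a assms by (simp add: refl_coroot inner_diff_right fd)
  moreover have "refl \<alpha> \<beta> \<in> R" using R refl_R by blast
  ultimately show ?thesis using root_expand(3) a(1) by (force simp: Pos_iff)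
qed

lemma Inv_descent: assumes "w \<in> W" "Inv w \<noteq> {}" obtains \<alpha> where "\<alpha> \<in> \<Delta>" "\<alpha> \<in> Inv w"
proof -
  obtain \<beta> where b: "\<beta> \<in> Pos" "w \<beta> \<notin> Pos" using assms by (auto simp: Inv_def)
  have "\<not> (\<forall>\<alpha>\<in>\<Delta>. w \<alpha> \<in> Pos)"
  proof
    assume all: "\<forall>\<alpha>\<in>\<Delta>. w \<alpha> \<in> Pos"
    have "w \<beta> = w (\<Sum>a\<in>\<Delta>. (fd a \<bullet> \<beta>) *\<^sub>R a)" using root_expand(1)[of \<beta>] b Pos_R by simp
    also have "\<dots> = (\<Sum>a\<in>\<Delta>. (fd a \<bullet> \<beta>) *\<^sub>R w a)"
      using linear_sum[OF W_linear[OF assms(1)], of "\<lambda>a. (fd a \<bullet> \<beta>) *\<^sub>R a" \<Delta>]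
      by (simp add: W_scale[OF assms(1)])
    finally have "fd c \<bullet> w \<beta> \<ge> 0" if "c \<in> \<Delta>" for c
      using all b that by (auto simp: inner_sum_right Pos_iff intro!: sum_nonneg)
    then show False using b W_R[OF assms(1)] by (auto simp: Pos_iff)
  qed
  then show ?thesis using that D_Pos by (auto simp: Inv_def)
qed

lemma Inv_simple: assumes w: "w \<in> W" and a: "\<alpha> \<in> \<Delta>" "w \<alpha> \<notin> Pos"
  shows "card (Inv w) = Suc (card (Inv (w \<circ> refl \<alpha>)))"
proof -
  have aP: "\<alpha> \<in> Pos" "\<alpha> \<in> R" using a D_Pos DR by auto
  have eq: "Inv (w \<circ> refl \<alpha>) = refl \<alpha> ` (Inv w - {\<alpha>})"
  proof
    show "refl \<alpha> ` (Inv w - {\<alpha>}) \<subseteq> Inv (w \<circ> refl \<alpha>)"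
      using simple_refl_Pos[OF a(1)] by (auto simp: Inv_def)
    show "Inv (w \<circ> refl \<alpha>) \<subseteq> refl \<alpha> ` (Inv w - {\<alpha>})"
    proof
      fix \<beta> assume b: "\<beta> \<in> Inv (w \<circ> refl \<alpha>)"
      have "w \<alpha> \<in> R" using W_R[OF w] aP by blast
      then have "\<beta> \<noteq> \<alpha>" using b a by (auto simp: Inv_def refl_self W_uminus[OF w] Pos_uminus)
      moreover have "refl \<alpha> \<beta> \<noteq> \<alpha>"
      proof
        assume "refl \<alpha> \<beta> = \<alpha>"
        then have "\<beta> = - \<alpha>" using refl_refl[of \<alpha> \<beta>] by (simp add: refl_self)
        with b aP show False by (simp add: Inv_def Pos_uminus)
      qed
      ultimately have "refl \<alpha> \<beta> \<in> Inv w - {\<alpha>}" using b simple_refl_Pos[OF a(1)] by (auto simp: Inv_def)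
      then show "\<beta> \<in> refl \<alpha> ` (Inv w - {\<alpha>})" by (metis refl_refl imageI)
    qed
  qed
  have "card (Inv (w \<circ> refl \<alpha>)) = card (Inv w - {\<alpha>})"
    unfolding eq by (intro card_image inj_onI) (metis refl_refl)
  moreover have "\<alpha> \<in> Inv w" "finite (Inv w)" using a aP finPos by (auto simp: Inv_def)
  ultimately show ?thesis using card_Suc_Diff1[of "Inv w" \<alpha>] by simp
qed

lemma Inv_word: "w \<in> W \<Longrightarrow> \<exists>as. set as \<subseteq> \<Delta> \<and> length as = card (Inv w) \<and> w = rword as"
proof (induction "card (Inv w)" arbitrary: w)
  case 0
  then have "Inv w = {}" using finPos by (simp add: Inv_def)
  then have "w = id" using Inv_empty_id 0 by blast
  then show ?case using 0 by (intro exI[of _ "[]"]) auto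
next
  case (Suc n)
  then obtain \<alpha> where a: "\<alpha> \<in> \<Delta>" "\<alpha> \<in> Inv w" using Inv_descent by (metis card.empty nat.distinct(1))
  have c: "card (Inv w) = Suc (card (Inv (w \<circ> refl \<alpha>)))" using Inv_simple Suc a by (simp add: Inv_def)
  moreover have "w \<circ> refl \<alpha> \<in> W" using Suc a DR by (intro W_comp W_refl) auto
  ultimately obtain as where as: "set as \<subseteq> \<Delta>" "length as = card (Inv (w \<circ> refl \<alpha>))" "w \<circ> refl \<alpha> = rword as"
    using Suc by (metis nat.inject)
  have "w = rword (as @ [\<alpha>])" by (simp add: rword_append as(3)[symmetric] comp_assoc)
  then show ?case using as a c by (intro exI[of _ "as @ [\<alpha>]"]) auto
qed

lemma Inv_word_le: "set as \<subseteq> \<Delta> \<Longrightarrow> card (Inv (rword as)) \<le> length as"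
proof (induction as rule: rev_induct)
  case (snoc \<alpha> as)
  have w: "rword as \<in> W" using snoc DR by (auto simp: weyl_def)
  have a: "\<alpha> \<in> \<Delta>" "\<alpha> \<in> R" using snoc DR by auto
  have wa: "rword as \<circ> refl \<alpha> \<in> W" using w a by (intro W_comp W_refl)
  have e: "rword (as @ [\<alpha>]) = rword as \<circ> refl \<alpha>" by (simp add: rword_append)
  have IH: "card (Inv (rword as)) \<le> length as" using snoc by simp
  show ?case
  proof (cases "rword as \<alpha> \<in> Pos")
    case True
    then have "(rword as \<circ> refl \<alpha>) \<alpha> \<notin> Pos"
      using W_R[OF w a(2)] by (simp add: refl_self W_uminus[OF w] Pos_uminus)
    from Inv_simple[OF wa a(1) this] have "card (Inv (rword as \<circ> refl \<alpha>)) = Suc (card (Inv (rword as)))"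
      by (metis comp_assoc comp_id refl_o_refl)
    then show ?thesis unfolding e length_append_singleton using IH by linarith
  next
    case False
    from Inv_simple[OF w a(1) this] show ?thesis unfolding e length_append_singleton using IH by linarith
  qed
qed (simp add: Inv_def)

lemma wlen_Inv: assumes "w \<in> W" shows "wlen \<Delta> w = card (Inv w)"
  unfolding wlen_def
proof (rule Least_equality)
  show "\<exists>as. set as \<subseteq> \<Delta> \<and> length as = card (Inv w) \<and> w = rword as" using Inv_word assms by blast
qed (use Inv_word_le in blast)

end

section \<open>Semi-infinite and Bruhat order\<close>

context root_datum
begin

definition rp :: "'a \<times> real \<Rightarrow> bool" where "rp a \<longleftrightarrow> fst a \<in> Pos"

abbreviation between where
  "between x a c \<equiv> rp c \<and> \<not> rp (arefl a c) \<and> lev (x c) > 0 \<and> lev (x (arefl a c)) < 0"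

text \<open>The semi-infinite covering relation: positivity of the right-hand root \<open>a\<close> is that of its
  finite part, whereas \<open>x a\<close> has to be positive as an affine root. The coverings turn out to be
  the edges of the quantum Bruhat graph, a quantum edge being one that translates by a coroot.\<close>

definition cov where
  "cov x y \<longleftrightarrow> (\<exists>a\<in>AR. rp a \<and> lev (x a) > 0 \<and> y = x \<circ> arefl a \<and>
     (\<forall>c\<in>AR. between x a c \<longrightarrow> c = a))"

definition sle where "sle = cov\<^sup>*\<^sup>*"
definition ble where "ble = bstep\<^sup>*\<^sup>*"
text \<open>Left multiplication by the reflection in \<open>s\<close> acts on the right as
  reflection in \<open>inv z s\<close>, so this says that it is a semi-infinite ascent.\<close>

definition up where "up s z \<longleftrightarrow> rp (inv z s)"

lemma rp_neg: "a \<in> AR \<Longrightarrow> rp (- a) \<longleftrightarrow> \<not> rp a"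
  using Pos_uminus by (auto simp: rp_def AR_def)

lemma rp_iff: "a \<in> AR \<Longrightarrow> rp a \<longleftrightarrow> fst a \<bullet> p0 > 0"
  using p0_root(2) by (auto simp: rp_def AR_def)

lemma rp_nz: "a \<in> AR \<Longrightarrow> fst a \<bullet> p0 \<noteq> 0"
  using p0_root(1) by (auto simp: AR_def)

lemma cov_G: "x \<in> G \<Longrightarrow> cov x y \<Longrightarrow> y \<in> G"
  unfolding cov_def using G_comp arefl_G by blast

lemma bstep_G: "x \<in> G \<Longrightarrow> bstep x y \<Longrightarrow> y \<in> G"
  unfolding bstep_def using G_comp arefl_G by blast

lemma sle_refl [simp]: "sle x x" by (simp add: sle_def)
lemma ble_refl [simp]: "ble x x" by (simp add: ble_def)
lemma sle_trans: "sle x y \<Longrightarrow> sle y z \<Longrightarrow> sle x z" by (simp add: sle_def)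
lemma ble_trans: "ble x y \<Longrightarrow> ble y z \<Longrightarrow> ble x z" by (simp add: ble_def)
lemma cov_sle: "cov x y \<Longrightarrow> sle x y" by (simp add: sle_def)
lemma bstep_ble: "bstep x y \<Longrightarrow> ble x y" by (simp add: ble_def)

lemma ble_G: assumes "ble x y" "x \<in> G" shows "y \<in> G"
  using assms unfolding ble_def by (induction rule: rtranclp_induct) (auto intro: bstep_G)

abbreviation "simp_root \<equiv> simple_in AR"

lemmas simp_rootD = simple_inD[OF rclosed_AR]

lemma inv_refl_o: assumes "z \<in> G" "s \<in> AR" shows "inv (arefl s \<circ> z) = inv z \<circ> arefl s"
proof -
  have "inv (arefl s) = arefl s" by (intro inv_unique_comp) simp_all
  with assms show ?thesis by (simp add: G_inv_o arefl_G)
qed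

lemma inv_o_refl: assumes "z \<in> G" "s \<in> AR" shows "inv (z \<circ> arefl s) = arefl s \<circ> inv z"
proof -
  have "inv (arefl s) = arefl s" by (intro inv_unique_comp) simp_all
  with assms show ?thesis by (simp add: G_inv_o arefl_G)
qed

lemma up_refl: assumes "z \<in> G" "s \<in> AR" shows "up s (arefl s \<circ> z) \<longleftrightarrow> \<not> up s z"
  using assms G_AR[OF G_inv(2)[OF assms(1)] assms(2)]
  by (simp add: up_def inv_refl_o arefl_self' G_neg[OF G_inv(2)] rp_neg)

lemma refl_cancel: "arefl s \<circ> (arefl s \<circ> z) = z"
  by (simp add: fun_eq_iff)

text \<open>The reflection in \<open>s\<close> makes no positive root but \<open>s\<close> negative,
  so only \<open>inv z s\<close> can lie in between.\<close>

lemma cov_simple: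
  assumes z: "z \<in> G" and s: "simp_root s" and u: "up s z"
  shows "cov z (arefl s \<circ> z)"
  unfolding cov_def
proof (intro bexI conjI ballI impI)
  note sD = simp_rootD[OF s]
  let ?a = "inv z s"
  show aA: "?a \<in> AR" using G_AR[OF G_inv(2)[OF z]] sD by blast
  show "rp ?a" using u by (simp add: up_def)
  show "lev (z ?a) > 0" using sD by (simp add: G_inv_r[OF z])
  show "arefl s \<circ> z = z \<circ> arefl ?a" using G_conj_inv[OF z] .
  fix c assume c: "c \<in> AR" "between z ?a c"
  have "z (arefl ?a c) = arefl s (z c)" by (simp add: G_conj'[OF z] G_inv_r[OF z])
  then have "z c = s" using sD(4)[OF G_AR[OF z c(1)]] c by fastforce
  then show "c = ?a" using G_inv_l[OF z] by metis
qed

text \<open>A root obstructing the covering after multiplication by \<open>s\<close> either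
  obstructs the given covering or has a sign changed by \<open>s\<close>. In the second case one of
  the two image roots is \<open>s\<close> up to sign, which forces \<open>x\<close> to descend and
  \<open>y\<close> to ascend under \<open>s\<close>, the configuration listed separately.\<close>

lemma cov_lift:
  assumes x: "x \<in> G" and xy: "cov x y" and s: "simp_root s"
  shows "y = arefl s \<circ> x \<or> (\<not> up s x \<and> up s y) \<or> cov (arefl s \<circ> x) (arefl s \<circ> y)"
proof -
  note sD = simp_rootD[OF s]
  obtain a where a: "a \<in> AR" "rp a" "lev (x a) > 0" "y = x \<circ> arefl a"
    and ac: "\<And>c. c \<in> AR \<Longrightarrow> rp c \<Longrightarrow> \<not> rp (arefl a c) \<Longrightarrow> lev (x c) > 0 \<Longrightarrow> lev (x (arefl a c)) < 0 \<Longrightarrow> c = a"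
    using xy unfolding cov_def by blast
  have invy: "inv y s = arefl a (inv x s)" by (simp add: a(4) inv_o_refl[OF x a(1)])
  show ?thesis
  proof (cases "x a = s \<or> (\<not> up s x \<and> up s y)")
    case True
    then show ?thesis using G_conj[OF x, of a] a(4) by auto
  next
    case False
    have "cov (arefl s \<circ> x) (arefl s \<circ> y)"
      unfolding cov_def
    proof (intro bexI[OF _ a(1)] conjI ballI impI)
      show "rp a" by fact
      show "lev ((arefl s \<circ> x) a) > 0" using False sD(4)[OF G_AR[OF x a(1)] a(3)] by simp
      show "arefl s \<circ> y = arefl s \<circ> x \<circ> arefl a" by (simp add: a(4) comp_assoc)
      fix c assume cA: "c \<in> AR" and "between (arefl s \<circ> x) a c"
      then have c: "rp c" "\<not> rp (arefl a c)" "lev (arefl s (x c)) > 0" "lev (arefl s (x (arefl a c))) < 0"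
        by auto
      have acA: "arefl a c \<in> AR" using AR_refl a cA by blast
      have p1: "lev (x c) > 0"
      proof (rule ccontr)
        assume "\<not> lev (x c) > 0"
        then have l: "lev (- x c) > 0" using lev_cases[OF G_AR[OF x cA]] by auto
        have "- x c = s"
        proof (rule ccontr)
          assume "- x c \<noteq> s"
          from sD(4)[OF AR_neg[OF G_AR[OF x cA]] l this] c(3) show False
            by (simp add: G_neg[OF arefl_G[OF sD(2)]] lev_linear)
        qed
        then have "inv x s = - c" by (metis G_inv_l[OF x] G_neg[OF x])
        then have "\<not> up s x" "up s y" using c(1,2) acA cA
          by (auto simp: up_def invy rp_neg G_neg[OF arefl_G[OF a(1)]])
        with False show False by blast
      qed
      have p2: "lev (x (arefl a c)) < 0"
      proof (rule ccontr)
        assume "\<not> lev (x (arefl a c)) < 0"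
        then have l: "lev (x (arefl a c)) > 0" using lev_neg_iff[OF G_AR[OF x acA]] by auto
        have "x (arefl a c) = s"
          using sD(4)[OF G_AR[OF x acA] l] c(4) by fastforce
        then have "inv x s = arefl a c" by (metis G_inv_l[OF x])
        then have "\<not> up s x" "up s y" using c(1,2) by (auto simp: up_def invy)
        with False show False by blast
      qed
      show "c = a" using ac[OF cA c(1,2) p1 p2] .
    qed
    then show ?thesis by blast
  qed
qed

text \<open>Otherwise \<open>s\<close> would be a combination of two positive roots different from
  \<open>s\<close>, with positive coefficients. Reflecting in \<open>s\<close> keeps those two
  positive but negates \<open>s\<close>.\<close>

lemma cov_up_down:
  assumes x: "x \<in> G" and xy: "cov x y" and s: "simp_root s" and u: "up s x" "\<not> up s y"
  shows "y = arefl s \<circ> x"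
proof -
  note sD = simp_rootD[OF s]
  obtain a where a: "a \<in> AR" "rp a" "lev (x a) > 0" "y = x \<circ> arefl a"
    and ac: "\<And>c. c \<in> AR \<Longrightarrow> rp c \<Longrightarrow> \<not> rp (arefl a c) \<Longrightarrow> lev (x c) > 0 \<Longrightarrow> lev (x (arefl a c)) < 0 \<Longrightarrow> c = a"
    using xy unfolding cov_def by blast
  let ?b = "inv x s"
  have invy: "inv y s = arefl a ?b" by (simp add: a(4) inv_o_refl[OF x a(1)])
  have bA: "?b \<in> AR" using G_AR[OF G_inv(2)[OF x]] sD by blast
  have b: "rp ?b" "\<not> rp (arefl a ?b)" "x ?b = s" using u by (auto simp: up_def invy G_inv_r[OF x])
  have rbA: "arefl a ?b \<in> AR" using AR_refl a bA by blast
  have "x a = s"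
  proof (cases "lev (x (arefl a ?b)) < 0")
    case True
    then show ?thesis using ac[OF bA b(1,2)] b(3) sD by auto
  next
    case False
    show ?thesis
    proof (rule ccontr)
      assume xa: "x a \<noteq> s"
      define k where "k = fst ?b \<bullet> coroot (fst a)"
      have pos: "lev (x (arefl a ?b)) > 0" using False lev_neg_iff[OF G_AR[OF x rbA]] by auto
      have "fst ?b \<bullet> p0 - k * (fst a \<bullet> p0) < 0"
        using b(2) rp_iff[OF rbA] rp_nz[OF rbA] by (simp add: arefl_def k_def inner_diff_left)
      then have "k * (fst a \<bullet> p0) > 0" using b(1) rp_iff[OF bA] by simp
      then have k: "k > 0" using a(2) rp_iff[OF a(1)] zero_less_mult_pos2 by blast
      have s_eq: "s = x (arefl a ?b) + k *\<^sub>R x a"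
        using b(3) by (simp add: arefl_def k_def G_diff[OF x] G_scale[OF x])
      have "x (arefl a ?b) \<noteq> s"
      proof
        assume "x (arefl a ?b) = s"
        then have "k *\<^sub>R x a = 0" using s_eq by simp
        then have "x a = 0" using k by simp
        then show False using a(3) by (simp add: lev_linear)
      qed
      then have l1: "lev (arefl s (x (arefl a ?b))) > 0" using sD(4)[OF G_AR[OF x rbA] pos] by blast
      have l2: "lev (arefl s (x a)) > 0" using sD(4)[OF G_AR[OF x a(1)] a(3) xa] .
      have "arefl s s = arefl s (x (arefl a ?b)) + k *\<^sub>R arefl s (x a)"
        by (subst (2) s_eq) (simp add: G_add[OF arefl_G[OF sD(2)]] G_scale[OF arefl_G[OF sD(2)]])
      then have "lev (arefl s s) = lev (arefl s (x (arefl a ?b))) + k * lev (arefl s (x a))"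
        by (simp add: lev_linear)
      moreover have "lev (arefl s s) < 0" using sD by (simp add: arefl_self' lev_linear)
      ultimately show False using l1 mult_pos_pos[OF k l2] by linarith
    qed
  qed
  then show ?thesis using G_conj[OF x, of a] a(4) by simp
qed

section \<open>Raising and lowering operators for the semi-infinite order\<close>

definition raise where "raise s z = (if up s z then arefl s \<circ> z else z)"
definition lower where "lower s z = (if up s z then z else arefl s \<circ> z)"

lemma cov_lower: "z \<in> G \<Longrightarrow> simp_root s \<Longrightarrow> \<not> up s z \<Longrightarrow> cov (arefl s \<circ> z) z"
  using cov_simple[of "arefl s \<circ> z" s] up_refl[of z s] simp_rootD(2)
  by (simp add: refl_cancel G_comp arefl_G)

lemma cov_raise_lower:
  assumes x: "x \<in> G" and xy: "cov x y" and s: "simp_root s"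
  shows "sle (raise s x) (raise s y)" "sle (lower s x) (lower s y)"
proof -
  note sD = simp_rootD[OF s]
  have y: "y \<in> G" using cov_G x xy by blast
  show "sle (raise s x) (raise s y)"
  proof (cases "y = arefl s \<circ> x")
    case True
    then show ?thesis using up_refl[OF x sD(2)] refl_cancel[of s x] xy by (auto simp: raise_def cov_sle)
  next
    case False
    then show ?thesis
      using cov_lift[OF x xy s] cov_up_down[OF x xy s] cov_sle[OF xy] cov_sle[OF cov_simple[OF y s]]
      by (auto simp: raise_def cov_sle intro: sle_trans)
  qed
  show "sle (lower s x) (lower s y)"
  proof (cases "y = arefl s \<circ> x")
    case True
    then show ?thesis using up_refl[OF x sD(2)] refl_cancel[of s x] xy by (auto simp: lower_def cov_sle)
  next
    case False
    then show ?thesis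
      using cov_lift[OF x xy s] cov_up_down[OF x xy s] cov_sle[OF xy] cov_sle[OF cov_lower[OF x s]]
      by (auto simp: lower_def cov_sle intro: sle_trans)
  qed
qed

lemma sle_raise_lower:
  assumes "sle x y" and x: "x \<in> G" and s: "simp_root s"
  shows "sle (raise s x) (raise s y)" "sle (lower s x) (lower s y)"
proof -
  have "sle (raise s x) (raise s y) \<and> sle (lower s x) (lower s y) \<and> y \<in> G"
    using assms(1) unfolding sle_def
  proof (induction rule: rtranclp_induct)
    case (step y z)
    then show ?case using cov_raise_lower[of y z s] s cov_G[of y z] unfolding sle_def by auto
  qed (use x in auto)
  then show "sle (raise s x) (raise s y)" "sle (lower s x) (lower s y)" by auto
qed

lemma sle_raise: "z \<in> G \<Longrightarrow> simp_root s \<Longrightarrow> sle (arefl s \<circ> z) (raise s z)"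
  using cov_lower by (auto simp: raise_def cov_sle)

text \<open>Choosing \<open>s\<close> so that it decreases the level of the root \<open>z a\<close> excludes the only
  configuration in which neither raising nor lowering transports the step from
  \<open>arefl s \<circ> z\<close> back to \<open>z\<close>.\<close>

lemma sle_step:
  assumes a: "a \<in> AR" "rp a"
  shows "z \<in> G \<Longrightarrow> lev (z a) > 0 \<Longrightarrow> sle z (z \<circ> arefl a)"
proof (induction "card {b \<in> AR. 0 < lev b \<and> lev b < lev (z a)}" arbitrary: z rule: less_induct)
  case less
  note z = \<open>z \<in> G\<close>
  let ?e = "z a"
  let ?z = "z \<circ> arefl a"
  have eA: "?e \<in> AR" using G_AR z a by blast
  have zG: "?z \<in> G" using z a by (intro G_comp arefl_G)
  obtain s where s: "simp_root s" "lev (arefl ?e s) < 0"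
    "s \<noteq> ?e \<Longrightarrow> lev (arefl s ?e) > 0 \<and> lev (arefl s ?e) < lev ?e"
    using simple_descent[OF rclosed_AR eA less.prems(2)] by metis
  note sD = simp_rootD[OF s(1)]
  show ?case
  proof (cases "s = ?e")
    case True
    then have "up s z" using a by (simp add: up_def G_inv_l[OF z])
    moreover have "?z = arefl s \<circ> z" using True G_conj[OF z] by simp
    ultimately show ?thesis using cov_sle[OF cov_simple[OF z s(1)]] by simp
  next
    case False
    let ?y = "arefl s \<circ> z"
    have yG: "?y \<in> G" using z sD by (intro G_comp arefl_G)
    have ya: "?y a = arefl s ?e" "lev (?y a) > 0" "lev (?y a) < lev ?e" using s(3)[OF False] by auto
    have yA: "?y a \<in> AR" using G_AR yG a by blast
    have "{b \<in> AR. 0 < lev b \<and> lev b < lev (?y a)} \<subset> {b \<in> AR. 0 < lev b \<and> lev b < lev ?e}"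
      using ya(2,3) yA by fastforce
    then have "card {b \<in> AR. 0 < lev b \<and> lev b < lev (?y a)} < card {b \<in> AR. 0 < lev b \<and> lev b < lev ?e}"
      by (intro psubset_card_mono finite_lev)
    from less.hyps[OF this yG ya(2)] have IH: "sle ?y (arefl s \<circ> ?z)" unfolding comp_assoc .
    have upy: "up s ?y \<longleftrightarrow> \<not> up s z" "up s (arefl s \<circ> ?z) \<longleftrightarrow> \<not> up s ?z"
      using up_refl z zG sD by auto
    have R: "sle (raise s ?y) (raise s (arefl s \<circ> ?z))" "sle (lower s ?y) (lower s (arefl s \<circ> ?z))"
      using sle_raise_lower[OF IH yG s(1)] by auto
    have nbad: "up s z \<or> \<not> up s ?z"
    proof (rule ccontr)
      assume bad: "\<not> ?thesis"
      let ?b = "inv z s"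
      have bA: "?b \<in> AR" using G_AR[OF G_inv(2)[OF z] sD(2)] .
      define k where "k = fst ?b \<bullet> coroot (fst a)"
      have b: "\<not> rp ?b" "rp (arefl a ?b)" using bad by (auto simp: up_def inv_o_refl[OF z a(1)])
      have "fst ?b \<bullet> p0 < 0" using b(1) rp_iff[OF bA] rp_nz[OF bA] by simp
      moreover have "fst ?b \<bullet> p0 - k * (fst a \<bullet> p0) > 0"
        using b(2) rp_iff[OF AR_refl[OF a(1) bA]] by (simp add: arefl_def k_def inner_diff_left)
      ultimately have k1: "k * (fst a \<bullet> p0) < 0" by linarith
      have "k = fst s \<bullet> coroot (fst ?e)" using G_fst[OF z, of ?b a] by (simp add: k_def G_inv_r[OF z])
      then have "k * lev ?e > 0" using s(2) sD(3) by (simp add: lev_arefl)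
      then have "k > 0" using less.prems(2) zero_less_mult_pos2 by blast
      with k1 show False using a rp_iff mult_pos_pos by fastforce
    qed
    consider "up s z" "up s ?z" | "\<not> up s z" "\<not> up s ?z" | "up s z" "\<not> up s ?z"
      using nbad by blast
    then show ?thesis
    proof cases
      case 1
      then show ?thesis using R(2) upy by (simp add: lower_def refl_cancel)
    next
      case 2
      then show ?thesis using R(1) upy by (simp add: raise_def refl_cancel)
    next
      case 3
      then have "sle z (arefl s \<circ> ?z)" using R(2) upy by (simp add: lower_def refl_cancel)
      then show ?thesis using cov_sle[OF cov_lower[OF zG s(1) 3(2)]] sle_trans by blast
    qed
  qed
qed

text \<open>Elements of length zero permute the positive affine roots. \<open>G\<close> may contain
  such elements other than the identity, so inductions on length have to start from them.\<close>

lemma N_empty: assumes "g \<in> G" "N g = {}" "a \<in> AR"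
  shows "lev (g a) > 0 \<longleftrightarrow> lev a > 0"
proof -
  have *: "lev (g b) > 0" if "lev b > 0" "b \<in> AR" for b
  proof -
    have "\<not> lev (g b) < 0" using assms(2) that unfolding N_def by blast
    then show ?thesis using lev_nz[OF G_AR[OF assms(1) that(2)]] by simp
  qed
  have "lev (- g a) > 0" if "\<not> lev a > 0"
    using *[of "- a"] that lev_cases[OF assms(3)] AR_neg[OF assms(3)] by (simp add: G_neg[OF assms(1)])
  then show ?thesis using *[of a] assms(3) lev_linear(3)[of "g a"] by fastforce
qed

lemma cov_len0: assumes t: "t \<in> G" "N t = {}" and z: "z \<in> G" and c: "cov z z'"
  shows "cov (t \<circ> z) (t \<circ> z')"
proof -
  have pos: "lev (t (z a)) > 0 \<longleftrightarrow> lev (z a) > 0" if "a \<in> AR" for a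
    using N_empty[OF t G_AR[OF z that]] .
  have neg: "lev (t (z a)) < 0 \<longleftrightarrow> lev (z a) < 0" if "a \<in> AR" for a
    using pos[OF that] lev_neg_iff[OF G_AR[OF z that]] lev_neg_iff[OF G_AR[OF t(1) G_AR[OF z that]]] by auto
  obtain a where "a \<in> AR" "rp a" "lev (z a) > 0" "z' = z \<circ> arefl a"
    "\<forall>c\<in>AR. between z a c \<longrightarrow> c = a"
    using c unfolding cov_def by blast
  then show ?thesis unfolding cov_def
    by (intro bexI[of _ a]) (auto simp: pos neg AR_refl comp_assoc)
qed

lemma sle_len0: assumes "t \<in> G" "N t = {}" "z \<in> G" "sle z z'"
  shows "sle (t \<circ> z) (t \<circ> z')"
proof -
  have "sle (t \<circ> z) (t \<circ> z') \<and> z' \<in> G"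
    using assms(4) unfolding sle_def
  proof (induction rule: rtranclp_induct)
    case (step y y')
    then show ?case using cov_len0[OF assms(1,2), of y y'] cov_G[of y y']
      by (meson rtranclp.rtrancl_into_rtrancl)
  qed (use assms in auto)
  then show ?thesis ..
qed

text \<open>The elements \<open>x \<circ> z\<close> with \<open>z\<close> below \<open>b\<close> have a greatest element: apply the raising
  operators along a reduced word of \<open>x\<close> to \<open>b\<close> (a semi-infinite Demazure product).\<close>

lemma sle_max:
  assumes b: "b \<in> G"
  shows "x \<in> G \<Longrightarrow> \<exists>z0\<in>G. sle z0 b \<and> (\<forall>z\<in>G. sle z b \<longrightarrow> sle (x \<circ> z) (x \<circ> z0))"
proof (induction "card (N x)" arbitrary: x)
  case 0
  then have "N x = {}" using finite_N by simp
  then show ?case using 0 b sle_len0 sle_refl by blast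
next
  case (Suc n)
  note x = \<open>x \<in> G\<close>
  have ix: "inv x \<in> G" using G_inv x by blast
  have "card (N (inv x)) = Suc n" using N_inv_card x Suc by simp
  then obtain b0 where "b0 \<in> N (inv x)" by (metis card.empty ex_in_conv nat.distinct(1))
  then obtain s where s: "simp_root s" "lev (inv x s) < 0"
    using simple_ex[OF rclosed_AR ix, of b0] N_D by blast
  note sD = simp_rootD[OF s(1)]
  define x1 where "x1 = arefl s \<circ> x"
  have x1: "x1 \<in> G" unfolding x1_def using x sD by (intro G_comp arefl_G)
  have xx1: "x = arefl s \<circ> x1" by (simp add: x1_def refl_cancel)
  have ix1: "inv x1 = inv x \<circ> arefl s" unfolding x1_def by (rule inv_refl_o[OF x sD(2)])
  have "card (N x1) = n"
    using N_simple(3)[OF ix s] N_inv_card[OF x] N_inv_card[OF x1] Suc(2) by (simp add: ix1)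
  then obtain z1 where z1: "z1 \<in> G" "sle z1 b" "\<And>z. z \<in> G \<Longrightarrow> sle z b \<Longrightarrow> sle (x1 \<circ> z) (x1 \<circ> z1)"
    using Suc(1)[of x1] x1 by blast
  let ?g = "x1 \<circ> z1"
  have g: "?g \<in> G" using x1 z1 by (intro G_comp)
  have ub: "sle (x \<circ> z) (raise s ?g)" if z: "z \<in> G" "sle z b" for z
  proof -
    have xz: "x1 \<circ> z \<in> G" using x1 z by (intro G_comp)
    have "sle (arefl s \<circ> (x1 \<circ> z)) (raise s (x1 \<circ> z))" using sle_raise[OF xz s(1)] .
    then show ?thesis using sle_raise_lower(1)[OF z1(3)[OF z] xz s(1)] sle_trans
      unfolding xx1 comp_assoc by blast
  qed
  show ?case
  proof (cases "up s ?g")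
    case True
    then have "raise s ?g = x \<circ> z1" by (simp add: raise_def xx1 comp_assoc)
    then show ?thesis using ub z1 by (intro bexI[OF _ z1(1)]) auto
  next
    case False
    \<comment> \<open>Raising fixes \<open>?g\<close> here although \<open>x\<close> has one more
      letter \<open>s\<close> than \<open>x1\<close>, so the witness absorbs it: \<open>?e\<close>
      is \<open>s\<close> carried through \<open>x1\<close>, whence
      \<open>x \<circ> ?z0 = ?g\<close>. Positivity of \<open>?e\<close> puts \<open>?z0\<close>
      below \<open>z1\<close>.\<close>
    let ?e = "inv x1 s"
    let ?z0 = "arefl ?e \<circ> z1"
    let ?a = "- inv z1 ?e"
    have eA: "?e \<in> AR" using G_AR[OF G_inv(2)[OF x1] sD(2)] .
    have le: "lev ?e > 0" using s(2) by (simp add: ix1 arefl_self'[OF sD(2)] G_neg[OF ix] lev_linear)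
    have bA: "inv z1 ?e \<in> AR" using G_AR[OF G_inv(2)[OF z1(1)] eA] .
    have z0: "?z0 \<in> G" using z1 eA by (intro G_comp arefl_G)
    have "inv ?g s = inv z1 ?e" using G_inv_o[OF x1 z1(1)] by simp
    then have "rp ?a" using False by (simp add: up_def rp_neg[OF bA])
    moreover have "?z0 ?a = ?e"
      using eA by (simp add: G_neg[OF z1(1)] G_inv_r[OF z1(1)] G_neg[OF arefl_G[OF eA]] arefl_self')
    ultimately have "sle ?z0 (?z0 \<circ> arefl ?a)" using sle_step[OF AR_neg[OF bA] _ z0] le by simp
    moreover have "?z0 \<circ> arefl ?a = z1"
      using G_conj_inv[OF z1(1), of ?e] refl_cancel[of ?e z1] by (simp add: arefl_uminus comp_assoc)
    ultimately have z0b: "sle ?z0 b" using z1(2) sle_trans by metis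
    have "x \<circ> ?z0 = arefl s \<circ> (x1 \<circ> arefl ?e) \<circ> z1" by (simp add: xx1 comp_assoc)
    also have "\<dots> = ?g" by (simp add: G_conj_inv[OF x1, symmetric] refl_cancel)
    finally have "x \<circ> ?z0 = raise s ?g" using False by (simp add: raise_def)
    then show ?thesis using ub z0b by (intro bexI[OF _ z0]) auto
  qed
qed

text \<open>The sign of the finite part of \<open>inv z a\<close> decides. If it is positive,
  \<open>x \<circ> z\<close> to \<open>y \<circ> z\<close> is a semi-infinite step; otherwise
  \<open>arefl a \<circ> z\<close> lies below \<open>z\<close>, and \<open>y\<close> sends it to
  \<open>x \<circ> z\<close>.\<close>

lemma bstep_sle:
  assumes x: "x \<in> G" and xy: "bstep x y" and z: "z \<in> G"
  shows "\<exists>z'\<in>G. sle z' z \<and> sle (x \<circ> z) (y \<circ> z')"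
proof -
  obtain a where a: "a \<in> AR" "lev a > 0" "lev (x a) > 0" "y = x \<circ> arefl a"
    using xy unfolding bstep_def by blast
  let ?b = "inv z a"
  have bA: "?b \<in> AR" using G_AR[OF G_inv(2)[OF z] a(1)] .
  show ?thesis
  proof (cases "rp ?b")
    case True
    have "sle (x \<circ> z) (x \<circ> z \<circ> arefl ?b)"
      using a by (intro sle_step[OF bA True] G_comp x z) (simp add: G_inv_r[OF z])
    moreover have "x \<circ> z \<circ> arefl ?b = y \<circ> z" by (simp add: a(4) comp_assoc G_conj_inv[OF z])
    ultimately show ?thesis using z by (intro bexI[OF _ z]) auto
  next
    case False
    let ?z = "arefl a \<circ> z"
    have zG: "?z \<in> G" using z a by (intro G_comp arefl_G)
    have "?z (- ?b) = a"
      by (simp add: G_neg[OF z] G_inv_r[OF z] G_neg[OF arefl_G[OF a(1)]] arefl_self'[OF a(1)])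
    then have "sle ?z (?z \<circ> arefl (- ?b))"
      using False a by (intro sle_step AR_neg bA zG) (simp_all add: rp_neg[OF bA])
    moreover have "?z \<circ> arefl (- ?b) = z"
      using G_conj_inv[OF z, of a] refl_cancel[of a z] by (simp add: arefl_uminus comp_assoc)
    moreover have "y \<circ> ?z = x \<circ> z" by (simp add: a(4) fun_eq_iff)
    ultimately show ?thesis using zG by (intro bexI[OF _ zG]) auto
  qed
qed

lemma ble_sle:
  assumes "ble x y" and x: "x \<in> G" and z: "z \<in> G"
  shows "\<exists>z'\<in>G. sle z' z \<and> sle (x \<circ> z) (y \<circ> z')"
proof -
  have "(\<exists>z'\<in>G. sle z' z \<and> sle (x \<circ> z) (y \<circ> z')) \<and> y \<in> G"
    using assms(1) unfolding ble_def
  proof (induction rule: rtranclp_induct)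
    case base
    then show ?case using x z by (auto intro!: bexI[OF _ z])
  next
    case (step y y')
    then obtain z1 where z1: "z1 \<in> G" "sle z1 z" "sle (x \<circ> z) (y \<circ> z1)" and y: "y \<in> G" by blast
    from bstep_sle[OF y step(2) z1(1)] obtain z2 where "z2 \<in> G" "sle z2 z1" "sle (y \<circ> z1) (y' \<circ> z2)"
      by blast
    with z1 show ?case using sle_trans bstep_G[OF y step(2)] by blast
  qed
  then show ?thesis ..
qed

section \<open>Lowering on the right and cancellation in the Bruhat order\<close>

definition rlower where "rlower s z = (if lev (z s) > 0 then z else z \<circ> arefl s)"

lemma refl_cancel': "z \<circ> arefl s \<circ> arefl s = z"
  by (simp add: fun_eq_iff)

lemma rlower_le:
  assumes z: "z \<in> G" and s: "simp_root s"
  shows "ble (rlower s z) z" "ble (rlower s z) (z \<circ> arefl s)"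
proof -
  note sD = simp_rootD[OF s]
  have *: "bstep (z \<circ> arefl s) z" if "\<not> lev (z s) > 0"
    unfolding bstep_def
    using that sD lev_cases[OF G_AR[OF z sD(2)]]
    by (intro bexI[OF _ sD(2)]) (simp add: arefl_self' G_neg[OF z] refl_cancel')
  have "bstep z (z \<circ> arefl s)" if "lev (z s) > 0"
    unfolding bstep_def using that sD by blast
  with * show "ble (rlower s z) z" "ble (rlower s z) (z \<circ> arefl s)" by (auto simp: rlower_def bstep_ble)
qed

text \<open>A step along \<open>a \<noteq> s\<close> is conjugated into one along
  \<open>arefl s a\<close>, which is positive because \<open>s\<close> is simple; a step along
  \<open>s\<close> itself is swallowed by the lowering.\<close>

lemma bstep_rlower:
  assumes z: "z \<in> G" and zz: "bstep z z'" and s: "simp_root s"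
  shows "ble (rlower s z) (rlower s z')"
proof -
  note sD = simp_rootD[OF s]
  obtain a where a: "a \<in> AR" "lev a > 0" "lev (z a) > 0" "z' = z \<circ> arefl a"
    using zz unfolding bstep_def by blast
  show ?thesis
  proof (cases "a = s")
    case True
    then have "rlower s z = z" using a by (simp add: rlower_def)
    moreover have "rlower s z' = z"
      using a True by (simp add: rlower_def arefl_self' G_neg[OF z] lev_linear refl_cancel')
    ultimately show ?thesis by simp
  next
    case False
    have "bstep (z \<circ> arefl s) (z' \<circ> arefl s)"
      unfolding bstep_def
    proof (intro bexI[of _ "arefl s a"] conjI)
      show "lev (arefl s a) > 0" using sD(4) a False by blast
      show "z' \<circ> arefl s = z \<circ> arefl s \<circ> arefl (arefl s a)"
        using G_conj[OF arefl_G[OF sD(2)], of "arefl s a"] by (simp add: a(4) comp_assoc)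
    qed (use a AR_refl sD in auto)
    then show ?thesis using rlower_le[OF z s] zz ble_trans bstep_ble
      by (cases "lev (z' s) > 0") (auto simp: rlower_def[of s z'])
  qed
qed

lemma ble_rlower:
  assumes "ble z z'" and z: "z \<in> G" and s: "simp_root s"
  shows "ble (rlower s z) (rlower s z')"
proof -
  have "ble (rlower s z) (rlower s z') \<and> z' \<in> G"
    using assms(1) unfolding ble_def
  proof (induction rule: rtranclp_induct)
    case (step y y')
    then show ?case using bstep_rlower[of y y' s] s bstep_G[of y y'] unfolding ble_def by auto
  qed (use z in auto)
  then show ?thesis ..
qed

lemma ble_len0:
  assumes "ble z z'" and z: "z \<in> G" and t: "t \<in> G" "N t = {}"
  shows "ble (z \<circ> inv t) (z' \<circ> inv t)"
  using assms(1) unfolding ble_def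
proof (induction rule: rtranclp_induct)
  case (step y y')
  obtain a where a: "a \<in> AR" "lev a > 0" "lev (y a) > 0" "y' = y \<circ> arefl a"
    using step(2) unfolding bstep_def by blast
  have "bstep (y \<circ> inv t) (y' \<circ> inv t)"
    unfolding bstep_def
  proof (intro bexI[of _ "t a"] conjI)
    show "t a \<in> AR" using G_AR t a by blast
    show "lev (t a) > 0" using N_empty[OF t a(1)] a by simp
    show "lev ((y \<circ> inv t) (t a)) > 0" using a by (simp add: G_inv_l[OF t(1)])
    show "y' \<circ> inv t = y \<circ> inv t \<circ> arefl (t a)"
      using G_conj_inv[OF G_inv(2)[OF t(1)], of a]
      unfolding a(4) comp_assoc inv_inv_eq[OF G_inv(1)[OF t(1)]] by (rule arg_cong)
  qed
  with step(3) show ?case by (meson rtranclp.rtrancl_into_rtrancl)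
qed auto

lemma ble_N_empty: assumes "ble c' c" "c' \<in> G" "N c = {}" shows "c' = c"
proof (rule ccontr)
  assume "c' \<noteq> c"
  then obtain y where y: "ble c' y" "bstep y c"
    using assms(1) unfolding ble_def by (metis rtranclp.cases)
  then have "y \<in> G" using ble_G assms by blast
  then have "card (N y) < card (N c)" using y bstep_iff_card by blast
  then show False using assms(3) by simp
qed

text \<open>The inclusion of inversion sets says that the lengths of \<open>x\<close> and
  \<open>c\<close> add up, so a right descent \<open>s\<close> of \<open>c\<close> is one of
  \<open>x \<circ> c\<close> too. Lowering both relations along \<open>s\<close> shortens
  \<open>c\<close>, and also \<open>c'\<close> if \<open>s\<close> is a descent of it.\<close>

lemma ble_cancel:
  assumes "x \<in> G" "x' \<in> G"
  shows "c \<in> G \<Longrightarrow> c' \<in> G \<Longrightarrow> ble (x \<circ> c) (x' \<circ> c') \<Longrightarrow> ble c' c \<Longrightarrow> N c \<subseteq> N (x \<circ> c) \<Longrightarrow> ble x x'"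
proof (induction "card (N c)" arbitrary: c c')
  case 0
  then have N: "N c = {}" using finite_N by simp
  then have "c' = c" using ble_N_empty 0 by blast
  moreover have "x \<circ> c \<in> G" using assms 0 by (intro G_comp)
  ultimately have "ble (x \<circ> c \<circ> inv c) (x' \<circ> c \<circ> inv c)"
    using ble_len0[OF 0(4) _ 0(2) N] by blast
  then show ?case unfolding comp_assoc G_inv_comp[OF 0(2)] by simp
next
  case (Suc n)
  note c = \<open>c \<in> G\<close> and c' = \<open>c' \<in> G\<close>
  obtain b0 where "b0 \<in> N c" using Suc(2) by (metis card.empty ex_in_conv nat.distinct(1))
  then obtain s where s: "simp_root s" "lev (c s) < 0"
    using simple_ex[OF rclosed_AR c, of b0] N_D by blast
  note sD = simp_rootD[OF s(1)]
  let ?y = "x \<circ> c"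
  let ?y' = "x' \<circ> c'"
  have y: "?y \<in> G" "?y' \<in> G" using assms c c' by (auto intro: G_comp)
  have ys: "lev (?y s) < 0" using N_simple(2)[OF c s] Suc.prems(5) by (auto simp: N_def)
  have c1: "c \<circ> arefl s \<in> G" "c' \<circ> arefl s \<in> G" using c c' sD by (auto intro!: G_comp arefl_G)
  have n: "n = card (N (c \<circ> arefl s))" using N_simple(3)[OF c s] Suc(2) by simp
  have sub: "N (c \<circ> arefl s) \<subseteq> N (x \<circ> (c \<circ> arefl s))"
    using N_simple(1)[OF c s] N_simple(1)[OF y(1) s(1) ys] Suc.prems(5)
    unfolding comp_assoc[symmetric] by blast
  have low: "rlower s ?y = x \<circ> (c \<circ> arefl s)" "rlower s c = c \<circ> arefl s"
    using ys s(2) by (auto simp: rlower_def comp_assoc)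
  show ?case
  proof (cases "lev (c' s) > 0")
    case True
    then have "ble c' (c \<circ> arefl s)"
      using ble_rlower[OF Suc.prems(4) c' s(1)] low by (simp add: rlower_def)
    moreover have "ble (x \<circ> (c \<circ> arefl s)) ?y'"
      using rlower_le(1)[OF y(1) s(1)] Suc.prems(3) low ble_trans by metis
    ultimately show ?thesis using Suc(1)[OF n c1(1) c'] sub by blast
  next
    case False
    then have "ble (c' \<circ> arefl s) (c \<circ> arefl s)"
      using ble_rlower[OF Suc.prems(4) c' s(1)] low by (simp add: rlower_def)
    moreover have "ble (x \<circ> (c \<circ> arefl s)) (x' \<circ> (c' \<circ> arefl s))"
      using rlower_le(2)[OF y(2) s(1)] ble_rlower[OF Suc.prems(3) y(1) s(1)] low ble_trans
      by (metis comp_assoc)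
    ultimately show ?thesis using Suc(1)[OF n c1] sub by blast
  qed
qed

end

section \<open>The quantum Bruhat graph\<close>

context root_datum
begin

abbreviation "PC \<equiv> nspan (coroot ` Pos)"

definition rho2 :: 'a where "rho2 = (\<Sum>\<beta>\<in>Pos. \<beta>)"

lemma two_rho_pair_eq: "two_rho_pair R \<Delta> \<alpha> = coroot \<alpha> \<bullet> rho2"
  by (simp add: two_rho_pair_def rho2_def inner_sum_right)

lemma aff_inj: assumes "aff u m = aff u' m'" shows "u = u'" "m = m'"
proof -
  have *: "u \<alpha> = u' \<alpha> \<and> m \<bullet> \<alpha> = m' \<bullet> \<alpha>" for \<alpha>
    using fun_cong[OF assms, of "(\<alpha>, 0)"] by (simp add: aff_def)
  then show "u = u'" by auto
  have "(m - m') \<bullet> (m - m') = 0" using * by (simp add: inner_diff_left)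
  then show "m = m'" by simp
qed

lemma inv_refl: "inv (refl \<alpha>) = refl \<alpha>"
  by (intro inv_unique_comp) simp_all

lemma aff_arefl: assumes "\<alpha> \<in> R"
  shows "aff u m \<circ> arefl (\<alpha>, k) = aff (u \<circ> refl \<alpha>) (m + (k - m \<bullet> \<alpha>) *\<^sub>R coroot \<alpha>)"
  unfolding arefl_aff using aff_comp[OF W_refl[OF assms], of u m]
  by (simp add: inv_refl refl_coroot' algebra_simps)

text \<open>The parameter \<open>j\<close> is chosen so that positivity of the image depends on
  \<open>u\<close> and \<open>j\<close> only, while the reflection translates by exactly
  \<open>j\<close> coroots.\<close>

lemma step_root: assumes "\<alpha> \<in> R" "m \<in> CW"
  shows "(\<alpha>, of_int j + m \<bullet> \<alpha>) \<in> AR" "aff u m (\<alpha>, of_int j + m \<bullet> \<alpha>) = (u \<alpha>, of_int j)"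
    "aff u m \<circ> arefl (\<alpha>, of_int j + m \<bullet> \<alpha>) = aff (u \<circ> refl \<alpha>) (m + of_int j *\<^sub>R coroot \<alpha>)"
  using assms by (simp_all add: AR_def CW_def aff_def aff_arefl)

lemma sle_refl_step:
  assumes "\<alpha> \<in> Pos" "u \<in> W" "m \<in> CW" "lev (u \<alpha>, of_int j) > 0"
  shows "sle (aff u m) (aff (u \<circ> refl \<alpha>) (m + of_int j *\<^sub>R coroot \<alpha>))"
proof -
  note sr = step_root[OF Pos_R[OF assms(1)] assms(3)]
  show ?thesis
    using sle_step[OF sr(1)[of j] _ aff_G[OF assms(2,3)]] assms by (simp add: rp_def sr)
qed

lemma lev_one: "\<alpha> \<in> R \<Longrightarrow> lev (\<alpha>, 1) > 0"
  using lev_pos_iff[of \<alpha> 1] by simp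

text \<open>Reflect in \<open>\<alpha>\<close> twice. For the least \<open>j\<close> that makes
  \<open>(u \<alpha>, j)\<close> positive, \<open>(- u \<alpha>, 1 - j)\<close> is positive too, and
  the two translations add up to one coroot.\<close>

lemma sle_PC1: assumes "\<alpha> \<in> Pos" "u \<in> W" "m \<in> CW"
  shows "sle (aff u m) (aff u (m + coroot \<alpha>))"
proof -
  have R: "\<alpha> \<in> R" "u \<alpha> \<in> R" using assms Pos_R W_R by auto
  define j :: int where "j = (if u \<alpha> \<in> Pos then 0 else 1)"
  have 1: "sle (aff u m) (aff (u \<circ> refl \<alpha>) (m + of_int j *\<^sub>R coroot \<alpha>))"
    using R by (intro sle_refl_step assms) (simp add: lev_pos_iff j_def)
  have 2: "sle (aff (u \<circ> refl \<alpha>) (m + of_int j *\<^sub>R coroot \<alpha>))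
     (aff (u \<circ> refl \<alpha> \<circ> refl \<alpha>) (m + of_int j *\<^sub>R coroot \<alpha> + of_int (1 - j) *\<^sub>R coroot \<alpha>))"
  proof (intro sle_refl_step)
    show "0 < lev ((u \<circ> refl \<alpha>) \<alpha>, of_int (1 - j))"
      using lev_pos_iff[of "- u \<alpha>" "1 - j"] R assms(2)
      by (simp add: refl_self W_uminus Pos_uminus j_def)
  qed (use assms R in \<open>auto intro!: W_comp W_refl CW_add CW_int CW_coroot\<close>)
  have "m + of_int j *\<^sub>R coroot \<alpha> + of_int (1 - j) *\<^sub>R coroot \<alpha> = m + coroot \<alpha>"
    by (simp add: algebra_simps)
  moreover have "u \<circ> refl \<alpha> \<circ> refl \<alpha> = u" by (simp add: fun_eq_iff)
  ultimately show ?thesis using 1 2 sle_trans by metis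
qed

lemma PC_CW: "x \<in> PC \<Longrightarrow> x \<in> CW"
  by (induction x rule: nspan.induct) (auto intro: CW_zero CW_add CW_coroot Pos_R)

lemma sle_PC: assumes "x \<in> PC" "u \<in> W" "m \<in> CW"
  shows "sle (aff u m) (aff u (m + x))"
  using assms
proof (induction x rule: nspan.induct)
  case (nspan_add v a)
  then obtain \<alpha> where a: "\<alpha> \<in> Pos" "a = coroot \<alpha>" by blast
  have "m + v \<in> CW" using nspan_add PC_CW by (intro CW_add) auto
  then have "sle (aff u (m + v)) (aff u (m + v + a))" using sle_PC1 a nspan_add by blast
  then show ?case using nspan_add sle_trans by (metis add.assoc)
qed simp

lemma sle_incr:
  assumes "sle (aff u m) z" "u \<in> W" "m \<in> CW"
  shows "\<exists>u' m'. z = aff u' m' \<and> u' \<in> W \<and> m' \<in> CW \<and> m' - m \<in> PC"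
  using assms(1) unfolding sle_def
proof (induction rule: rtranclp_induct)
  case base
  then show ?case using assms nspan_zero by (metis diff_self)
next
  case (step y z)
  then obtain u1 m1 where y: "y = aff u1 m1" "u1 \<in> W" "m1 \<in> CW" "m1 - m \<in> PC" by blast
  obtain a where a: "a \<in> AR" "rp a" "lev (y a) > 0" "z = y \<circ> arefl a"
    using step(2) unfolding cov_def by blast
  obtain \<alpha> k where ak: "a = (\<alpha>, of_int k)" "\<alpha> \<in> R" using a(1) by (auto simp: AR_def elim!: Ints_cases)
  have aP: "\<alpha> \<in> Pos" using a(2) ak by (simp add: rp_def)
  obtain i where i: "m1 \<bullet> \<alpha> = of_int i" using y ak by (auto simp: CW_def elim!: Ints_cases)
  let ?j = "k - i"
  have "lev (u1 \<alpha>, of_int ?j) > 0" using a(3) by (simp add: y ak aff_def i)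
  then have j: "?j \<ge> 0" using lev_pos_iff[OF W_R[OF y(2) ak(2)], of ?j] by (auto split: if_splits)
  have z: "z = aff (u1 \<circ> refl \<alpha>) (m1 + of_int ?j *\<^sub>R coroot \<alpha>)"
    using aff_arefl[OF ak(2), of u1 m1 "of_int k"] by (simp add: a(4) ak(1) y(1) i)
  have "of_nat (nat ?j) *\<^sub>R coroot \<alpha> \<in> PC" using aP by (intro nspan_nat nspan_base) auto
  then have "(m1 - m) + of_int ?j *\<^sub>R coroot \<alpha> \<in> PC" using y j by (intro nspan_plus) auto
  then have "m1 + of_int ?j *\<^sub>R coroot \<alpha> - m \<in> PC" by (simp add: algebra_simps)
  moreover have "u1 \<circ> refl \<alpha> \<in> W" using y ak by (intro W_comp W_refl)
  moreover have "m1 + of_int ?j *\<^sub>R coroot \<alpha> \<in> CW"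
    using y ak by (intro CW_add CW_int CW_coroot) auto
  ultimately show ?case using z by blast
qed

lemma sle_incr': assumes "sle (aff u m) (aff u' m')" "u \<in> W" "m \<in> CW"
  shows "m' - m \<in> PC" "u' \<in> W" "m' \<in> CW"
  using sle_incr[OF assms] aff_inj by blast+

text \<open>A right translation changes only the second component of an affine root, whereas
  \<open>rp\<close> depends on the first.\<close>

lemma cov_shift:
  assumes t: "t \<in> CW" and z: "z \<in> G" "cov z z'"
  shows "cov (z \<circ> aff id t) (z' \<circ> aff id t)"
proof -
  let ?t = "aff id t" and ?i = "aff id (- t)"
  have tG: "?t \<in> G" "?i \<in> G" using t by (auto intro: aff_G W_id CW_uminus)
  have ti: "?t (?i a) = a" "?i (?t a) = a" for a by (simp_all add: aff_def)
  have f: "fst (?t a) = fst a" "fst (?i a) = fst a" for a by (simp_all add: aff_def)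
  have rpt: "rp (?t a) = rp a" "rp (?i a) = rp a" for a by (simp_all add: rp_def f)
  obtain a where a: "a \<in> AR" "rp a" "lev (z a) > 0" "z' = z \<circ> arefl a"
    and ac: "\<And>c. c \<in> AR \<Longrightarrow> rp c \<Longrightarrow> \<not> rp (arefl a c) \<Longrightarrow> lev (z c) > 0 \<Longrightarrow> lev (z (arefl a c)) < 0 \<Longrightarrow> c = a"
    using z(2) unfolding cov_def by blast
  have r: "?t (arefl (?i a) c) = arefl a (?t c)" for c using G_conj'[OF tG(1), of "?i a" c] ti by simp
  show ?thesis
    unfolding cov_def
  proof (intro bexI[of _ "?i a"] conjI ballI impI)
    show "?i a \<in> AR" using G_AR tG a by blast
    show "rp (?i a)" using a rpt by simp
    show "lev ((z \<circ> ?t) (?i a)) > 0" using a ti by simp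
    show "z' \<circ> ?t = z \<circ> ?t \<circ> arefl (?i a)" using r by (simp add: a(4) fun_eq_iff)
    fix c assume c: "c \<in> AR" "between (z \<circ> ?t) (?i a) c"
    have "?t c = a"
    proof (rule ac)
      show "?t c \<in> AR" using G_AR tG c by blast
    qed (use c r rpt in \<open>auto simp: rpt(1)[of "arefl (?i a) c", symmetric]\<close>)
    then show "c = ?i a" using ti by metis
  qed
qed

lemma sle_shift:
  assumes "sle (aff u m) (aff u' m')" "u \<in> W" "m \<in> CW" and t: "t \<in> CW"
  shows "sle (aff u (m + t)) (aff u' (m' + t))"
proof -
  have "sle (aff u m \<circ> aff id t) (z \<circ> aff id t) \<and> z \<in> G" if "sle (aff u m) z" for z
    using that unfolding sle_def
  proof (induction rule: rtranclp_induct)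
    case base
    then show ?case using assms aff_G by auto
  next
    case (step y z)
    then show ?case using cov_shift[OF t, of y z] cov_G[of y z] by (meson rtranclp.rtrancl_into_rtrancl)
  qed
  from this[OF assms(1)] show ?thesis by (simp add: aff_transl)
qed

section \<open>Change of semi-infinite length under a reflection\<close>

lemma Inv_refl_pair: assumes "\<alpha> \<in> Pos" "\<gamma> \<in> Inv (refl \<alpha>)"
  shows "\<exists>n::int. coroot \<alpha> \<bullet> \<gamma> = of_int n \<and> n \<ge> 1"
proof -
  have R: "\<alpha> \<in> R" "\<gamma> \<in> R" "\<gamma> \<in> Pos" "refl \<alpha> \<gamma> \<in> R" using assms Pos_R refl_R by (auto simp: Inv_def)
  obtain n where n: "coroot \<alpha> \<bullet> \<gamma> = of_int n" using coroot_int'[OF R(1,2)] by (auto elim: Ints_cases)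
  have "refl \<alpha> \<gamma> \<bullet> p0 < 0" using assms(2) p0_root(1,2)[OF R(4)] by (auto simp: Inv_def)
  moreover have "\<gamma> \<bullet> p0 > 0" "\<alpha> \<bullet> p0 > 0" using p0_root(2) R assms by auto
  moreover have "refl \<alpha> \<gamma> \<bullet> p0 = \<gamma> \<bullet> p0 - of_int n * (\<alpha> \<bullet> p0)"
    using n by (simp add: refl_coroot inner_diff_left inner_commute[of \<gamma> "coroot \<alpha>"])
  ultimately have "of_int n * (\<alpha> \<bullet> p0) > 0" by linarith
  then have "n > 0" using \<open>\<alpha> \<bullet> p0 > 0\<close> zero_less_mult_pos2 by (metis of_int_0_less_iff)
  with n show ?thesis by auto
qed

lemma Inv_refl_self: "\<alpha> \<in> Pos \<Longrightarrow> \<alpha> \<in> Inv (refl \<alpha>)"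
  by (simp add: Inv_def refl_self Pos_uminus Pos_R)

lemma finite_Inv: "finite (Inv w)" using finPos by (simp add: Inv_def)

lemma refl_bij: assumes "\<alpha> \<in> Pos"
  shows "bij_betw (refl \<alpha>) (Pos - Inv (refl \<alpha>)) (Pos - Inv (refl \<alpha>))"
  by (intro bij_betwI[where g="refl \<alpha>"]) (auto simp: Inv_def)

text \<open>The reflection permutes the positive roots that it keeps positive and negates their
  pairings with the coroot, so these cancel.\<close>

lemma two_rho_sum: assumes "\<alpha> \<in> Pos"
  shows "coroot \<alpha> \<bullet> rho2 = (\<Sum>\<gamma>\<in>Inv (refl \<alpha>). coroot \<alpha> \<bullet> \<gamma>)"
proof -
  let ?S = "Inv (refl \<alpha>)"
  have S: "?S \<subseteq> Pos" by (auto simp: Inv_def)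
  have "(\<Sum>\<gamma>\<in>Pos - ?S. coroot \<alpha> \<bullet> refl \<alpha> \<gamma>) = (\<Sum>\<gamma>\<in>Pos - ?S. coroot \<alpha> \<bullet> \<gamma>)"
    using sum.reindex_bij_betw[OF refl_bij[OF assms], of "\<lambda>\<gamma>. coroot \<alpha> \<bullet> \<gamma>"] by simp
  moreover have "coroot \<alpha> \<bullet> refl \<alpha> \<gamma> = - (coroot \<alpha> \<bullet> \<gamma>)" for \<gamma>
    using coroot_self[OF Pos_R[OF assms]]
    by (simp add: refl_coroot inner_diff_right inner_commute)
  ultimately have "(\<Sum>\<gamma>\<in>Pos - ?S. coroot \<alpha> \<bullet> \<gamma>) = 0" by (simp add: sum_negf)
  then show ?thesis
    using sum.subset_diff[OF S finPos, of "\<lambda>\<gamma>. coroot \<alpha> \<bullet> \<gamma>"] by (simp add: rho2_def inner_sum_right)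
qed

lemma two_rho_ge: assumes "\<alpha> \<in> Pos" shows "coroot \<alpha> \<bullet> rho2 \<ge> 2"
proof -
  have "coroot \<alpha> \<bullet> \<alpha> \<le> (\<Sum>\<gamma>\<in>Inv (refl \<alpha>). coroot \<alpha> \<bullet> \<gamma>)"
    using Inv_refl_pair[OF assms] Inv_refl_self[OF assms]
    by (intro member_le_sum finite_Inv) (auto, fastforce)
  then show ?thesis using two_rho_sum[OF assms] coroot_self[OF Pos_R[OF assms]] by (simp add: inner_commute)
qed

text \<open>The change of the semi-infinite length
  \<open>\<ell>(u) + \<langle>m, 2\<rho>\<rangle>\<close> when \<open>u\<close> is reflected in
  \<open>\<alpha>\<close> and \<open>m\<close> grows by \<open>j\<close> coroots; it does not depend
  on \<open>m\<close>.\<close>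

abbreviation incr :: "('a \<Rightarrow> 'a) \<Rightarrow> 'a \<Rightarrow> int \<Rightarrow> real" where
  "incr u \<alpha> j \<equiv> real (card (Inv (u \<circ> refl \<alpha>))) - real (card (Inv u)) +
    of_int j * (coroot \<alpha> \<bullet> rho2)"

text \<open>For a root \<open>\<beta>\<close> this is the least \<open>k\<close> such that
  \<open>(\<beta>, k)\<close> is a positive affine root.\<close>

definition ng :: "'a \<Rightarrow> int" where "ng \<beta> = (if \<beta> \<in> Pos then 0 else 1)"

lemma card_eq_sum_ng:
  assumes "finite S" shows "int (card {\<gamma>\<in>S. f \<gamma> \<notin> Pos}) = (\<Sum>\<gamma>\<in>S. ng (f \<gamma>))"
proof -
  have "int (card {\<gamma>\<in>S. f \<gamma> \<notin> Pos}) = (\<Sum>\<gamma>\<in>S. if f \<gamma> \<notin> Pos then 1 else 0)"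
    using assms by (simp add: sum.If_cases Int_def)
  also have "\<dots> = (\<Sum>\<gamma>\<in>S. ng (f \<gamma>))" by (intro sum.cong) (auto simp: ng_def)
  finally show ?thesis .
qed

text \<open>Roots that \<open>refl \<alpha>\<close> keeps positive contribute equally to both
  lengths. On the others, \<open>u (refl \<alpha> \<gamma>)\<close> is negative iff
  \<open>u (- refl \<alpha> \<gamma>)\<close> is positive.\<close>

lemma length_refl: assumes u: "u \<in> W" and a: "\<alpha> \<in> Pos"
  shows "int (card (Inv (u \<circ> refl \<alpha>))) - int (card (Inv u)) =
    (\<Sum>\<gamma>\<in>Inv (refl \<alpha>). 1 - ng (u \<gamma>) - ng (u (- refl \<alpha> \<gamma>)))"
proof -
  let ?S = "Inv (refl \<alpha>)" and ?u = "u \<circ> refl \<alpha>"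
  have SP: "\<gamma> \<in> ?S \<Longrightarrow> \<gamma> \<in> Pos" for \<gamma> by (auto simp: Inv_def)
  have split: "card (Inv w) = card (Inv w - ?S) + card {\<gamma>\<in>?S. w \<gamma> \<notin> Pos}" for w
  proof -
    have "Inv w = (Inv w - ?S) \<union> {\<gamma>\<in>?S. w \<gamma> \<notin> Pos}" by (auto simp: Inv_def)
    moreover have "card ((Inv w - ?S) \<union> {\<gamma>\<in>?S. w \<gamma> \<notin> Pos}) = card (Inv w - ?S) + card {\<gamma>\<in>?S. w \<gamma> \<notin> Pos}"
      by (intro card_Un_disjoint) (auto simp: finite_Inv)
    ultimately show ?thesis by simp
  qed
  have "bij_betw (refl \<alpha>) (Inv ?u - ?S) (Inv u - ?S)"
    by (intro bij_betwI[where g="refl \<alpha>"]) (auto simp: Inv_def)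
  then have e1: "card (Inv ?u - ?S) = card (Inv u - ?S)" by (rule bij_betw_same_card)
  have ngf: "ng (?u \<gamma>) = 1 - ng (u (- refl \<alpha> \<gamma>))" if "\<gamma> \<in> ?S" for \<gamma>
  proof -
    have "refl \<alpha> \<gamma> \<in> R" using that a by (simp add: refl_R Pos_R SP)
    then have "u (refl \<alpha> \<gamma>) \<in> R" using W_R[OF u] by blast
    then show ?thesis by (simp add: ng_def W_uminus[OF u] Pos_uminus)
  qed
  have "int (card {\<gamma>\<in>?S. ?u \<gamma> \<notin> Pos}) = (\<Sum>\<gamma>\<in>?S. 1 - ng (u (- refl \<alpha> \<gamma>)))"
    unfolding card_eq_sum_ng[OF finite_Inv] using ngf by (intro sum.cong) auto
  then show ?thesis
    unfolding split[of ?u] split[of u] e1 using card_eq_sum_ng[OF finite_Inv, of "refl \<alpha>" u]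
    by (simp add: sum_subtractf)
qed

lemma lev_pos_ng: "\<beta> \<in> R \<Longrightarrow> lev (\<beta>, of_int k) > 0 \<longleftrightarrow> k \<ge> ng \<beta>"
  by (simp add: lev_pos_iff ng_def)

text \<open>The covering condition counts lattice points: each \<open>\<gamma>\<close> inverted by \<open>refl \<alpha>\<close> contributes
  \<open>1 + j \<langle>\<alpha>\<^sup>\<or>,\<gamma>\<rangle> - ng (u \<gamma>) - ng (- u (refl \<alpha> \<gamma>)) \<ge> 0\<close> of them, and these contributions sum up to
  the change of semi-infinite length.\<close>

lemma cov_condition:
  assumes u: "u \<in> W" and m: "m \<in> CW" and a: "\<alpha> \<in> Pos" and j: "lev (u \<alpha>, of_int j) > 0"
  shows "(\<forall>c\<in>AR. between (aff u m) (\<alpha>, of_int j + m \<bullet> \<alpha>) c \<longrightarrow> c = (\<alpha>, of_int j + m \<bullet> \<alpha>)) \<longleftrightarrow>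
    incr u \<alpha> j = 1"
    (is "?C \<longleftrightarrow> ?E")
    and "incr u \<alpha> j = 1
      \<Longrightarrow> j = ng (u \<alpha>)"
    and "incr u \<alpha> j \<ge> 1"
proof -
  let ?S = "Inv (refl \<alpha>)" and ?a = "(\<alpha>, of_int j + m \<bullet> \<alpha>)"
  have aR: "\<alpha> \<in> R" using a Pos_R by blast
  have aA: "?a \<in> AR" using step_root[OF aR m] by blast
  have SR: "\<gamma> \<in> R" "\<gamma> \<in> Pos" "refl \<alpha> \<gamma> \<in> R" "- refl \<alpha> \<gamma> \<in> R" if "\<gamma> \<in> ?S" for \<gamma>
    using that aR Pos_R refl_R by (auto simp: Inv_def)
  obtain n :: "'a \<Rightarrow> int" where n: "\<And>\<gamma>. \<gamma> \<in> ?S \<Longrightarrow> coroot \<alpha> \<bullet> \<gamma> = of_int (n \<gamma>)"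
    "\<And>\<gamma>. \<gamma> \<in> ?S \<Longrightarrow> n \<gamma> \<ge> 1" using Inv_refl_pair[OF a] by metis
  \<comment> \<open>Once shown nonnegative, this is the number of integers \<open>i\<close> from
    \<open>ng (u \<gamma>)\<close> to
    \<open>n \<gamma> * j - ng (u (- refl \<alpha> \<gamma>))\<close>, both included, hence of the
    affine roots over \<open>\<gamma>\<close> that satisfy \<open>between\<close>.\<close>
  define t where "t \<gamma> = 1 + j * n \<gamma> - ng (u \<gamma>) - ng (u (- refl \<alpha> \<gamma>))" for \<gamma>
  have aS: "\<alpha> \<in> ?S" using Inv_refl_self[OF a] .
  have na: "n \<alpha> = 2" using n(1)[OF aS] coroot_self[OF aR] by (simp add: inner_commute)
  have j1: "j \<ge> ng (u \<alpha>)" using j lev_pos_ng[OF W_R[OF u aR]] by simp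
  have ng01: "ng \<beta> = 0 \<or> ng \<beta> = 1" for \<beta> by (simp add: ng_def)
  have t_nonneg: "t \<gamma> \<ge> 0" if g: "\<gamma> \<in> ?S" for \<gamma>
  proof (cases "j \<ge> 1")
    case True
    then have "j * n \<gamma> \<ge> 1" using n(2)[OF g] by (metis mult_mono' mult_1 zero_le_one)
    then show ?thesis using ng01[of "u \<gamma>"] ng01[of "u (- refl \<alpha> \<gamma>)"] unfolding t_def by linarith
  next
    case False
    then have j0: "j = 0" "u \<alpha> \<in> Pos" using j1 by (auto simp: ng_def split: if_splits)
    \<comment> \<open>For \<open>j = 0\<close> the term is negative only if both roots are, but they
      add up to a positive multiple of the positive root \<open>u \<alpha>\<close>.\<close>
    have "u \<gamma> \<in> Pos \<or> u (- refl \<alpha> \<gamma>) \<in> Pos"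
    proof (rule ccontr)
      assume "\<not> ?thesis"
      then have "u \<gamma> \<bullet> p0 \<le> 0" "u (- refl \<alpha> \<gamma>) \<bullet> p0 \<le> 0"
        using p0_root(2) W_R[OF u] SR[OF g] by force+
      moreover have "u (- refl \<alpha> \<gamma>) = of_int (n \<gamma>) *\<^sub>R u \<alpha> - u \<gamma>"
        using n(1)[OF g] by (simp add: refl_coroot W_diff[OF u] W_scale[OF u] inner_commute)
      ultimately have "of_int (n \<gamma>) * (u \<alpha> \<bullet> p0) \<le> 0" by (simp add: inner_diff_left)
      moreover have "u \<alpha> \<bullet> p0 > 0" using j0 p0_root(2)[OF W_R[OF u aR]] by simp
      ultimately show False using n(2)[OF g] by (simp add: mult_le_0_iff)
    qed
    then show ?thesis using j0 ng01[of "u \<gamma>"] ng01[of "u (- refl \<alpha> \<gamma>)"] unfolding t_def by (auto simp: ng_def)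
  qed
  have ta: "t \<alpha> = 1 + 2 * (j - ng (u \<alpha>))" by (simp add: t_def na refl_self)
  have S_eq: "incr u \<alpha> j
      = of_int (\<Sum>\<gamma>\<in>?S. t \<gamma>)"
  proof -
    have "coroot \<alpha> \<bullet> rho2 = of_int (\<Sum>\<gamma>\<in>?S. n \<gamma>)"
      unfolding two_rho_sum[OF a] using n(1) by simp
    moreover have "real (card (Inv (u \<circ> refl \<alpha>))) - real (card (Inv u)) =
       of_int (\<Sum>\<gamma>\<in>?S. 1 - ng (u \<gamma>) - ng (u (- refl \<alpha> \<gamma>)))"
      unfolding length_refl[OF u a, symmetric] by simp
    ultimately have "incr u \<alpha> j
      = of_int ((\<Sum>\<gamma>\<in>?S. 1 - ng (u \<gamma>) - ng (u (- refl \<alpha> \<gamma>))) + j * (\<Sum>\<gamma>\<in>?S. n \<gamma>))" by simp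
    also have "(\<Sum>\<gamma>\<in>?S. 1 - ng (u \<gamma>) - ng (u (- refl \<alpha> \<gamma>))) + j * (\<Sum>\<gamma>\<in>?S. n \<gamma>) = (\<Sum>\<gamma>\<in>?S. t \<gamma>)"
      unfolding sum_distrib_left sum.distrib[symmetric] by (intro sum.cong) (auto simp: t_def)
    finally show ?thesis .
  qed
  have sum_split: "(\<Sum>\<gamma>\<in>?S. t \<gamma>) = t \<alpha> + (\<Sum>\<gamma>\<in>?S - {\<alpha>}. t \<gamma>)"
    using sum.remove[OF finite_Inv aS] by blast
  have rest: "(\<Sum>\<gamma>\<in>?S - {\<alpha>}. t \<gamma>) \<ge> 0" using t_nonneg by (intro sum_nonneg) auto
  show ge: "incr u \<alpha> j \<ge> 1"
  proof -
    have "(\<Sum>\<gamma>\<in>?S. t \<gamma>) \<ge> 1" unfolding sum_split ta using rest j1 by simp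
    then show ?thesis unfolding S_eq by linarith
  qed
  \<comment> \<open>Since \<open>\<alpha>\<close> pairs to 2 with its coroot, its own term is at
    least 1, with equality iff \<open>j\<close> is minimal. The sum is 1 iff, moreover, all other
    terms vanish.\<close>
  have E_iff: "?E \<longleftrightarrow> j = ng (u \<alpha>) \<and> (\<forall>\<gamma>\<in>?S - {\<alpha>}. t \<gamma> = 0)"
  proof -
    have "?E \<longleftrightarrow> t \<alpha> + (\<Sum>\<gamma>\<in>?S - {\<alpha>}. t \<gamma>) = 1"
      unfolding S_eq sum_split by (metis of_int_eq_1_iff)
    also have "\<dots> \<longleftrightarrow> j = ng (u \<alpha>) \<and> (\<Sum>\<gamma>\<in>?S - {\<alpha>}. t \<gamma>) = 0" unfolding ta using rest j1 by auto
    also have "\<dots> \<longleftrightarrow> j = ng (u \<alpha>) \<and> (\<forall>\<gamma>\<in>?S - {\<alpha>}. t \<gamma> = 0)"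
      using t_nonneg finite_Inv by (subst sum_nonneg_eq_0_iff) auto
    finally show ?thesis .
  qed
  show "?E \<Longrightarrow> j = ng (u \<alpha>)" using E_iff by blast
  have C_iff: "?C \<longleftrightarrow> (\<forall>\<gamma>\<in>?S. \<forall>i::int. i \<ge> ng (u \<gamma>) \<and> n \<gamma> * j - i \<ge> ng (u (- refl \<alpha> \<gamma>)) \<longrightarrow> \<gamma> = \<alpha> \<and> i = j)"
  proof -
    have key: "between (aff u m) ?a c \<longleftrightarrow>
       \<gamma> \<in> ?S \<and> i \<ge> ng (u \<gamma>) \<and> n \<gamma> * j - i \<ge> ng (u (- refl \<alpha> \<gamma>))"
      if c: "c = (\<gamma>, of_int i + m \<bullet> \<gamma>)" and g: "\<gamma> \<in> R" for c \<gamma> i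
    proof -
      have f: "fst (arefl ?a c) = refl \<alpha> \<gamma>" by (simp add: arefl_def c refl_coroot)
      have 1: "rp c \<and> \<not> rp (arefl ?a c) \<longleftrightarrow> \<gamma> \<in> ?S" by (simp add: rp_def f Inv_def) (simp add: c)
      have 2: "lev (aff u m c) > 0 \<longleftrightarrow> i \<ge> ng (u \<gamma>)"
        unfolding c step_root(2)[OF g m] using lev_pos_ng[OF W_R[OF u g]] by simp
      have 3: "lev (aff u m (arefl ?a c)) < 0 \<longleftrightarrow> n \<gamma> * j - i \<ge> ng (u (- refl \<alpha> \<gamma>))" if gS: "\<gamma> \<in> ?S"
      proof -
        have "- aff u m (arefl ?a c) = (u (- refl \<alpha> \<gamma>), of_int (n \<gamma> * j - i))"
          using n(1)[OF gS]
          by (simp add: aff_def f W_uminus[OF u]) (simp add: arefl_def c refl_coroot inner_diff_right inner_commute algebra_simps)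
        then have "lev (- aff u m (arefl ?a c)) > 0 \<longleftrightarrow> n \<gamma> * j - i \<ge> ng (u (- refl \<alpha> \<gamma>))"
          using lev_pos_ng[OF W_R[OF u SR(4)[OF gS]], of "n \<gamma> * j - i"] by simp
        then show ?thesis by (simp add: lev_linear)
      qed
      show ?thesis using 1 2 3 by blast
    qed
    show ?thesis
    proof (intro iffI ballI allI impI)
      fix \<gamma> i assume C: ?C and g: "\<gamma> \<in> ?S" and i: "ng (u \<gamma>) \<le> i \<and> ng (u (- refl \<alpha> \<gamma>)) \<le> n \<gamma> * j - i"
      have "(\<gamma>, of_int i + m \<bullet> \<gamma>) \<in> AR" using step_root(1)[OF SR(1)[OF g] m] .
      then have "(\<gamma>, of_int i + m \<bullet> \<gamma>) = ?a" using C key[OF refl SR(1)[OF g], of i] g i by blast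
      then show "\<gamma> = \<alpha> \<and> i = j" by auto
    next
      fix c assume H: "\<forall>\<gamma>\<in>?S. \<forall>i. ng (u \<gamma>) \<le> i \<and> ng (u (- refl \<alpha> \<gamma>)) \<le> n \<gamma> * j - i \<longrightarrow> \<gamma> = \<alpha> \<and> i = j"
        and c: "c \<in> AR" and cc: "between (aff u m) ?a c"
      have "snd c - m \<bullet> fst c \<in> \<int>" using c m by (auto simp: AR_def CW_def)
      then obtain i where "snd c - m \<bullet> fst c = of_int i" by (elim Ints_cases)
      then have ce: "c = (fst c, of_int i + m \<bullet> fst c)" by (simp add: prod_eq_iff)
      have "fst c \<in> R" using c by (auto simp: AR_def)
      from key[OF ce this] cc H have "fst c = \<alpha> \<and> i = j" by blast
      then show "c = ?a" using ce by metis
    qed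
  qed
  show "?C \<longleftrightarrow> ?E"
    unfolding C_iff E_iff
  proof (intro iffI conjI ballI allI impI)
    assume H: "\<forall>\<gamma>\<in>?S. \<forall>i. ng (u \<gamma>) \<le> i \<and> ng (u (- refl \<alpha> \<gamma>)) \<le> n \<gamma> * j - i \<longrightarrow> \<gamma> = \<alpha> \<and> i = j"
    have "ng (u (- refl \<alpha> \<alpha>)) \<le> n \<alpha> * j - ng (u \<alpha>)" using j1 by (simp add: refl_self na)
    then show "j = ng (u \<alpha>)" using H aS by blast
    fix \<gamma> assume g: "\<gamma> \<in> ?S - {\<alpha>}"
    then have "\<not> ng (u (- refl \<alpha> \<gamma>)) \<le> n \<gamma> * j - ng (u \<gamma>)" using H by blast
    then show "t \<gamma> = 0" using t_nonneg[of \<gamma>] g by (simp add: t_def mult.commute)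
  next
    fix \<gamma> i assume H: "j = ng (u \<alpha>) \<and> (\<forall>\<gamma>\<in>?S - {\<alpha>}. t \<gamma> = 0)" and g: "\<gamma> \<in> ?S"
      and i: "ng (u \<gamma>) \<le> i \<and> ng (u (- refl \<alpha> \<gamma>)) \<le> n \<gamma> * j - i"
    have "t \<gamma> \<noteq> 0" using i unfolding t_def by (auto simp: mult.commute)
    then show "\<gamma> = \<alpha>" using H g by blast
    with i H show "i = j" by (simp add: na refl_self)
  qed
qed

lemma cov_aff_iff:
  assumes u: "u \<in> W" and m: "m \<in> CW"
  shows "cov (aff u m) z \<longleftrightarrow> (\<exists>\<alpha>\<in>Pos. \<exists>j::int. lev (u \<alpha>, of_int j) > 0 \<and>
     z = aff (u \<circ> refl \<alpha>) (m + of_int j *\<^sub>R coroot \<alpha>) \<and>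
     incr u \<alpha> j = 1)"
proof
  assume "cov (aff u m) z"
  then obtain a where a: "a \<in> AR" "rp a" "lev (aff u m a) > 0" "z = aff u m \<circ> arefl a"
    "\<forall>c\<in>AR. between (aff u m) a c \<longrightarrow> c = a"
    unfolding cov_def by blast
  have aR: "fst a \<in> R" using a by (auto simp: AR_def)
  have "snd a - m \<bullet> fst a \<in> \<int>" using a m by (auto simp: AR_def CW_def)
  then obtain j where "snd a - m \<bullet> fst a = of_int j" by (elim Ints_cases)
  then have ae: "a = (fst a, of_int j + m \<bullet> fst a)" by (simp add: prod_eq_iff)
  have P: "fst a \<in> Pos" using a(2) by (simp add: rp_def)
  have l: "lev (u (fst a), of_int j) > 0" using a(3) step_root(2)[OF aR m] ae by metis
  have z: "z = aff (u \<circ> refl (fst a)) (m + of_int j *\<^sub>R coroot (fst a))"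
    using a(4) step_root(3)[OF aR m] ae by metis
  show "\<exists>\<alpha>\<in>Pos. \<exists>j::int. lev (u \<alpha>, of_int j) > 0 \<and>
     z = aff (u \<circ> refl \<alpha>) (m + of_int j *\<^sub>R coroot \<alpha>) \<and>
     incr u \<alpha> j = 1"
    using cov_condition(1)[OF u m P l] a(5) ae l z P by metis
next
  assume "\<exists>\<alpha>\<in>Pos. \<exists>j::int. lev (u \<alpha>, of_int j) > 0 \<and>
     z = aff (u \<circ> refl \<alpha>) (m + of_int j *\<^sub>R coroot \<alpha>) \<and>
     incr u \<alpha> j = 1"
  then obtain \<alpha> j where a: "\<alpha> \<in> Pos" "lev (u \<alpha>, of_int j) > 0"
     "z = aff (u \<circ> refl \<alpha>) (m + of_int j *\<^sub>R coroot \<alpha>)"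
     "incr u \<alpha> j = 1" by blast
  note sr = step_root[OF Pos_R[OF a(1)] m]
  show "cov (aff u m) z"
    unfolding cov_def
    using cov_condition(1)[OF u m a(1,2)] a sr
    by (intro bexI[OF _ sr(1)[of j]]) (auto simp: rp_def)
qed

text \<open>A quantum edge is the case \<open>j = 1\<close>, where \<open>(u \<alpha>, 1)\<close> is
  positive automatically. A Bruhat edge is the case \<open>j = 0\<close>, where
  \<open>u \<alpha>\<close> has to be positive: otherwise the reverse step would increase the
  length.\<close>

lemma qb_edge_cov:
  assumes u: "u \<in> W" and m: "m \<in> CW" and e: "qb_edge R \<Delta> u \<alpha>"
  shows "cov (aff u m) (aff (u \<circ> refl \<alpha>) (m + qb_edge_wt R \<Delta> u \<alpha>))" "\<alpha> \<in> Pos"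
    "real (card (Inv (u \<circ> refl \<alpha>))) - real (card (Inv u)) + qb_edge_wt R \<Delta> u \<alpha> \<bullet> rho2 = 1"
    "qb_edge_wt R \<Delta> u \<alpha> \<in> CW"
proof -
  show a: "\<alpha> \<in> Pos" using e by (auto simp: qb_edge_def qb_bruhat_edge_def qb_quantum_edge_def)
  have aR: "\<alpha> \<in> R" "u \<alpha> \<in> R" using a Pos_R W_R[OF u] by auto
  have ua: "u \<circ> refl \<alpha> \<in> W" using u aR by (intro W_comp W_refl)
  have len: "wlen \<Delta> u = card (Inv u)" "wlen \<Delta> (u \<circ> refl \<alpha>) = card (Inv (u \<circ> refl \<alpha>))"
    using wlen_Inv u ua by auto
  show "qb_edge_wt R \<Delta> u \<alpha> \<in> CW" using aR by (simp add: qb_edge_wt_def CW_zero CW_coroot)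
  have *: "\<exists>j::int. lev (u \<alpha>, of_int j) > 0 \<and> qb_edge_wt R \<Delta> u \<alpha> = of_int j *\<^sub>R coroot \<alpha> \<and>
     incr u \<alpha> j = 1"
  proof (cases "qb_quantum_edge R \<Delta> u \<alpha>")
    case True
    then show ?thesis using lev_one[OF aR(2)]
      by (intro exI[of _ 1]) (simp add: qb_edge_wt_def qb_quantum_edge_def len two_rho_pair_eq)
  next
    case False
    then have b: "qb_bruhat_edge R \<Delta> u \<alpha>" using e by (simp add: qb_edge_def)
    have "u \<alpha> \<in> Pos"
    proof (rule ccontr)
      assume "u \<alpha> \<notin> Pos"
      then have "(u \<circ> refl \<alpha>) \<alpha> \<in> Pos" using aR by (simp add: refl_self W_uminus[OF u] Pos_uminus)
      then have "lev ((u \<circ> refl \<alpha>) \<alpha>, of_int 0) > 0" using lev_P0 Pos_R by simp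
      moreover have uu: "u \<circ> refl \<alpha> \<circ> refl \<alpha> = u" by (simp add: fun_eq_iff)
      ultimately have "real (card (Inv u)) - real (card (Inv (u \<circ> refl \<alpha>))) \<ge> 1"
        using cov_condition(3)[OF ua m a, of 0] unfolding uu of_int_0 mult_zero_left add_0_right by blast
      then show False using b by (simp add: qb_bruhat_edge_def len)
    qed
    then show ?thesis using b False lev_P0[OF aR(2)]
      by (intro exI[of _ 0]) (simp add: qb_edge_wt_def qb_bruhat_edge_def len)
  qed
  show "cov (aff u m) (aff (u \<circ> refl \<alpha>) (m + qb_edge_wt R \<Delta> u \<alpha>))"
  proof -
    from * obtain j :: int where "lev (u \<alpha>, of_int j) > 0" "qb_edge_wt R \<Delta> u \<alpha> = of_int j *\<^sub>R coroot \<alpha>"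
      "incr u \<alpha> j = 1" by blast
    then show ?thesis unfolding cov_aff_iff[OF u m] by (intro bexI[OF _ a] exI[of _ j]) simp
  qed
  show "real (card (Inv (u \<circ> refl \<alpha>))) - real (card (Inv u)) + qb_edge_wt R \<Delta> u \<alpha> \<bullet> rho2 = 1"
    using * by auto
qed

text \<open>A covering uses the least admissible \<open>j\<close>, which is 0 or 1. For
  \<open>j = 0\<close> the edge cannot be quantum as well, because the coroot pairs with
  \<open>rho2\<close> to at least 2; so its weight is 0.\<close>

lemma cov_qb_edge:
  assumes u: "u \<in> W" and m: "m \<in> CW" and c: "cov (aff u m) z"
  shows "\<exists>\<alpha>\<in>Pos. qb_edge R \<Delta> u \<alpha> \<and> z = aff (u \<circ> refl \<alpha>) (m + qb_edge_wt R \<Delta> u \<alpha>)"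
proof -
  from c obtain \<alpha> j where a: "\<alpha> \<in> Pos" "lev (u \<alpha>, of_int j) > 0"
     "z = aff (u \<circ> refl \<alpha>) (m + of_int j *\<^sub>R coroot \<alpha>)"
     "incr u \<alpha> j = 1"
    unfolding cov_aff_iff[OF u m] by blast
  have ua: "u \<circ> refl \<alpha> \<in> W" using u a Pos_R by (intro W_comp W_refl) auto
  have len: "wlen \<Delta> u = card (Inv u)" "wlen \<Delta> (u \<circ> refl \<alpha>) = card (Inv (u \<circ> refl \<alpha>))"
    using wlen_Inv u ua by auto
  have "j = 0 \<or> j = 1" using cov_condition(2)[OF u m a(1,2,4)] by (simp add: ng_def)
  then show ?thesis
  proof
    assume j: "j = 0"
    then have "real (card (Inv (u \<circ> refl \<alpha>))) = real (card (Inv u)) + 1" using a(4) by simp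
    then have b: "card (Inv (u \<circ> refl \<alpha>)) = card (Inv u) + 1" by linarith
    then have "\<not> qb_quantum_edge R \<Delta> u \<alpha>"
      using two_rho_ge[OF a(1)] by (simp add: qb_quantum_edge_def len two_rho_pair_eq)
    with b show ?thesis using a j
      by (intro bexI[OF _ a(1)]) (simp add: qb_edge_def qb_bruhat_edge_def qb_edge_wt_def len)
  next
    assume j: "j = 1"
    then have "qb_quantum_edge R \<Delta> u \<alpha>"
      using a by (simp add: qb_quantum_edge_def len two_rho_pair_eq)
    then show ?thesis using a j by (intro bexI[OF _ a(1)]) (simp add: qb_edge_def qb_edge_wt_def)
  qed
qed

text \<open>Every edge raises the semi-infinite length by exactly 1, so the number of edges is
  determined by the end points and the weight.\<close>

lemma qb_path_sle:
  assumes "u \<in> W" "m \<in> CW" "qb_path R \<Delta> u as u'"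
  shows "u' \<in> W \<and> sle (aff u m) (aff u' (m + qb_path_wt R \<Delta> u as)) \<and>
    real (length as) = real (card (Inv u')) - real (card (Inv u)) + qb_path_wt R \<Delta> u as \<bullet> rho2"
  using assms
proof (induction as arbitrary: u m)
  case (Cons \<alpha> as)
  define u1 where "u1 = u \<circ> refl \<alpha>"
  have e: "qb_edge R \<Delta> u \<alpha>" and p: "qb_path R \<Delta> u1 as u'" using Cons.prems by (auto simp: u1_def)
  note qe = qb_edge_cov[OF Cons.prems(1,2) e, folded u1_def]
  have ua: "u1 \<in> W" unfolding u1_def using Cons.prems qe Pos_R by (intro W_comp W_refl) auto
  have m': "m + qb_edge_wt R \<Delta> u \<alpha> \<in> CW" using Cons.prems qe by (intro CW_add)
  from Cons.IH[OF ua m' p] qe(3) show ?case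
    using sle_trans[OF cov_sle[OF qe(1)]] unfolding qb_path_wt.simps u1_def[symmetric]
    by (auto simp: add.assoc inner_add_left)
qed simp

lemma sle_qb_path:
  assumes "sle (aff u m) (aff u' m')" "u \<in> W" "m \<in> CW"
  shows "\<exists>as. qb_path R \<Delta> u as u' \<and> m' = m + qb_path_wt R \<Delta> u as"
proof -
  have "\<forall>u m. z = aff u m \<longrightarrow> u \<in> W \<longrightarrow> m \<in> CW \<longrightarrow> (\<exists>as. qb_path R \<Delta> u as u' \<and> m' = m + qb_path_wt R \<Delta> u as)"
    if "sle z (aff u' m')" for z
    using that unfolding sle_def
  proof (induction rule: converse_rtranclp_induct)
    case base
    then show ?case using aff_inj by (intro allI impI exI[of _ "[]"]) auto
  next
    case (step y z)
    show ?case
    proof (intro allI impI)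
      fix u m assume y: "y = aff u m" "u \<in> W" "m \<in> CW"
      from step(1) cov_qb_edge[OF y(2,3)] obtain \<alpha> where a: "\<alpha> \<in> Pos" "qb_edge R \<Delta> u \<alpha>"
        "z = aff (u \<circ> refl \<alpha>) (m + qb_edge_wt R \<Delta> u \<alpha>)" unfolding y(1) by blast
      have ua: "u \<circ> refl \<alpha> \<in> W" using y a Pos_R by (intro W_comp W_refl) auto
      have "m + qb_edge_wt R \<Delta> u \<alpha> \<in> CW" using y qb_edge_cov[OF y(2,3) a(2)] by (intro CW_add)
      with step(3) a(3) ua obtain as where "qb_path R \<Delta> (u \<circ> refl \<alpha>) as u'"
        "m' = m + qb_edge_wt R \<Delta> u \<alpha> + qb_path_wt R \<Delta> (u \<circ> refl \<alpha>) as" by blast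
      then show "\<exists>as. qb_path R \<Delta> u as u' \<and> m' = m + qb_path_wt R \<Delta> u as"
        using a by (intro exI[of _ "\<alpha> # as"]) (simp add: add.assoc)
    qed
  qed
  then show ?thesis using assms by blast
qed

text \<open>As \<open>(\<beta>, 1)\<close> is positive for every root \<open>\<beta>\<close>, each
  reflection can be performed as an ascending step with \<open>j = 1\<close>; a word for
  \<open>inv u \<circ> u'\<close> then joins the finite parts.\<close>

lemma sle_connected:
  assumes "u \<in> W" "u' \<in> W"
  shows "\<exists>x. x \<in> CW \<and> sle (aff u 0) (aff u' x)"
proof -
  have 1: "\<exists>x\<in>CW. sle (aff u m) (aff (u \<circ> refl \<alpha>) x)" if "\<alpha> \<in> Pos" "u \<in> W" "m \<in> CW" for \<alpha> u m
    using sle_refl_step[OF that, of 1] lev_one[OF W_R[OF that(2) Pos_R[OF that(1)]]] that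
    by (auto intro!: bexI[of _ "m + coroot \<alpha>"] CW_add CW_coroot Pos_R)
  have "set as \<subseteq> R \<Longrightarrow> u \<in> W \<Longrightarrow> m \<in> CW \<Longrightarrow> \<exists>x\<in>CW. sle (aff u m) (aff (u \<circ> rword as) x)" for as u m
  proof (induction as arbitrary: u m)
    case (Cons \<alpha> as)
    then have aR: "\<alpha> \<in> R" by simp
    define u1 where "u1 = u \<circ> refl \<alpha>"
    have ua: "u1 \<in> W" unfolding u1_def using Cons.prems aR by (intro W_comp W_refl)
    obtain x where x: "x \<in> CW" "sle (aff u m) (aff u1 x)"
      using 1[of \<alpha> u m] 1[of "-\<alpha>" u m] Pos_uminus[OF aR] Cons.prems refl_uminus
      unfolding u1_def by metis
    have "set as \<subseteq> R" using Cons.prems by simp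
    from Cons.IH[OF this ua x(1)] obtain y where "y \<in> CW"
      "sle (aff u1 x) (aff (u1 \<circ> rword as) y)" by blast
    then show ?case using x sle_trans unfolding u1_def by (metis comp_assoc rword_Cons)
  qed (auto intro: sle_refl)
  moreover obtain as where "set as \<subseteq> R" "inv u \<circ> u' = rword as"
    using weyl_rword W_comp W_inv_ex assms by metis
  moreover have "u \<circ> (inv u \<circ> u') = u'" using W_inv_r[OF assms(1)] by (simp add: fun_eq_iff)
  ultimately show ?thesis using assms CW_zero by metis
qed

section \<open>Least weights and shortest paths\<close>

definition kappa :: 'a where "kappa = (\<Sum>\<gamma>\<in>Pos. coroot \<gamma>)"

lemma kappa_CW: "kappa \<in> CW"
  unfolding kappa_def by (intro PC_CW nspan_sum nspan_base) auto

lemma PC_rho2: "x \<in> PC \<Longrightarrow> x \<bullet> rho2 \<ge> 0"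
  by (induction x rule: nspan.induct) (use two_rho_ge in \<open>fastforce simp: inner_add_left\<close>)+

lemma PC_rho2_zero: "x \<in> PC \<Longrightarrow> x \<bullet> rho2 \<le> 0 \<Longrightarrow> x = 0"
proof (induction x rule: nspan.induct)
  case (nspan_add v a)
  then show ?case using PC_rho2[of v] two_rho_ge by (fastforce simp: inner_add_left)
qed simp

text \<open>Positive roots that are not images of positive roots enter \<open>y kappa\<close>
  negated, so the difference is twice their coroot sum; for \<open>y \<noteq> id\<close> there is at
  least one such root.\<close>

lemma kappa_less: assumes y: "y \<in> W" "y \<noteq> id" shows "y kappa \<bullet> rho2 \<le> kappa \<bullet> rho2 - 2"
proof -
  have inj: "inj_on y Pos" using W_inv_ex(1)[OF y(1)] by (meson bij_is_inj inj_on_subset subset_UNIV)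
  let ?Q = "y ` Pos"
  have QR: "?Q \<subseteq> R" using W_R[OF y(1)] Pos_R by auto
  have "y kappa = (\<Sum>\<gamma>\<in>Pos. coroot (y \<gamma>))"
    using linear_sum[OF W_linear[OF y(1)], of coroot Pos] by (simp add: kappa_def W_coroot[OF y(1)])
  then have yk: "y kappa = (\<Sum>\<gamma>\<in>?Q. coroot \<gamma>)" by (simp add: sum.reindex[OF inj])
  have s1: "kappa = (\<Sum>\<gamma>\<in>Pos \<inter> ?Q. coroot \<gamma>) + (\<Sum>\<gamma>\<in>Pos - ?Q. coroot \<gamma>)"
    unfolding kappa_def by (rule sum.Int_Diff[OF finPos])
  have s2: "y kappa = (\<Sum>\<gamma>\<in>Pos \<inter> ?Q. coroot \<gamma>) + (\<Sum>\<gamma>\<in>?Q - Pos. coroot \<gamma>)"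
    unfolding yk using sum.Int_Diff[of ?Q coroot Pos] finPos by (simp add: Int_commute)
  have img: "?Q - Pos = uminus ` (Pos - ?Q)"
  proof
    show "?Q - Pos \<subseteq> uminus ` (Pos - ?Q)"
    proof
      fix \<gamma> assume g: "\<gamma> \<in> ?Q - Pos"
      then obtain \<beta> where b: "\<beta> \<in> Pos" "\<gamma> = y \<beta>" by blast
      have "- \<gamma> \<in> Pos" using g QR Pos_uminus by blast
      moreover have "- \<gamma> \<notin> ?Q"
      proof
        assume "- \<gamma> \<in> ?Q"
        then obtain \<delta> where d: "\<delta> \<in> Pos" "- \<gamma> = y \<delta>" by blast
        then have "y \<delta> = y (- \<beta>)" using b by (simp add: W_uminus[OF y(1)])
        then have "\<delta> = - \<beta>" using W_inv_l[OF y(1)] by metis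
        then show False using d b Pos_uminus Pos_R by blast
      qed
      ultimately show "\<gamma> \<in> uminus ` (Pos - ?Q)" by (intro image_eqI[of _ _ "- \<gamma>"]) auto
    qed
    show "uminus ` (Pos - ?Q) \<subseteq> ?Q - Pos"
    proof
      fix \<gamma> assume "\<gamma> \<in> uminus ` (Pos - ?Q)"
      then obtain \<delta> where d: "\<delta> \<in> Pos" "\<delta> \<notin> ?Q" "\<gamma> = - \<delta>" by blast
      let ?b = "inv y \<delta>"
      have bR: "?b \<in> R" using W_R W_inv_ex[OF y(1)] d Pos_R by blast
      have "?b \<notin> Pos" using d W_inv_r[OF y(1)] by (metis imageI)
      then have "- ?b \<in> Pos" using Pos_uminus bR by blast
      moreover have "\<gamma> = y (- ?b)" using d by (simp add: W_uminus[OF y(1)] W_inv_r[OF y(1)])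
      moreover have "\<gamma> \<notin> Pos" using d Pos_uminus[OF Pos_R[OF d(1)]] by simp
      ultimately show "\<gamma> \<in> ?Q - Pos" by simp
    qed
  qed
  have "(\<Sum>\<gamma>\<in>?Q - Pos. coroot \<gamma>) = - (\<Sum>\<gamma>\<in>Pos - ?Q. coroot \<gamma>)"
    unfolding img by (subst sum.reindex) (auto simp: sum_negf)
  then have d: "kappa - y kappa = 2 *\<^sub>R (\<Sum>\<gamma>\<in>Pos - ?Q. coroot \<gamma>)"
    using s1 s2 by (simp add: scaleR_2)
  have ne: "Pos - ?Q \<noteq> {}"
  proof
    assume "Pos - ?Q = {}"
    then have "Pos \<subseteq> ?Q" by blast
    then have "?Q = Pos" using finPos card_image[OF inj] by (metis card_subset_eq finite_imageI)
    then have "Inv y = {}" by (auto simp: Inv_def)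
    then show False using Inv_empty_id y by blast
  qed
  then obtain \<gamma>0 where g0: "\<gamma>0 \<in> Pos - ?Q" by blast
  have "coroot \<gamma>0 \<bullet> rho2 \<le> (\<Sum>\<gamma>\<in>Pos - ?Q. coroot \<gamma> \<bullet> rho2)"
    using finPos two_rho_ge by (intro member_le_sum[OF g0]) (auto, fastforce)
  then have "(\<Sum>\<gamma>\<in>Pos - ?Q. coroot \<gamma>) \<bullet> rho2 \<ge> 1" using two_rho_ge[of \<gamma>0] g0 by (simp add: inner_sum_left)
  then show ?thesis using arg_cong[OF d, of "\<lambda>x. x \<bullet> rho2"] by (simp add: inner_diff_left)
qed

text \<open>Apply the greatest-element lemma to a translation that is very dominant in the direction \<open>u\<close>:
  the greatest element must then have finite part \<open>u\<close>.\<close>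

lemma min_weight_ex:
  assumes u: "u \<in> W" and b: "b \<in> W"
  shows "\<exists>x\<in>CW. sle (aff u 0) (aff b x) \<and> (\<forall>m\<in>CW. sle (aff u 0) (aff b m) \<longrightarrow> m - x \<in> PC)"
proof -
  obtain x0 where x0: "x0 \<in> CW" "sle (aff u 0) (aff b x0)" using sle_connected[OF u b] by blast
  \<comment> \<open>A wrong finite part of the greatest element would cost at least
    \<open>2 n\<close> in the pairing with \<open>rho2\<close>, more than the known solution
    \<open>x0\<close> can make up for.\<close>
  obtain n :: nat where n: "real n > x0 \<bullet> rho2" using reals_Archimedean2 by blast
  have nk: "real n *\<^sub>R u kappa \<in> CW" by (rule CW_int[OF _ CW_W[OF u kappa_CW]]) simp
  let ?x = "aff id (real n *\<^sub>R u kappa)"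
  have xG: "?x \<in> G" using nk W_id by (intro aff_G)
  obtain z0 where z0: "z0 \<in> G" "sle z0 (aff b 0)"
    "\<And>z. z \<in> G \<Longrightarrow> sle z (aff b 0) \<Longrightarrow> sle (?x \<circ> z) (?x \<circ> z0)"
    using sle_max[OF aff_G[OF b CW_zero] xG] by blast
  obtain v k where vk: "z0 = aff v k" "v \<in> W" "k \<in> CW" using z0(1) by (rule GE)
  have kP: "0 - k \<in> PC" using sle_incr'(1)[OF z0(2)[unfolded vk(1)] vk(2,3)] .
  have main: "real n *\<^sub>R inv v (u kappa) + k - (real n *\<^sub>R kappa - m) \<in> PC"
    if m: "m \<in> CW" "sle (aff u 0) (aff b m)" for m
  proof -
    have um: "- m \<in> CW" using CW_uminus m by blast
    have "sle (aff u (- m)) (aff b 0)" using sle_shift[OF m(2) u CW_zero um] by simp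
    from z0(3)[OF aff_G[OF u um] this]
    have "sle (aff u (real n *\<^sub>R kappa - m)) (aff v (real n *\<^sub>R inv v (u kappa) + k))"
      using u vk(2) W_inv_ex
      by (simp add: vk(1) aff_comp W_scale W_inv_l)
    moreover have "real n *\<^sub>R kappa - m \<in> CW" by (rule CW_diff[OF CW_int[OF _ kappa_CW] m(1)]) simp
    ultimately show ?thesis using sle_incr'(1) u by blast
  qed
  have "inv v \<circ> u = id"
  proof (rule ccontr)
    assume ne: "inv v \<circ> u \<noteq> id"
    have "inv v \<circ> u \<in> W" using W_comp W_inv_ex vk u by blast
    from kappa_less[OF this ne] have kl: "inv v (u kappa) \<bullet> rho2 \<le> kappa \<bullet> rho2 - 2" by simp
    have "real n * (inv v (u kappa) \<bullet> rho2) \<le> real n * (kappa \<bullet> rho2 - 2)"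
      by (intro mult_left_mono kl) simp
    moreover have "k \<bullet> rho2 \<le> 0" using PC_rho2[OF kP] by simp
    moreover have "real n * (inv v (u kappa) \<bullet> rho2) + k \<bullet> rho2 - (real n * (kappa \<bullet> rho2) - x0 \<bullet> rho2) \<ge> 0"
      using PC_rho2[OF main[OF x0]] by (simp add: inner_add_left inner_diff_left)
    ultimately show False using n by (simp add: algebra_simps)
  qed
  then have uv: "u = v" using W_inv_r[OF vk(2)] by (metis comp_apply eq_id_iff ext)
  show ?thesis
  \<comment> \<open>With equal finite parts the dominant translation cancels from
    \<open>main\<close>, and what remains says that \<open>- k\<close> is the least weight.\<close>
  proof (intro bexI[of _ "- k"] conjI ballI impI)
    show "sle (aff u 0) (aff b (- k))"
      using sle_shift[OF z0(2)[unfolded vk(1)] vk(2,3) CW_uminus[OF vk(3)]] uv by simp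
    fix m assume "m \<in> CW" "sle (aff u 0) (aff b m)"
    from main[OF this] show "m - - k \<in> PC" using uv W_inv_l[OF vk(2)] by (simp add: algebra_simps)
  qed (use vk CW_uminus in auto)
qed

text \<open>By the length formula in \<open>qb_path_sle\<close>, the weight of a shortest path has
  the smallest pairing with \<open>rho2\<close>. It exceeds the least weight by an element of
  \<open>PC\<close>, and on \<open>PC\<close> this pairing is positive except at 0. So the choice of
  the shortest path does not affect the weight.\<close>

lemma qb_wt_min:
  assumes u: "u \<in> W" and b: "b \<in> W"
  shows "qb_wt R \<Delta> u b \<in> CW" "sle (aff u 0) (aff b (qb_wt R \<Delta> u b))"
    "m \<in> CW \<Longrightarrow> sle (aff u 0) (aff b m) \<Longrightarrow> m - qb_wt R \<Delta> u b \<in> PC"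
proof -
  obtain x where x: "x \<in> CW" "sle (aff u 0) (aff b x)"
    "\<And>m. m \<in> CW \<Longrightarrow> sle (aff u 0) (aff b m) \<Longrightarrow> m - x \<in> PC"
    using min_weight_ex[OF u b] by blast
  obtain as where as: "qb_path R \<Delta> u as b" "x = qb_path_wt R \<Delta> u as"
    using sle_qb_path[OF x(2) u CW_zero] by auto
  define P where "P bs \<longleftrightarrow> qb_path R \<Delta> u bs b \<and> length bs = qb_dist R \<Delta> u b" for bs
  have "\<exists>bs. P bs" unfolding P_def qb_dist_def by (rule LeastI2_wellorder_ex) (use as in auto)
  then have P: "P (SOME bs. P bs)" by (rule someI_ex)
  define bs where "bs = (SOME bs. P bs)"
  have bs: "qb_path R \<Delta> u bs b" "length bs = qb_dist R \<Delta> u b" using P by (auto simp: bs_def P_def)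
  have wt: "qb_wt R \<Delta> u b = qb_path_wt R \<Delta> u bs" by (simp add: qb_wt_def bs_def P_def)
  have "length bs \<le> length as" unfolding bs(2) qb_dist_def by (rule Least_le) (use as in auto)
  note pa = qb_path_sle[OF u CW_zero as(1)]
  note pb = qb_path_sle[OF u CW_zero bs(1)]
  have s: "sle (aff u 0) (aff b (qb_path_wt R \<Delta> u bs))" using pb by simp
  have bC: "qb_path_wt R \<Delta> u bs \<in> CW" using sle_incr'(3)[OF s u CW_zero] .
  have d: "qb_path_wt R \<Delta> u bs - x \<in> PC" using x(3)[OF bC s] .
  have "(qb_path_wt R \<Delta> u bs - x) \<bullet> rho2 \<le> 0"
    using pa pb as(2) \<open>length bs \<le> length as\<close> by (simp add: inner_diff_left)
  then have "qb_path_wt R \<Delta> u bs = x" using PC_rho2_zero[OF d] by simp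
  then show "qb_wt R \<Delta> u b \<in> CW" "sle (aff u 0) (aff b (qb_wt R \<Delta> u b))"
    "m \<in> CW \<Longrightarrow> sle (aff u 0) (aff b m) \<Longrightarrow> m - qb_wt R \<Delta> u b \<in> PC"
    using x wt by auto
qed

lemma sle_iff_wt:
  assumes u: "u \<in> W" and u': "u' \<in> W" and m: "m \<in> CW" and m': "m' \<in> CW"
  shows "sle (aff u m) (aff u' m') \<longleftrightarrow> m' - m - qb_wt R \<Delta> u u' \<in> PC"
proof
  assume "sle (aff u m) (aff u' m')"
  from sle_shift[OF this u m CW_uminus[OF m]] have "sle (aff u 0) (aff u' (m' - m))" by simp
  then show "m' - m - qb_wt R \<Delta> u u' \<in> PC" using qb_wt_min(3)[OF u u'] CW_diff m m' by blast
next
  let ?w = "qb_wt R \<Delta> u u'"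
  assume P: "m' - m - ?w \<in> PC"
  have "sle (aff u (0 + m)) (aff u' (?w + m))" using sle_shift[OF qb_wt_min(2)[OF u u'] u CW_zero m] .
  moreover have "sle (aff u' (?w + m)) (aff u' (?w + m + (m' - m - ?w)))"
    using sle_PC[OF P u'] CW_add qb_wt_min(1)[OF u u'] m by blast
  ultimately have "sle (aff u (0 + m)) (aff u' (?w + m + (m' - m - ?w)))" by (rule sle_trans)
  then show "sle (aff u m) (aff u' m')" by simp
qed

end

section \<open>Reduction modulo a subsystem\<close>

context root_datum
begin

definition JR :: "'a \<Rightarrow> ('a \<times> real) set" where
  "JR \<nu> = {a \<in> AR. \<nu> \<bullet> fst a = 0}"

text \<open>Steps that are semi-infinite across, but Bruhat steps along, the subsystem orthogonal to \<open>\<nu>\<close>.\<close>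

definition mstep where
  "mstep \<nu> z z' \<longleftrightarrow> (\<exists>a\<in>AR. lev (z a) > 0 \<and> z' = z \<circ> arefl a \<and>
     (\<nu> \<bullet> fst a > 0 \<or> (\<nu> \<bullet> fst a = 0 \<and> lev a > 0)))"

lemma JR_closed: "rclosed (JR \<nu>)"
  by (auto simp: rclosed_def JR_def AR_refl) (auto simp: arefl_def inner_diff_right)

lemma JR_AR: "JR \<nu> \<subseteq> AR" by (auto simp: JR_def)

lemma rgen_JR_inner: assumes "g \<in> rgen (JR \<nu>)" shows "\<nu> \<bullet> fst (g a) = \<nu> \<bullet> fst a"
proof -
  have "set as \<subseteq> JR \<nu> \<Longrightarrow> \<nu> \<bullet> fst (aword as a) = \<nu> \<bullet> fst a" for as
    by (induction as) (auto simp: JR_def arefl_def inner_diff_right)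
  with assms show ?thesis by (auto simp: rgen_def)
qed

lemma rgen_JR_G: "g \<in> rgen (JR \<nu>) \<Longrightarrow> g \<in> G"
  using rgen_G JR_AR by blast

text \<open>A covering along the subsystem is absorbed into the coset representative. Any other one
  survives conjugation by \<open>g\<close>, which preserves the value of \<open>\<nu>\<close> on
  finite parts.\<close>

lemma cov_project:
  assumes \<nu>: "\<And>\<beta>. \<beta> \<in> Pos \<Longrightarrow> \<nu> \<bullet> \<beta> \<ge> 0" and z: "z \<in> G" and c: "cov z z'" and g: "g \<in> rgen (JR \<nu>)"
  shows "\<exists>h\<in>rgen (JR \<nu>). (mstep \<nu>)\<^sup>*\<^sup>* (z \<circ> h) (z' \<circ> g)"
proof -
  obtain a where a: "a \<in> AR" "rp a" "lev (z a) > 0" "z' = z \<circ> arefl a" using c unfolding cov_def by blast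
  have gG: "g \<in> G" "inv g \<in> rgen (JR \<nu>)" using g rgen_JR_G rgen_inv by auto
  have "\<nu> \<bullet> fst a \<ge> 0" using a(2) \<nu> by (simp add: rp_def)
  then consider "\<nu> \<bullet> fst a = 0" | "\<nu> \<bullet> fst a > 0" by linarith
  then show ?thesis
  proof cases
    case 1
    then have "arefl a \<circ> g \<in> rgen (JR \<nu>)" using a g by (intro rgen_comp rgen_refl) (auto simp: JR_def)
    then show ?thesis unfolding a(4) comp_assoc by blast
  next
    case 2
    let ?b = "inv g a"
    have "z' \<circ> g = z \<circ> g \<circ> arefl ?b" by (simp add: a(4) comp_assoc G_conj_inv[OF gG(1)])
    moreover have "?b \<in> AR" using G_AR[OF G_inv(2)[OF gG(1)] a(1)] .
    moreover have "\<nu> \<bullet> fst ?b > 0" using 2 rgen_JR_inner[OF gG(2)] by simp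
    moreover have "lev ((z \<circ> g) ?b) > 0" using a by (simp add: G_inv_r[OF gG(1)])
    ultimately have "mstep \<nu> (z \<circ> g) (z' \<circ> g)" unfolding mstep_def by blast
    then show ?thesis using g by blast
  qed
qed

lemma sle_project:
  assumes \<nu>: "\<And>\<beta>. \<beta> \<in> Pos \<Longrightarrow> \<nu> \<bullet> \<beta> \<ge> 0" and z: "z \<in> G" and c: "sle z z'" and g: "g \<in> rgen (JR \<nu>)"
  shows "\<exists>h\<in>rgen (JR \<nu>). (mstep \<nu>)\<^sup>*\<^sup>* (z \<circ> h) (z' \<circ> g)"
proof -
  have "(\<forall>g\<in>rgen (JR \<nu>). \<exists>h\<in>rgen (JR \<nu>). (mstep \<nu>)\<^sup>*\<^sup>* (z \<circ> h) (z' \<circ> g)) \<and> z' \<in> G"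
    using c unfolding sle_def
  proof (induction rule: rtranclp_induct)
    case base
    then show ?case using z by blast
  next
    case (step y y')
    then have y: "y \<in> G" by blast
    have "\<exists>h\<in>rgen (JR \<nu>). (mstep \<nu>)\<^sup>*\<^sup>* (z \<circ> h) (y' \<circ> g)" if g: "g \<in> rgen (JR \<nu>)" for g
    proof -
      obtain h1 where h1: "h1 \<in> rgen (JR \<nu>)" "(mstep \<nu>)\<^sup>*\<^sup>* (y \<circ> h1) (y' \<circ> g)"
        using cov_project[OF \<nu> y step(2) g] by blast
      obtain h where "h \<in> rgen (JR \<nu>)" "(mstep \<nu>)\<^sup>*\<^sup>* (z \<circ> h) (y \<circ> h1)" using step(3) h1 by blast
      with h1 show ?thesis by (meson rtranclp_trans)
    qed
    then show ?case using cov_G[OF y step(2)] by blast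
  qed
  then show ?thesis using g by blast
qed

text \<open>Minimality within the coset \<open>z \<circ> rgen (JR \<nu>)\<close>, expressed through
  inversions instead of length.\<close>

definition Jmin where "Jmin \<nu> z \<longleftrightarrow> (\<forall>a\<in>JR \<nu>. lev a > 0 \<longrightarrow> lev (z a) > 0)"

lemma Jmin_ex:
  shows "z \<in> G \<Longrightarrow> \<exists>g\<in>rgen (JR \<nu>). Jmin \<nu> (z \<circ> g) \<and> (mstep \<nu>)\<^sup>*\<^sup>* (z \<circ> g) z"
proof (induction "card (N z)" arbitrary: z rule: less_induct)
  case less
  show ?case
  proof (cases "Jmin \<nu> z")
    case True
    then show ?thesis using rgen_id by (intro bexI[of _ id]) auto
  next
    case False
    then obtain a where a: "a \<in> JR \<nu>" "lev a > 0" "\<not> lev (z a) > 0" by (auto simp: Jmin_def)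
    have aA: "a \<in> AR" using a JR_AR by blast
    define y where "y = z \<circ> arefl a"
    have y: "y \<in> G" unfolding y_def using less.prems aA by (intro G_comp arefl_G)
    have zy: "z = y \<circ> arefl a" by (simp add: y_def fun_eq_iff)
    have ya: "lev (y a) > 0"
      using a(3) lev_cases[OF G_AR[OF less.prems aA]] by (simp add: y_def arefl_self'[OF aA] G_neg[OF less.prems])
    have "card (N y) < card (N z)" using card_N_less[OF y aA a(2) ya] zy by simp
    from less.hyps[OF this y] obtain g where g: "g \<in> rgen (JR \<nu>)" "Jmin \<nu> (y \<circ> g)"
      "(mstep \<nu>)\<^sup>*\<^sup>* (y \<circ> g) y" by blast
    have "mstep \<nu> y z" unfolding mstep_def using a aA ya zy by (auto simp: JR_def)
    then have "(mstep \<nu>)\<^sup>*\<^sup>* (y \<circ> g) z" using g(3) by auto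
    moreover have "arefl a \<circ> g \<in> rgen (JR \<nu>)" using a g by (intro rgen_comp rgen_refl)
    moreover have "y \<circ> g = z \<circ> (arefl a \<circ> g)" by (simp add: y_def comp_assoc)
    ultimately show ?thesis using g(2) by metis
  qed
qed

text \<open>A coset has only one minimal representative: the element relating two of them keeps the
  signs of all roots in \<open>JR \<nu>\<close> and is the identity by
  \<open>no_inversion_id\<close>. So the representative found below \<open>z \<circ> g\<close> is
  \<open>z\<close>.\<close>

lemma Jmin_le:
  assumes z: "z \<in> G" "Jmin \<nu> z" and g: "g \<in> rgen (JR \<nu>)"
  shows "(mstep \<nu>)\<^sup>*\<^sup>* z (z \<circ> g)"
proof -
  have "z \<circ> g \<in> G" using z g rgen_JR_G by (intro G_comp)
  then obtain g' where g': "g' \<in> rgen (JR \<nu>)" "Jmin \<nu> (z \<circ> g \<circ> g')" "(mstep \<nu>)\<^sup>*\<^sup>* (z \<circ> g \<circ> g') (z \<circ> g)"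
    using Jmin_ex by blast
  let ?h = "g \<circ> g'"
  have h: "?h \<in> rgen (JR \<nu>)" using g g'(1) by (rule rgen_comp)
  have "?h = id"
  proof (rule no_inversion_id[OF JR_closed h])
    fix a assume a: "a \<in> JR \<nu>" "lev a > 0"
    have hJ: "?h a \<in> JR \<nu>" using rgen_stable[OF JR_closed h a(1)] .
    show "lev (?h a) > 0"
    proof (rule ccontr)
      assume "\<not> lev (?h a) > 0"
      then have "lev (- ?h a) > 0" using lev_cases[of "?h a"] hJ JR_AR by blast
      then have "lev (z (- ?h a)) > 0" using z(2) rclosed_neg[OF JR_closed hJ] by (auto simp: Jmin_def)
      moreover have "lev (z (?h a)) > 0" using g'(2) a by (auto simp: Jmin_def)
      ultimately show False by (simp add: G_neg[OF z(1)] lev_linear)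
    qed
  qed
  then show ?thesis using g'(3) by (simp add: comp_assoc)
qed

lemma CW_of_nat: "\<nu> \<in> CW \<Longrightarrow> of_nat M *\<^sub>R \<nu> \<in> CW"
  by (rule CW_int) auto

text \<open>Translation by \<open>M\<close> times \<open>\<nu>\<close> raises the level of the
  right-hand root by \<open>M * (\<nu> \<bullet> fst a)\<close>. A root across the subsystem becomes
  positive for large \<open>M\<close>, and one along it keeps its level.\<close>

lemma mstep_ble:
  assumes \<nu>: "\<nu> \<in> CW" and zz: "(mstep \<nu>)\<^sup>*\<^sup>* z z'"
  shows "\<exists>M0::nat. \<forall>M\<ge>M0. ble (z \<circ> aff id (of_nat M *\<^sub>R \<nu>)) (z' \<circ> aff id (of_nat M *\<^sub>R \<nu>))"
  using zz
proof (induction rule: rtranclp_induct)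
  case (step y y')
  then obtain M0 :: nat where M0: "\<And>M. M \<ge> M0 \<Longrightarrow> ble (z \<circ> aff id (of_nat M *\<^sub>R \<nu>)) (y \<circ> aff id (of_nat M *\<^sub>R \<nu>))"
    by blast
  obtain a where a: "a \<in> AR" "lev (y a) > 0" "y' = y \<circ> arefl a"
    "\<nu> \<bullet> fst a > 0 \<or> (\<nu> \<bullet> fst a = 0 \<and> lev a > 0)" using step(2) unfolding mstep_def by blast
  have "\<exists>M1::nat. \<forall>M\<ge>M1. lev a + of_nat M * (\<nu> \<bullet> fst a) > 0"
  proof (cases "\<nu> \<bullet> fst a = 0")
    case False
    then have p: "\<nu> \<bullet> fst a > 0" using a by auto
    obtain M1 :: nat where M1: "- lev a / (\<nu> \<bullet> fst a) < of_nat M1" using reals_Archimedean2 by blast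
    show ?thesis
    proof (intro exI[of _ M1] allI impI)
      fix M :: nat assume "M \<ge> M1"
      then have "- lev a / (\<nu> \<bullet> fst a) < of_nat M" using M1 by (meson less_le_trans of_nat_le_iff)
      then have "- lev a < of_nat M * (\<nu> \<bullet> fst a)" using pos_divide_less_eq[OF p] by blast
      then show "lev a + of_nat M * (\<nu> \<bullet> fst a) > 0" by linarith
    qed
  qed (use a in auto)
  then obtain M1 :: nat where M1: "\<And>M. M \<ge> M1 \<Longrightarrow> lev a + of_nat M * (\<nu> \<bullet> fst a) > 0" by blast
  have "bstep (y \<circ> aff id (of_nat M *\<^sub>R \<nu>)) (y' \<circ> aff id (of_nat M *\<^sub>R \<nu>))" if M: "M \<ge> M1" for M
  proof -
    let ?t = "aff id (of_nat M *\<^sub>R \<nu>)" and ?b = "(fst a, snd a + of_nat M * (\<nu> \<bullet> fst a))"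
    have t: "?t \<in> G" using W_id CW_of_nat[OF \<nu>] by (intro aff_G)
    have tb: "?t ?b = a" by (simp add: aff_def)
    have "of_nat M * (\<nu> \<bullet> fst a) \<in> \<int>" using CW_of_nat[OF \<nu>, of M] a(1) by (auto simp: CW_def AR_def)
    then have "?b \<in> AR" using a(1) by (auto simp: AR_def)
    moreover have "lev ?b > 0" using M1[OF M] by (simp add: lev_def algebra_simps)
    moreover have "y' \<circ> ?t = y \<circ> ?t \<circ> arefl ?b"
      by (simp only: a(3) comp_assoc G_conj[OF t] tb)
    ultimately show ?thesis unfolding bstep_def using a(2) tb by (metis comp_apply)
  qed
  then show ?case using M0 bstep_ble ble_trans
    by (intro exI[of _ "max M0 M1"]) (meson max.bounded_iff)
qed auto

text \<open>Pass to elements that are minimal modulo the affine Weyl group of \<open>JR \<nu>\<close>; after right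
  translation by a large multiple of \<open>\<nu>\<close> the mixed steps become Bruhat steps and lengths add up,
  so that the translation can be cancelled again.\<close>

lemma ble_of_sle_mod:
  assumes x: "x \<in> G" "x' \<in> G" and b: "b \<in> G" and z0: "z0 \<in> G" "sle z0 b"
    and \<nu>: "\<nu> \<in> CW" "\<And>\<beta>. \<beta> \<in> Pos \<Longrightarrow> \<nu> \<bullet> \<beta> \<ge> 0"
    and t: "t \<in> rgen (JR \<nu>)" and le: "sle (x \<circ> b) (x' \<circ> z0 \<circ> t)"
    and LP: "\<And>e. e \<in> AR \<Longrightarrow> \<nu> \<bullet> fst (inv b e) \<le> 0 \<Longrightarrow> lev e > 0 \<Longrightarrow> lev (x e) > 0"
  shows "ble x x'"
proof -
  obtain g where g: "g \<in> rgen (JR \<nu>)" "Jmin \<nu> (b \<circ> g)" using Jmin_ex[OF b] by blast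
  obtain g0 where g0: "g0 \<in> rgen (JR \<nu>)" "(mstep \<nu>)\<^sup>*\<^sup>* (z0 \<circ> g0) (b \<circ> g)"
    using sle_project[OF \<nu>(2) z0(1,2) g(1)] by blast
  have gG: "g \<in> G" "g0 \<in> G" "t \<in> G" using g g0 t rgen_JR_G by auto
  have xb: "x \<circ> b \<in> G" using x b by (intro G_comp)
  have "inv t \<circ> g0 \<in> rgen (JR \<nu>)" using rgen_comp rgen_inv t g0 by blast
  from sle_project[OF \<nu>(2) xb le this] obtain g1 where g1: "g1 \<in> rgen (JR \<nu>)"
    "(mstep \<nu>)\<^sup>*\<^sup>* (x \<circ> b \<circ> g1) (x' \<circ> z0 \<circ> t \<circ> (inv t \<circ> g0))" by blast
  have tt: "x' \<circ> z0 \<circ> t \<circ> (inv t \<circ> g0) = x' \<circ> (z0 \<circ> g0)"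
    using G_inv_cancel(2)[OF gG(3), of g0] by (simp only: comp_assoc)
  have bg: "b \<circ> g \<in> G" and xbg: "x \<circ> (b \<circ> g) \<in> G" using x b gG by (auto intro!: G_comp)
  \<comment> \<open>On roots along the subsystem \<open>\<nu>\<close> takes the value 0, so
    \<open>LP\<close> applies to their images under \<open>b \<circ> g\<close>, and \<open>x\<close>
    keeps these positive.\<close>
  have "Jmin \<nu> (x \<circ> (b \<circ> g))"
    unfolding Jmin_def
  proof (intro ballI impI)
    fix a assume a: "a \<in> JR \<nu>" "lev a > 0"
    have "lev (b (g a)) > 0" using g(2) a by (auto simp: Jmin_def)
    moreover have "g a \<in> JR \<nu>" using rgen_stable[OF JR_closed g(1) a(1)] .
    ultimately show "lev ((x \<circ> (b \<circ> g)) a) > 0"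
      using LP[of "b (g a)"] G_AR[OF b] JR_AR by (auto simp: G_inv_l[OF b] JR_def)
  qed
  from Jmin_le[OF xbg this, of "inv g \<circ> g1"] have m1: "(mstep \<nu>)\<^sup>*\<^sup>* (x \<circ> (b \<circ> g)) (x \<circ> (b \<circ> g) \<circ> (inv g \<circ> g1))"
    using rgen_comp rgen_inv g g1 by blast
  have m2: "x \<circ> (b \<circ> g) \<circ> (inv g \<circ> g1) = x \<circ> b \<circ> g1"
    using G_inv_cancel(2)[OF gG(1), of g1] by (simp only: comp_assoc)
  have m: "(mstep \<nu>)\<^sup>*\<^sup>* (x \<circ> (b \<circ> g)) (x' \<circ> (z0 \<circ> g0))"
    using rtranclp_trans[OF m1[unfolded m2] g1(2)[unfolded tt]] .
  obtain M1 :: nat where M1: "\<And>M. M \<ge> M1 \<Longrightarrow>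
      ble (x \<circ> (b \<circ> g) \<circ> aff id (of_nat M *\<^sub>R \<nu>)) (x' \<circ> (z0 \<circ> g0) \<circ> aff id (of_nat M *\<^sub>R \<nu>))"
    using mstep_ble[OF \<nu>(1) m] by blast
  obtain M2 :: nat where M2: "\<And>M. M \<ge> M2 \<Longrightarrow>
      ble (z0 \<circ> g0 \<circ> aff id (of_nat M *\<^sub>R \<nu>)) (b \<circ> g \<circ> aff id (of_nat M *\<^sub>R \<nu>))"
    using mstep_ble[OF \<nu>(1) g0(2)] by blast
  \<comment> \<open>\<open>M3\<close> bounds the levels to which \<open>b \<circ> g\<close> sends
    its finitely many inversions, so the translation makes those with
    \<open>\<nu> \<bullet> fst d \<le> -1\<close> positive again.\<close>
  obtain M3 :: nat where M3: "of_nat M3 > (\<Sum>d\<in>N (b \<circ> g). \<bar>lev ((b \<circ> g) d)\<bar>)"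
    using reals_Archimedean2 by blast
  define M where "M = max M1 (max M2 M3)"
  define e where "e = aff id (of_nat M *\<^sub>R \<nu>)"
  have eG: "e \<in> G" unfolding e_def using W_id CW_of_nat[OF \<nu>(1)] by (intro aff_G)
  let ?c = "b \<circ> g \<circ> e" and ?c' = "z0 \<circ> g0 \<circ> e"
  have cG: "?c \<in> G" "?c' \<in> G" using b gG eG z0 by (auto intro!: G_comp)
  have cd: "?c d = (b \<circ> g) d - (0, of_nat M * (\<nu> \<bullet> fst d))" for d
  proof -
    have "e d = d - (0, of_nat M * (\<nu> \<bullet> fst d))" by (simp add: e_def aff_def prod_eq_iff)
    then show ?thesis by (simp add: G_diff[OF bg, unfolded comp_apply] G_delta[OF bg, unfolded comp_apply])
  qed
  \<comment> \<open>This is the additivity of lengths. For large \<open>M\<close> every inversion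
    \<open>d\<close> of \<open>?c\<close> satisfies \<open>\<nu> \<bullet> fst d > 0\<close>, so
    \<open>LP\<close> applies to the positive root \<open>- ?c d\<close>.\<close>
  have "N ?c \<subseteq> N (x \<circ> ?c)"
  proof
    fix d assume d: "d \<in> N ?c"
    note dD = N_D[OF d]
    have cl: "lev (?c d) = lev ((b \<circ> g) d) - of_nat M * (\<nu> \<bullet> fst d)"
      unfolding cd lev_linear by (simp add: lev_def)
    have dI: "\<nu> \<bullet> fst d \<in> \<int>" using dD(1) \<nu>(1) by (auto simp: AR_def CW_def)
    have cA: "?c d \<in> AR" using G_AR[OF cG(1) dD(1)] .
    have "\<nu> \<bullet> fst d > 0"
    proof (rule ccontr)
      assume "\<not> \<nu> \<bullet> fst d > 0"
      then consider "\<nu> \<bullet> fst d = 0" | "\<nu> \<bullet> fst d < 0" by linarith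
      then show False
      proof cases
        case 1
        then have "d \<in> JR \<nu>" using dD(1) by (simp add: JR_def)
        then have "lev ((b \<circ> g) d) > 0" using g(2) dD(2) unfolding Jmin_def by blast
        then show False using cl dD(3) 1 by simp
      next
        case 2
        then have "\<nu> \<bullet> fst d \<le> -1" using dI by (auto elim!: Ints_cases)
        then have Ml: "of_nat M * (\<nu> \<bullet> fst d) \<le> - of_nat M"
          using mult_left_mono[of "\<nu> \<bullet> fst d" "-1" "of_nat M"] by simp
        show False
        proof (cases "d \<in> N (b \<circ> g)")
          case True
          then have "\<bar>lev ((b \<circ> g) d)\<bar> \<le> (\<Sum>d\<in>N (b \<circ> g). \<bar>lev ((b \<circ> g) d)\<bar>)"
            using finite_N[OF bg] by (intro member_le_sum) auto
          also have "\<dots> < of_nat M" using M3 by (simp add: M_def less_max_iff_disj of_nat_max)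
          finally show False using cl dD(3) Ml by linarith
        next
          case False
          then have "\<not> lev ((b \<circ> g) d) < 0" using dD(1,2) unfolding N_def by blast
          then show False using cl dD(3) Ml of_nat_0_le_iff[of M, where ?'a=real] by linarith
        qed
      qed
    qed
    moreover have "inv b (- ?c d) = - g (e d)"
      by (simp add: G_neg[OF G_inv(2)[OF b]] G_inv_l[OF b])
    moreover have "\<nu> \<bullet> fst (g (e d)) = \<nu> \<bullet> fst d" using rgen_JR_inner[OF g(1)] by (simp add: e_def aff_def)
    ultimately have "\<nu> \<bullet> fst (inv b (- ?c d)) \<le> 0" by simp
    from LP[OF AR_neg[OF cA] this] dD(3) have "lev (x (?c d)) < 0"
      by (simp add: lev_linear G_neg[OF x(1)])
    then show "d \<in> N (x \<circ> ?c)" using dD by (simp add: N_def)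
  qed
  moreover have "ble (x \<circ> ?c) (x' \<circ> ?c')" using M1[of M] by (simp only: comp_assoc) (simp add: M_def e_def)
  moreover have "ble ?c' ?c" using M2[of M] by (simp add: M_def e_def)
  ultimately show ?thesis using ble_cancel[OF x cG] by blast
qed

section \<open>Dominant coweights orthogonal to a parabolic subsystem, and simple coroot
  coefficients\<close>

definition nu :: "'a set \<Rightarrow> 'a" where "nu J = (\<Sum>a\<in>\<Delta> - J. fd a)"

lemma nu_inner: "nu J \<bullet> \<beta> = (\<Sum>a\<in>\<Delta> - J. fd a \<bullet> \<beta>)"
  by (simp add: nu_def inner_sum_left)

lemma nu_CW: "nu J \<in> CW"
proof -
  have "nu J \<bullet> \<beta> \<in> \<int>" if "\<beta> \<in> R" for \<beta>
    unfolding nu_inner using root_expand(2)[OF that] by (intro Ints_sum) auto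
  then show ?thesis by (simp add: CW_def)
qed

lemma nu_Pos: "\<beta> \<in> Pos \<Longrightarrow> nu J \<bullet> \<beta> \<ge> 0"
  unfolding nu_inner by (auto intro!: sum_nonneg simp: Pos_iff)

lemma fd_span: assumes "J \<subseteq> \<Delta>" "a \<in> \<Delta> - J" "\<beta> \<in> span J" shows "fd a \<bullet> \<beta> = 0"
  using assms(3)
proof (induction rule: span_induct_alt)
  case (step c x y)
  then have "fd a \<bullet> x = 0" using fd[of a x] assms(1,2) by auto
  with step show ?case by (simp add: inner_add_right)
qed simp

text \<open>All coefficients of a root have the same sign, so their sum outside \<open>J\<close>
  vanishes only if each of them does.\<close>

lemma nu_span: assumes J: "J \<subseteq> \<Delta>" and b: "\<beta> \<in> R" shows "nu J \<bullet> \<beta> = 0 \<longleftrightarrow> \<beta> \<in> span J"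
proof
  assume "\<beta> \<in> span J"
  then show "nu J \<bullet> \<beta> = 0" unfolding nu_inner using fd_span[OF J] by simp
next
  assume z: "nu J \<bullet> \<beta> = 0"
  have f: "finite (\<Delta> - J)" using finD by blast
  have *: "fd a \<bullet> \<beta> = 0" if a: "a \<in> \<Delta> - J" for a
  proof (cases "\<forall>a\<in>\<Delta>. fd a \<bullet> \<beta> \<ge> 0")
    case True
    then show ?thesis using z a f unfolding nu_inner by (subst (asm) sum_nonneg_eq_0_iff) auto
  next
    case False
    then have n: "\<forall>a\<in>\<Delta>. - (fd a \<bullet> \<beta>) \<ge> 0" using root_expand(3)[OF b] by auto
    have "(\<Sum>a\<in>\<Delta> - J. - (fd a \<bullet> \<beta>)) = 0" using z unfolding nu_inner by (simp add: sum_negf)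
    then have "- (fd a \<bullet> \<beta>) = 0" using n a f by (subst (asm) sum_nonneg_eq_0_iff) auto
    then show ?thesis by simp
  qed
  have "\<beta> = (\<Sum>a\<in>\<Delta>. (fd a \<bullet> \<beta>) *\<^sub>R a)" using root_expand(1)[OF b] .
  also have "\<dots> = (\<Sum>a\<in>J. (fd a \<bullet> \<beta>) *\<^sub>R a)"
    using finD J * by (intro sum.mono_neutral_right) auto
  also have "\<dots> \<in> span J" by (intro span_sum span_scale span_base)
  finally show "\<beta> \<in> span J" .
qed

text \<open>Expanding the root does not directly give integral coefficients for its coroot. Instead
  \<open>\<beta> \<bullet> \<beta> > 0\<close> provides a simple root in \<open>J\<close> pairing
  positively with \<open>\<beta>\<close>; reflecting in it lowers \<open>\<beta>\<close> and
  subtracts a positive integral multiple of a simple coroot.\<close>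

lemma coroot_nspan_simple:
  assumes J: "J \<subseteq> \<Delta>"
  shows "\<beta> \<in> Pos \<Longrightarrow> \<beta> \<in> span J \<Longrightarrow> coroot \<beta> \<in> nspan (coroot ` J)"
proof (induction "card {\<gamma>\<in>R. \<gamma> \<bullet> p0 < \<beta> \<bullet> p0}" arbitrary: \<beta> rule: less_induct)
  case less
  have bR: "\<beta> \<in> R" using less.prems Pos_R by blast
  have fJ: "fd a \<bullet> \<beta> = 0" if "a \<in> \<Delta> - J" for a using fd_span[OF J that less.prems(2)] .
  have "\<beta> = (\<Sum>a\<in>\<Delta>. (fd a \<bullet> \<beta>) *\<^sub>R a)" using root_expand(1)[OF bR] .
  also have "\<dots> = (\<Sum>a\<in>J. (fd a \<bullet> \<beta>) *\<^sub>R a)"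
    using finD J fJ by (intro sum.mono_neutral_right) auto
  finally have be: "\<beta> \<bullet> \<beta> = (\<Sum>a\<in>J. (fd a \<bullet> \<beta>) * (\<beta> \<bullet> a))"
    by (metis (no_types, lifting) inner_scaleR_right inner_sum_right sum.cong)
  have "\<beta> \<bullet> \<beta> > 0" using bR zero_R by auto
  then obtain a where a: "a \<in> J" "(fd a \<bullet> \<beta>) * (\<beta> \<bullet> a) > 0"
    unfolding be by (meson not_less sum_nonpos)
  have aD: "a \<in> \<Delta>" "a \<in> R" "a \<in> Pos" using a J DR D_Pos by auto
  have "fd a \<bullet> \<beta> \<ge> 0" using less.prems aD by (simp add: Pos_iff)
  then have ba: "\<beta> \<bullet> a > 0" using a(2) by (simp add: zero_less_mult_iff)
  show ?case
  proof (cases "\<beta> = a")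
    case True
    then show ?thesis using a by (intro nspan_base) auto
  next
    case False
    let ?b = "refl a \<beta>"
    have bP: "?b \<in> Pos" using simple_refl_Pos aD less.prems False by blast
    have bs: "?b \<in> span J" using less.prems a by (simp add: refl_coroot span_diff span_scale span_base)
    have "a \<bullet> a > 0" using aD zero_R by auto
    then have k: "\<beta> \<bullet> coroot a > 0" using ba by (simp add: coroot_def)
    have "a \<bullet> p0 > 0" using aD p0_root(2) by blast
    then have lt: "?b \<bullet> p0 < \<beta> \<bullet> p0" using k by (simp add: refl_coroot inner_diff_left)
    have "{\<gamma>\<in>R. \<gamma> \<bullet> p0 < ?b \<bullet> p0} \<subset> {\<gamma>\<in>R. \<gamma> \<bullet> p0 < \<beta> \<bullet> p0}" using lt bP Pos_R by fastforce
    then have "card {\<gamma>\<in>R. \<gamma> \<bullet> p0 < ?b \<bullet> p0} < card {\<gamma>\<in>R. \<gamma> \<bullet> p0 < \<beta> \<bullet> p0}"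
      using finR by (intro psubset_card_mono) auto
    from less.hyps[OF this bP bs] have IH: "coroot ?b \<in> nspan (coroot ` J)" .
    have "coroot ?b = refl a (coroot \<beta>)" using W_coroot[OF W_refl[OF aD(2)]] by simp
    also have "\<dots> = coroot \<beta> - (coroot \<beta> \<bullet> a) *\<^sub>R coroot a" by (simp add: refl_coroot')
    finally have e: "coroot \<beta> = coroot ?b + (coroot \<beta> \<bullet> a) *\<^sub>R coroot a" by simp
    obtain n where n: "coroot \<beta> \<bullet> a = of_int n" using coroot_int'[OF bR aD(2)] by (auto elim: Ints_cases)
    have "coroot \<beta> \<bullet> a > 0" using ba \<open>\<beta> \<bullet> \<beta> > 0\<close> by (simp add: coroot_def)
    then have "coroot \<beta> \<bullet> a = of_nat (nat n)" using n by simp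
    then show ?thesis using e IH a by (metis imageI nspan_base nspan_nat nspan_plus)
  qed
qed

text \<open>The coefficient of \<open>coroot a\<close>; the factor undoes the scaling of
  \<open>a\<close> by \<open>2 / (a \<bullet> a)\<close>.\<close>

definition cc :: "'a \<Rightarrow> 'a \<Rightarrow> real" where "cc a x = (a \<bullet> a / 2) * (fd a \<bullet> x)"

lemma cc_coroot: assumes "a \<in> \<Delta>" "b \<in> \<Delta>" shows "cc a (coroot b) = (if a = b then 1 else 0)"
proof -
  have "a \<bullet> a > 0" using assms DR zero_R by auto
  then show ?thesis using fd[OF assms] by (simp add: cc_def coroot_def)
qed

lemma cc_add: "cc a (x + y) = cc a x + cc a y" and cc_diff: "cc a (x - y) = cc a x - cc a y"
  by (simp_all add: cc_def inner_add_right inner_diff_right algebra_simps)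

lemma cc_zspan:
  assumes J: "J \<subseteq> \<Delta>" and x: "x \<in> zspan (coroot ` J)"
  shows "x = (\<Sum>a\<in>\<Delta>. cc a x *\<^sub>R coroot a)" "a \<in> \<Delta> \<Longrightarrow> cc a x \<in> \<int>" "a \<in> \<Delta> - J \<Longrightarrow> cc a x = 0"
proof -
  have e: "(\<Sum>a\<in>\<Delta>. cc a (coroot b) *\<^sub>R coroot a) = coroot b" if "b \<in> \<Delta>" for b
  proof -
    have "(\<Sum>a\<in>\<Delta>. cc a (coroot b) *\<^sub>R coroot a) = (\<Sum>a\<in>\<Delta>. if a = b then coroot b else 0)"
      using that by (intro sum.cong) (auto simp: cc_coroot)
    then show ?thesis using that finD by simp
  qed
  have "x = (\<Sum>a\<in>\<Delta>. cc a x *\<^sub>R coroot a) \<and> (\<forall>a\<in>\<Delta>. cc a x \<in> \<int>) \<and> (\<forall>a\<in>\<Delta> - J. cc a x = 0)"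
    using x
  proof (induction x rule: zspan.induct)
    case zspan_zero
    then show ?case by (simp add: cc_def)
  next
    case (zspan_add v c)
    then obtain b where b: "b \<in> J" "c = coroot b" by blast
    have "(\<Sum>a\<in>\<Delta>. cc a (v + c) *\<^sub>R coroot a) = (\<Sum>a\<in>\<Delta>. cc a v *\<^sub>R coroot a) + (\<Sum>a\<in>\<Delta>. cc a c *\<^sub>R coroot a)"
      by (simp add: cc_add scaleR_left_distrib sum.distrib)
    then show ?case using zspan_add b e[of b] J by (auto simp: cc_add cc_coroot)
  next
    case (zspan_diff v c)
    then obtain b where b: "b \<in> J" "c = coroot b" by blast
    have "(\<Sum>a\<in>\<Delta>. cc a (v - c) *\<^sub>R coroot a) = (\<Sum>a\<in>\<Delta>. cc a v *\<^sub>R coroot a) - (\<Sum>a\<in>\<Delta>. cc a c *\<^sub>R coroot a)"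
      by (simp add: cc_diff scaleR_left_diff_distrib sum_subtractf)
    then show ?case using zspan_diff b e[of b] J by (auto simp: cc_diff cc_coroot)
  qed
  then show "x = (\<Sum>a\<in>\<Delta>. cc a x *\<^sub>R coroot a)" "a \<in> \<Delta> \<Longrightarrow> cc a x \<in> \<int>" "a \<in> \<Delta> - J \<Longrightarrow> cc a x = 0" by auto
qed

lemma cc_nspan: assumes "x \<in> nspan (coroot ` \<Delta>)" "a \<in> \<Delta>" shows "cc a x \<ge> 0"
  using assms(1)
proof (induction x rule: nspan.induct)
  case (nspan_add v c)
  then show ?case using cc_coroot[OF assms(2)] by (auto simp: cc_add)
qed (simp add: cc_def)

text \<open>The counterpart of \<open>leq_mod\<close> in the Euclidean model, as a condition on the
  difference of the two sides.\<close>

definition modJ :: "'a set \<Rightarrow> 'a \<Rightarrow> bool" where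
  "modJ J x \<longleftrightarrow> (\<exists>l1 l2. l1 \<in> PC \<and> l2 \<in> zspan (coroot ` sub_roots R J) \<and> x = l1 + l2)"

lemma PC_simple: "x \<in> PC \<Longrightarrow> x \<in> nspan (coroot ` \<Delta>)"
proof (rule nspan_nspan)
  have "\<beta> \<in> span \<Delta>" if "\<beta> \<in> Pos" for \<beta>
  proof -
    have "\<beta> = (\<Sum>a\<in>\<Delta>. (fd a \<bullet> \<beta>) *\<^sub>R a)" using root_expand(1) Pos_R[OF that] by blast
    also have "\<dots> \<in> span \<Delta>" by (intro span_sum span_scale span_base)
    finally show ?thesis .
  qed
  then show "coroot ` Pos \<subseteq> nspan (coroot ` \<Delta>)" using coroot_nspan_simple[of \<Delta>] by auto
qed

lemma sub_roots_simple: assumes "J \<subseteq> \<Delta>" "x \<in> zspan (coroot ` sub_roots R J)"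
  shows "x \<in> zspan (coroot ` J)"
  using assms(2)
proof (rule zspan_zspan)
  show "coroot ` sub_roots R J \<subseteq> zspan (coroot ` J)"
  proof clarify
    fix \<beta> assume b: "\<beta> \<in> sub_roots R J"
    then have bR: "\<beta> \<in> R" "\<beta> \<in> span J" by (auto simp: sub_roots_def)
    show "coroot \<beta> \<in> zspan (coroot ` J)"
    proof (cases "\<beta> \<in> Pos")
      case True
      then show ?thesis using coroot_nspan_simple[OF assms(1) True bR(2)] nspan_sub_zspan by blast
    next
      case False
      then have "- \<beta> \<in> Pos" "- \<beta> \<in> span J" using bR Pos_uminus by (auto simp: span_neg)
      then have "coroot (- \<beta>) \<in> zspan (coroot ` J)"
        using coroot_nspan_simple[OF assms(1)] nspan_sub_zspan by blast
      then show ?thesis using zspan_uminus by fastforce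
    qed
  qed
qed

lemma modJ_coeff: assumes J: "J \<subseteq> \<Delta>" and m: "modJ J x"
  shows "x = (\<Sum>a\<in>\<Delta>. cc a x *\<^sub>R coroot a)" "a \<in> \<Delta> \<Longrightarrow> cc a x \<in> \<int>" "a \<in> \<Delta> - J \<Longrightarrow> cc a x \<ge> 0"
proof -
  obtain l1 l2 where l: "l1 \<in> nspan (coroot ` \<Delta>)" "l2 \<in> zspan (coroot ` J)" "x = l1 + l2"
    using m PC_simple sub_roots_simple[OF J] unfolding modJ_def by blast
  have "l2 \<in> zspan (coroot ` \<Delta>)" using zspan_mono[OF l(2)] J by blast
  then have z: "x \<in> zspan (coroot ` \<Delta>)" unfolding l(3) using l(1) nspan_sub_zspan zspan_plus by blast
  show "x = (\<Sum>a\<in>\<Delta>. cc a x *\<^sub>R coroot a)" "a \<in> \<Delta> \<Longrightarrow> cc a x \<in> \<int>" using cc_zspan[OF _ z] by auto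
  show "a \<in> \<Delta> - J \<Longrightarrow> cc a x \<ge> 0" using cc_nspan[OF l(1), of a] cc_zspan(3)[OF J l(2), of a] by (simp add: l(3) cc_add)
qed

text \<open>For each \<open>J\<close> the simple coroot coefficients of \<open>x\<close> are
  integers, nonnegative outside \<open>J\<close>. A simple root with negative coefficient thus lies
  in every \<open>J\<close>, and its term belongs to the lattice of the intersection.\<close>

lemma modJ_Inter:
  assumes "\<J> \<noteq> {}" and J: "\<And>J. J \<in> \<J> \<Longrightarrow> J \<subseteq> \<Delta>" and m: "\<And>J. J \<in> \<J> \<Longrightarrow> modJ J x"
  shows "modJ (\<Inter>\<J>) x"
proof -
  obtain J0 where J0: "J0 \<in> \<J>" using assms(1) by blast
  note D = modJ_coeff[OF J[OF J0] m[OF J0]]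
  let ?P = "{a\<in>\<Delta>. cc a x \<ge> 0}" and ?M = "{a\<in>\<Delta>. \<not> cc a x \<ge> 0}"
  have "x = (\<Sum>a\<in>?P. cc a x *\<^sub>R coroot a) + (\<Sum>a\<in>?M. cc a x *\<^sub>R coroot a)"
  proof -
    have "(\<Sum>a\<in>\<Delta>. cc a x *\<^sub>R coroot a) = (\<Sum>a\<in>?P \<union> ?M. cc a x *\<^sub>R coroot a)" by (rule sum.cong) auto
    also have "\<dots> = (\<Sum>a\<in>?P. cc a x *\<^sub>R coroot a) + (\<Sum>a\<in>?M. cc a x *\<^sub>R coroot a)"
      using finD by (intro sum.union_disjoint) auto
    finally show ?thesis using D(1) by simp
  qed
  moreover have "(\<Sum>a\<in>?P. cc a x *\<^sub>R coroot a) \<in> PC"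
  proof (rule nspan_sum)
    fix a assume a: "a \<in> ?P"
    then obtain k where k: "cc a x = of_int k" using D(2)[of a] by (auto elim: Ints_cases)
    then have "cc a x = of_nat (nat k)" using a by simp
    then show "cc a x *\<^sub>R coroot a \<in> PC" using a D_Pos by (metis (no_types, lifting) imageI mem_Collect_eq nspan_base nspan_nat subsetD)
  qed
  moreover have "(\<Sum>a\<in>?M. cc a x *\<^sub>R coroot a) \<in> zspan (coroot ` sub_roots R (\<Inter>\<J>))"
  proof (rule zspan_sum)
    fix a assume a: "a \<in> ?M"
    then obtain k where k: "cc a x = of_int k" using D(2)[of a] by (auto elim: Ints_cases)
    have "a \<in> J" if "J \<in> \<J>" for J using modJ_coeff(3)[OF J[OF that] m[OF that], of a] a by auto
    then have "a \<in> sub_roots R (\<Inter>\<J>)" using a DR by (auto simp: sub_roots_def intro: span_base)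
    then show "cc a x *\<^sub>R coroot a \<in> zspan (coroot ` sub_roots R (\<Inter>\<J>))"
      unfolding k by (intro zspan_int zspan_base) auto
  qed
  ultimately show ?thesis unfolding modJ_def by blast
qed

text \<open>Translation by an integral multiple of a coroot is a product of two parallel affine
  reflections.\<close>

lemma transl_rgen:
  assumes J: "J \<subseteq> \<Delta>" and l: "l \<in> zspan (coroot ` sub_roots R J)"
  shows "aff id l \<in> rgen (JR (nu J))"
proof -
  have 1: "aff id (c *\<^sub>R coroot \<gamma>) \<in> rgen (JR (nu J))" if g: "\<gamma> \<in> sub_roots R J" and c: "c \<in> \<int>" for \<gamma> c
  proof -
    have gR: "\<gamma> \<in> R" "nu J \<bullet> \<gamma> = 0" using g nu_span[OF J] by (auto simp: sub_roots_def)
    have "arefl (\<gamma>, 0) \<circ> arefl (\<gamma>, c) = aff id (c *\<^sub>R coroot \<gamma>)"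
      unfolding arefl_aff fst_conv snd_conv aff_comp[OF W_refl[OF gR(1)]]
      by (simp add: inv_refl linear_0[OF linear_refl])
    moreover have "(\<gamma>, 0) \<in> JR (nu J)" "(\<gamma>, c) \<in> JR (nu J)" using gR c by (auto simp: JR_def AR_def)
    ultimately show ?thesis using rgen_comp rgen_refl by metis
  qed
  show ?thesis
    using l
  proof (induction l rule: zspan.induct)
    case zspan_zero
    then show ?case unfolding aff_id by (rule rgen_id)
  next
    case (zspan_add v a)
    then have "aff id a \<in> rgen (JR (nu J))" using 1[of _ 1] by auto
    from rgen_comp[OF zspan_add.IH this] show ?case unfolding aff_transl .
  next
    case (zspan_diff v a)
    then have "aff id (- a) \<in> rgen (JR (nu J))" using 1[of _ "-1"] by auto
    from rgen_comp[OF zspan_diff.IH this] show ?case unfolding aff_transl diff_conv_add_uminus .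
  qed
qed

lemma zspan_sub_CW: "x \<in> zspan (coroot ` sub_roots R J) \<Longrightarrow> x \<in> CW"
  by (rule CW_zspan) (erule zspan_mono, auto simp: sub_roots_def)

text \<open>The criterion with vectors in place of cocharacters. On roots, \<open>1 - ng\<close> is
  the indicator of positivity, so \<open>LP\<close> and \<open>LZ\<close> are the two conditions on
  the length functional.\<close>

lemma ble_iff_modJ:
  assumes W: "w \<in> W" "w' \<in> W" "v \<in> W" and m: "m \<in> CW" "m' \<in> CW"
    and Js: "\<J> \<noteq> {}" "\<And>J. J \<in> \<J> \<Longrightarrow> J \<subseteq> \<Delta>"
    and LP: "\<And>\<alpha>. \<alpha> \<in> Pos \<Longrightarrow> m \<bullet> v \<alpha> + of_int (ng (w (v \<alpha>))) - of_int (ng (v \<alpha>)) \<ge> 0"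
    and LZ: "\<And>\<alpha>. \<alpha> \<in> sub_roots R (\<Inter>\<J>) \<Longrightarrow> m \<bullet> v \<alpha> + of_int (ng (w (v \<alpha>))) - of_int (ng (v \<alpha>)) = 0"
  shows "ble (aff w m) (aff w' m') \<longleftrightarrow>
    (\<forall>J\<in>\<J>. \<exists>v'\<in>W. modJ J (inv v' m' - (inv v m + qb_wt R \<Delta> v' v + qb_wt R \<Delta> (w \<circ> v) (w' \<circ> v'))))"
    (is "?L \<longleftrightarrow> ?R")
proof
  have xG: "aff w m \<in> G" "aff w' m' \<in> G" "aff v 0 \<in> G" using W m CW_zero by (auto intro: aff_G)
  have wv: "w \<circ> v \<in> W" using W by (intro W_comp)
  have iv: "inv v m \<in> CW" using CW_inv W m by blast
  {
    assume ?L
    from ble_sle[OF this xG(1,3)] obtain z where z: "z \<in> G" "sle z (aff v 0)"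
      "sle (aff w m \<circ> aff v 0) (aff w' m' \<circ> z)" by blast
    obtain v' k where vk: "z = aff v' k" "v' \<in> W" "k \<in> CW" using z(1) by (rule GE)
    have wv': "w' \<circ> v' \<in> W" and iv': "inv v' m' \<in> CW" using W vk CW_inv m by (auto intro: W_comp)
    have 1: "0 - k - qb_wt R \<Delta> v' v \<in> PC"
      using z(2) sle_iff_wt[OF vk(2) W(3) vk(3) CW_zero] by (simp add: vk(1))
    have 2: "inv v' m' + k - inv v m - qb_wt R \<Delta> (w \<circ> v) (w' \<circ> v') \<in> PC"
      using z(3) sle_iff_wt[OF wv wv' iv CW_add[OF iv' vk(3)]]
      by (simp add: vk(1) aff_comp[OF vk(2)] aff_comp[OF W(3)])
    have "inv v' m' - (inv v m + qb_wt R \<Delta> v' v + qb_wt R \<Delta> (w \<circ> v) (w' \<circ> v')) \<in> PC"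
      using nspan_plus[OF 1 2] by (simp add: algebra_simps)
    then show ?R using vk(2) zspan_zero unfolding modJ_def by (metis add.right_neutral)
  }
  {
    assume R: ?R
    obtain z0 where z0: "z0 \<in> G" "sle z0 (aff v 0)"
      "\<And>z. z \<in> G \<Longrightarrow> sle z (aff v 0) \<Longrightarrow> sle (aff w' m' \<circ> z) (aff w' m' \<circ> z0)"
      using sle_max[OF xG(3,2)] by blast
    obtain v0 k where vk: "z0 = aff v0 k" "v0 \<in> W" "k \<in> CW" using z0(1) by (rule GE)
    have wv0: "w' \<circ> v0 \<in> W" and n0: "inv v0 m' + k \<in> CW" using W vk CW_inv m CW_add by (auto intro: W_comp)
    \<comment> \<open>The difference that decides whether \<open>x \<circ> v\<close> lies below
      \<open>x' \<circ> z0\<close>. It does not involve \<open>J\<close>, which lets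
      \<open>modJ_Inter\<close> combine the conditions.\<close>
    define \<kappa> where "\<kappa> = inv v0 m' + k - inv v m - qb_wt R \<Delta> (w \<circ> v) (w' \<circ> v0)"
    have "modJ J \<kappa>" if J: "J \<in> \<J>" for J
    proof -
      from R J obtain v' l1 l2 where v': "v' \<in> W" and l: "l1 \<in> PC" "l2 \<in> zspan (coroot ` sub_roots R J)"
        "inv v' m' - (inv v m + qb_wt R \<Delta> v' v + qb_wt R \<Delta> (w \<circ> v) (w' \<circ> v')) = l1 + l2"
        unfolding modJ_def by blast
      have wv': "w' \<circ> v' \<in> W" and iv': "inv v' m' \<in> CW" using W v' CW_inv m by (auto intro: W_comp)
      define q where "q = qb_wt R \<Delta> v' v"
      have q: "q \<in> CW" unfolding q_def using qb_wt_min(1)[OF v' W(3)] .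
      have nq: "- q \<in> CW" "inv v' m' + - q \<in> CW" using q iv' CW_uminus CW_add by blast+
      have l2: "l2 \<in> CW" "- l2 \<in> CW" using zspan_sub_CW l CW_uminus by auto
      \<comment> \<open>By \<open>sle_iff_wt\<close>, \<open>- q\<close> is the largest translation
        part with which \<open>v'\<close> stays below \<open>v\<close>. Maximality of
        \<open>z0\<close> then transfers the condition from \<open>v'\<close> to
        \<open>v0\<close>.\<close>
      have "sle (aff v' (- q)) (aff v 0)"
        using sle_iff_wt[OF v' W(3) nq(1) CW_zero] by (simp add: q_def nspan_zero)
      from z0(3)[OF aff_G[OF v' nq(1)] this]
      have "sle (aff (w' \<circ> v') (inv v' m' + - q)) (aff (w' \<circ> v0) (inv v0 m' + k))"
        by (simp only: vk(1) aff_comp[OF v'] aff_comp[OF vk(2)])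
      from sle_shift[OF this wv' nq(2) l2(2)]
      have 1: "sle (aff (w' \<circ> v') (inv v' m' + - q + - l2)) (aff (w' \<circ> v0) (inv v0 m' + k + - l2))" .
      have c3: "inv v' m' + - q + - l2 \<in> CW" using nq l2 CW_add by blast
      have "inv v' m' + - q + - l2 - inv v m - qb_wt R \<Delta> (w \<circ> v) (w' \<circ> v') = l1"
        using l(3) by (simp add: q_def algebra_simps)
      then have "sle (aff (w \<circ> v) (inv v m)) (aff (w' \<circ> v') (inv v' m' + - q + - l2))"
        using sle_iff_wt[OF wv wv' iv c3] l(1) by simp
      then have "sle (aff (w \<circ> v) (inv v m)) (aff (w' \<circ> v0) (inv v0 m' + k + - l2))" using 1 sle_trans by blast
      then have "inv v0 m' + k + - l2 - inv v m - qb_wt R \<Delta> (w \<circ> v) (w' \<circ> v0) \<in> PC"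
        using sle_iff_wt[OF wv wv0 iv CW_add[OF n0 l2(2)]] by simp
      then have "\<kappa> - l2 \<in> PC" by (simp add: \<kappa>_def algebra_simps)
      then show ?thesis unfolding modJ_def using l(2) by (metis diff_add_cancel)
    qed
    then have "modJ (\<Inter>\<J>) \<kappa>" using modJ_Inter[OF Js] by blast
    then obtain l1 l2 where l: "l1 \<in> PC" "l2 \<in> zspan (coroot ` sub_roots R (\<Inter>\<J>))" "\<kappa> = l1 + l2"
      unfolding modJ_def by blast
    let ?\<nu> = "nu (\<Inter>\<J>)"
    have JD: "\<Inter>\<J> \<subseteq> \<Delta>" using Js by blast
    have l2: "- l2 \<in> CW" "- l2 \<in> zspan (coroot ` sub_roots R (\<Inter>\<J>))"
      using zspan_sub_CW zspan_uminus l(2) by blast+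
    have t: "aff id (- l2) \<in> rgen (JR ?\<nu>)" using transl_rgen[OF JD l2(2)] .
    have "inv v0 m' + k + - l2 - inv v m - qb_wt R \<Delta> (w \<circ> v) (w' \<circ> v0) = l1"
      using l(3) by (simp add: \<kappa>_def algebra_simps)
    then have "sle (aff (w \<circ> v) (inv v m)) (aff (w' \<circ> v0) (inv v0 m' + k + - l2))"
      using sle_iff_wt[OF wv wv0 iv CW_add[OF n0 l2(1)]] l(1) by simp
    then have le: "sle (aff w m \<circ> aff v 0) (aff w' m' \<circ> z0 \<circ> aff id (- l2))"
      by (simp only: vk(1) aff_comp[OF vk(2)] aff_comp[OF W(3)] aff_transl add_0_right)
    show ?L
    proof (rule ble_of_sle_mod[OF xG z0(1,2) nu_CW nu_Pos t le])
      fix e assume e: "e \<in> AR" "?\<nu> \<bullet> fst (inv (aff v 0) e) \<le> 0" "lev e > 0"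
      have "inv (aff v 0) e = aff (inv v) 0 e"
      proof -
        have "aff v 0 (aff (inv v) 0 e) = e" by (simp add: aff_def W_inv_r[OF W(3)])
        then show ?thesis using G_inv_l[OF xG(3)] by metis
      qed
      then have fe: "?\<nu> \<bullet> inv v (fst e) \<le> 0" using e(2) by (simp add: aff_def)
      define \<gamma> where "\<gamma> = inv v (fst e)"
      have eR: "fst e \<in> R" using e by (auto simp: AR_def)
      have gR: "\<gamma> \<in> R" unfolding \<gamma>_def using W_R W_inv_ex W eR by blast
      have vg: "v \<gamma> = fst e" by (simp add: \<gamma>_def W_inv_r[OF W(3)])
      have wR: "w (fst e) \<in> R" using W_R W eR by blast
      obtain k where k: "snd e = of_int k" using e(1) by (auto simp: AR_def elim: Ints_cases)
      have ki: "k \<ge> ng (fst e)" using lev_pos_ng[OF eR, of k] e(3) k by (metis prod.collapse)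
      obtain i where i: "m \<bullet> fst e = of_int i" using m(1) eR by (auto simp: CW_def elim!: Ints_cases)
      \<comment> \<open>If \<open>\<gamma>\<close> is positive, \<open>fe\<close> forces it into the
        subsystem, where the length functional vanishes. If it is negative, the inequality for
        \<open>- \<gamma>\<close> applies, with all signs reversed.\<close>
      have key: "- i \<ge> ng (w (fst e)) - ng (fst e)"
      proof (cases "\<gamma> \<in> Pos")
        case True
        then have "?\<nu> \<bullet> \<gamma> = 0" using fe nu_Pos[OF True] by (simp add: \<gamma>_def order_antisym)
        then have "\<gamma> \<in> sub_roots R (\<Inter>\<J>)" using nu_span[OF JD gR] gR by (simp add: sub_roots_def)
        from LZ[OF this] show ?thesis unfolding vg i by linarith
      next
        case False
        then have "- \<gamma> \<in> Pos" using gR Pos_uminus by blast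
        from LP[OF this] have "- of_int i + of_int (ng (- w (fst e))) - real_of_int (ng (- fst e)) \<ge> 0"
          by (simp add: W_uminus[OF W(3)] W_uminus[OF W(1)] vg i)
        moreover have "ng (- w (fst e)) = 1 - ng (w (fst e))" "ng (- fst e) = 1 - ng (fst e)"
          using Pos_uminus[OF wR] Pos_uminus[OF eR] by (auto simp: ng_def)
        ultimately show ?thesis by linarith
      qed
      have "aff w m e = (w (fst e), of_int (k - i))" by (simp add: aff_def k i)
      then show "lev (aff w m e) > 0" using lev_pos_ng[OF wR, of "k - i"] key ki by simp
    qed
  }
qed

end

section \<open>The cocharacter datum\<close>

text \<open>The base point \<open>\<mu>\<close> is a parameter because Bruhat steps and the action
  of \<open>W\<close> stay within \<open>\<mu> + emb Q\<close>. A second base point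
  \<open>\<mu>'\<close> is used to see that \<open>W\<close> moves \<open>\<mu>'\<close> within its
  own coset.\<close>

locale cochar_base = root_datum R \<Delta>
  for R \<Delta> :: "'a::euclidean_space set" +
  fixes emb :: "'a \<Rightarrow> 'x::ab_group_add" and pair :: "'x \<Rightarrow> 'a \<Rightarrow> int" and \<mu> :: 'x
  assumes cd: "cochar_datum R emb pair"
begin

abbreviation "Q \<equiv> zspan (coroot ` R)"

lemma emb_add: "l \<in> Q \<Longrightarrow> l' \<in> Q \<Longrightarrow> emb (l + l') = emb l + emb l'"
  and emb_inj: "inj_on emb Q"
  and pair_add_left: "\<beta> \<in> zspan R \<Longrightarrow> pair (\<nu> + \<nu>') \<beta> = pair \<nu> \<beta> + pair \<nu>' \<beta>"
  and pair_add_right: "\<beta> \<in> zspan R \<Longrightarrow> \<gamma> \<in> zspan R \<Longrightarrow> pair \<nu> (\<beta> + \<gamma>) = pair \<nu> \<beta> + pair \<nu> \<gamma>"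
  and pair_emb: "l \<in> Q \<Longrightarrow> \<beta> \<in> zspan R \<Longrightarrow> real_of_int (pair (emb l) \<beta>) = l \<bullet> \<beta>"
  using cd unfolding cochar_datum_def by blast+

lemma emb_zero: "emb 0 = 0"
  using emb_add[OF zspan_zero zspan_zero] by simp

lemma emb_uminus: "l \<in> Q \<Longrightarrow> emb (- l) = - emb l"
  using emb_add[of l "- l"] zspan_uminus[of l "coroot ` R"] emb_zero by (simp add: eq_neg_iff_add_eq_0 add.commute)

lemma emb_diff: "l \<in> Q \<Longrightarrow> l' \<in> Q \<Longrightarrow> emb (l - l') = emb l - emb l'"
  using emb_add[of l "- l'"] zspan_uminus[of l' "coroot ` R"] emb_uminus by simp

lemma pair_zero: "pair \<nu> 0 = 0"
  using pair_add_right[OF zspan_zero zspan_zero] by simp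

lemma pair_uminus: "\<beta> \<in> zspan R \<Longrightarrow> pair \<nu> (- \<beta>) = - pair \<nu> \<beta>"
  using pair_add_right[of \<beta> "- \<beta>"] zspan_uminus[of \<beta> R] pair_zero by (simp add: eq_neg_iff_add_eq_0 add.commute)

lemma pair_int: assumes "\<beta> \<in> zspan R" shows "pair \<nu> (of_int c *\<^sub>R \<beta>) = c * pair \<nu> \<beta>"
proof -
  have n: "pair \<nu> (of_nat n *\<^sub>R \<beta>) = of_nat n * pair \<nu> \<beta>" for n
  proof (induction n)
    case (Suc n)
    have "of_nat n *\<^sub>R \<beta> \<in> zspan R" using zspan_int[OF assms, of "int n"] by simp
    then show ?case using Suc pair_add_right[OF assms, of "of_nat n *\<^sub>R \<beta>" \<nu>]
      by (simp add: algebra_simps)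
  qed (simp add: pair_zero)
  show ?thesis
  proof (cases c rule: int_cases2)
    case (nonpos n)
    have "of_nat n *\<^sub>R \<beta> \<in> zspan R" using zspan_int[OF assms, of "int n"] by simp
    then show ?thesis using nonpos n pair_uminus by simp
  qed (simp add: n)
qed

lemma pair_sum: assumes "\<And>a. a \<in> A \<Longrightarrow> f a \<in> zspan R"
  shows "pair \<nu> (sum f A) = (\<Sum>a\<in>A. pair \<nu> (f a))"
  using assms
proof (induction A rule: infinite_finite_induct)
  case (insert x F)
  then show ?case using pair_add_right[of "f x" "sum f F"] zspan_sum[of F f R] by simp
qed (simp_all add: pair_zero)

text \<open>A vector representing the pairing with the base point \<open>\<mu>\<close>; the coset
  \<open>\<mu> + emb Q\<close> is modelled by \<open>base + Q\<close>.\<close>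

definition base :: 'a where "base = (\<Sum>a\<in>\<Delta>. of_int (pair \<mu> a) *\<^sub>R fd a)"

text \<open>\<open>pair\<close> is additive on the root lattice only, so the passage from simple
  roots to all roots uses their integral coefficients.\<close>

lemma base_inner: assumes "\<beta> \<in> R" shows "base \<bullet> \<beta> = of_int (pair \<mu> \<beta>)"
proof -
  define c where "c a = \<lfloor>fd a \<bullet> \<beta>\<rfloor>" for a
  have c: "fd a \<bullet> \<beta> = of_int (c a)" if "a \<in> \<Delta>" for a
    using root_expand(2)[OF assms that] by (simp add: c_def)
  have Dz: "a \<in> zspan R" if "a \<in> \<Delta>" for a using that DR zspan_base by blast
  have "(\<Sum>a\<in>\<Delta>. of_int (c a) *\<^sub>R a) = \<beta>"
    using root_expand(1)[OF assms] c by simp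
  then have "pair \<mu> \<beta> = pair \<mu> (\<Sum>a\<in>\<Delta>. of_int (c a) *\<^sub>R a)" by simp
  also have "\<dots> = (\<Sum>a\<in>\<Delta>. c a * pair \<mu> a)"
    using pair_sum[of \<Delta> "\<lambda>a. of_int (c a) *\<^sub>R a" \<mu>] zspan_int[OF Dz] pair_int[OF Dz] by simp
  finally show ?thesis using c by (simp add: base_def inner_sum_left mult.commute)
qed

lemma base_CW: "base \<in> CW"
  using base_inner by (auto simp: CW_def)

lemma baseQ_CW: "l \<in> Q \<Longrightarrow> base + l \<in> CW"
  by (intro CW_add base_CW CW_zspan)

lemma pair_baseQ: "l \<in> Q \<Longrightarrow> \<beta> \<in> R \<Longrightarrow> real_of_int (pair (\<mu> + emb l) \<beta>) = (base + l) \<bullet> \<beta>"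
  using pair_add_left[OF zspan_base] pair_emb[OF _ zspan_base] by (simp add: base_inner inner_add_left)

lemma refl_baseQ: assumes "l \<in> Q" "\<alpha> \<in> R" shows "refl \<alpha> (base + l) - base \<in> Q"
proof -
  have "refl \<alpha> (base + l) - base = l - of_int (pair (\<mu> + emb l) \<alpha>) *\<^sub>R coroot \<alpha>"
    by (simp add: refl_coroot' pair_baseQ[OF assms])
  then show ?thesis using assms by (simp add: zspan_minus zspan_int zspan_base)
qed

lemma xrefl_baseQ: assumes "l \<in> Q" "\<alpha> \<in> R"
  shows "xrefl emb pair \<alpha> (\<mu> + emb l) = \<mu> + emb (refl \<alpha> (base + l) - base)"
proof -
  let ?k = "pair (\<mu> + emb l) \<alpha>"
  have "of_int ?k *\<^sub>R coroot \<alpha> \<in> Q" using assms by (intro zspan_int zspan_base) auto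
  moreover have "refl \<alpha> (base + l) - base = l - of_int ?k *\<^sub>R coroot \<alpha>"
    by (simp add: refl_coroot' pair_baseQ[OF assms])
  ultimately show ?thesis using emb_diff[OF assms(1)] by (simp add: xrefl_def)
qed

lemma foldr_xrefl:
  assumes "set as \<subseteq> R" "l \<in> Q"
  shows "rword as (base + l) - base \<in> Q \<and>
    foldr (xrefl emb pair) as (\<mu> + emb l) = \<mu> + emb (rword as (base + l) - base)"
  using assms
proof (induction as)
  case (Cons \<alpha> as)
  define l1 where "l1 = rword as (base + l) - base"
  have l1: "l1 \<in> Q" "foldr (xrefl emb pair) as (\<mu> + emb l) = \<mu> + emb l1"
    using Cons by (auto simp: l1_def)
  have e: "rword (\<alpha> # as) (base + l) = refl \<alpha> (base + l1)" by (simp add: l1_def)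
  have a: "\<alpha> \<in> R" using Cons by simp
  show ?case unfolding e using refl_baseQ[OF l1(1) a] xrefl_baseQ[OF l1(1) a] by (simp add: l1(2))
qed simp

text \<open>\<open>xact\<close> selects some word for \<open>w\<close>, but
  \<open>foldr_xrefl\<close> gives the same value for all such words.\<close>

lemma xact_baseQ: assumes "w \<in> W" "l \<in> Q"
  shows "w (base + l) - base \<in> Q" "xact R emb pair w (\<mu> + emb l) = \<mu> + emb (w (base + l) - base)"
proof -
  have "\<exists>as. set as \<subseteq> R \<and> w = rword as" using weyl_rword[OF assms(1)] .
  then have "set (SOME as. set as \<subseteq> R \<and> w = rword as) \<subseteq> R \<and> w = rword (SOME as. set as \<subseteq> R \<and> w = rword as)"
    by (rule someI_ex)
  from foldr_xrefl[OF conjunct1[OF this] assms(2)] conjunct2[OF this]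
  show "w (base + l) - base \<in> Q" "xact R emb pair w (\<mu> + emb l) = \<mu> + emb (w (base + l) - base)"
    unfolding xact_def by metis+
qed

lemma af_pos_lev: assumes "\<beta> \<in> R" shows "af_pos R \<Delta> (\<beta>, k) \<longleftrightarrow> lev (\<beta>, of_int k) > 0"
  using assms by (simp add: af_pos_def ind_pos_def lev_pos_iff Pos_uminus)

lemma af_len_N: assumes "w \<in> W" "l \<in> Q"
  shows "af_len R \<Delta> pair (w, \<mu> + emb l) = card (N (aff w (base + l)))"
  unfolding af_len_def
proof (rule bij_betw_same_card)
  let ?x = "(w, \<mu> + emb l)"
  let ?A = "{a \<in> R \<times> UNIV. af_pos R \<Delta> a \<and> \<not> af_pos R \<Delta> (af_act pair ?x a)}"
  let ?f = "\<lambda>a::'a \<times> int. (fst a, real_of_int (snd a))"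
  have G: "aff w (base + l) \<in> G" using assms baseQ_CW by (intro aff_G)
  have iff: "a \<in> ?A \<longleftrightarrow> ?f a \<in> N (aff w (base + l))" if aR: "fst a \<in> R" for a
  proof -
    obtain \<alpha> k where a: "a = (\<alpha>, k)" "\<alpha> \<in> R" using aR by (metis prod.collapse)
    have "aff w (base + l) (?f a) = (w \<alpha>, of_int (k - pair (\<mu> + emb l) \<alpha>))"
      by (simp add: a aff_def pair_baseQ[OF assms(2) a(2)])
    moreover have "w \<alpha> \<in> R" using W_R assms a by blast
    moreover have "?f a \<in> AR" using a by (simp add: AR_def)
    moreover have "aff w (base + l) (?f a) \<in> AR" using G_AR[OF G] calculation(3) .
    ultimately show ?thesis using a
      by (simp add: N_def af_act_def af_pos_lev lev_neg_iff[symmetric] del: of_int_diff)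
  qed
  show "bij_betw ?f ?A (N (aff w (base + l)))"
  proof (rule bij_betw_imageI)
    show "inj_on ?f ?A" by (rule inj_onI) (auto simp: prod_eq_iff)
    show "?f ` ?A = N (aff w (base + l))"
    proof
      show "?f ` ?A \<subseteq> N (aff w (base + l))" using iff by fastforce
      show "N (aff w (base + l)) \<subseteq> ?f ` ?A"
      proof
        fix b assume b: "b \<in> N (aff w (base + l))"
        then obtain k where k: "fst b \<in> R" "snd b = of_int k" using N_D(1) by (force simp: AR_def elim: Ints_cases)
        then have e: "b = ?f (fst b, k)" by (simp add: prod_eq_iff)
        have "(fst b, k) \<in> ?A \<longleftrightarrow> ?f (fst b, k) \<in> N (aff w (base + l))" by (rule iff) (simp add: k)
        with b e have "(fst b, k) \<in> ?A" by metis
        then show "b \<in> ?f ` ?A" using e by (intro image_eqI[of b ?f "(fst b, k)"])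
      qed
    qed
  qed
qed

lemma af_refl_mult: assumes "w \<in> W" "l \<in> Q" "\<alpha> \<in> R"
  shows "\<exists>l1\<in>Q. eaw_mult R emb pair (w, \<mu> + emb l) (af_refl emb (\<alpha>, k)) = (w \<circ> refl \<alpha>, \<mu> + emb l1) \<and>
    aff w (base + l) \<circ> arefl (\<alpha>, of_int k) = aff (w \<circ> refl \<alpha>) (base + l1)"
proof -
  let ?c = "of_int k *\<^sub>R coroot \<alpha>"
  have c: "?c \<in> Q" using assms by (intro zspan_int zspan_base) auto
  note xa = xact_baseQ[OF W_refl[OF assms(3)] assms(2)]
  let ?l = "refl \<alpha> (base + l) - base + ?c"
  have "?l \<in> Q" using zspan_plus[OF xa(1) c] .
  moreover have "eaw_mult R emb pair (w, \<mu> + emb l) (af_refl emb (\<alpha>, k)) = (w \<circ> refl \<alpha>, \<mu> + emb ?l)"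
    using xa(2) emb_add[OF xa(1) c] by (simp add: eaw_mult_def af_refl_def inv_refl add.assoc)
  moreover have "aff w (base + l) \<circ> arefl (\<alpha>, of_int k) = aff (w \<circ> refl \<alpha>) (base + ?l)"
    unfolding aff_arefl[OF assms(3)] by (simp add: refl_coroot' algebra_simps)
  ultimately show ?thesis by blast
qed

lemma bruhat_step_iff: assumes w: "w \<in> W" and l: "l \<in> Q"
  shows "bruhat_step R \<Delta> emb pair (w, \<mu> + emb l) y \<longleftrightarrow>
    (\<exists>w1\<in>W. \<exists>l1\<in>Q. y = (w1, \<mu> + emb l1) \<and> bstep (aff w (base + l)) (aff w1 (base + l1)))"
proof -
  have G: "aff w (base + l) \<in> G" using w l baseQ_CW by (intro aff_G)
  show ?thesis
  proof
    assume "bruhat_step R \<Delta> emb pair (w, \<mu> + emb l) y"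
    then obtain \<alpha> k where a: "\<alpha> \<in> R" "y = eaw_mult R emb pair (w, \<mu> + emb l) (af_refl emb (\<alpha>, k))"
      "af_len R \<Delta> pair (w, \<mu> + emb l) < af_len R \<Delta> pair y" unfolding bruhat_step_def by auto
    obtain l1 where l1: "l1 \<in> Q" "y = (w \<circ> refl \<alpha>, \<mu> + emb l1)"
      "aff w (base + l) \<circ> arefl (\<alpha>, of_int k) = aff (w \<circ> refl \<alpha>) (base + l1)"
      using af_refl_mult[OF w l a(1), of k] a(2) by auto
    have w1: "w \<circ> refl \<alpha> \<in> W" using w a by (intro W_comp W_refl)
    have "card (N (aff w (base + l))) < card (N (aff (w \<circ> refl \<alpha>) (base + l1)))"
      using a(3) af_len_N[OF w l] af_len_N[OF w1 l1(1)] l1(2) by simp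
    moreover have "(\<alpha>, of_int k) \<in> AR" using a by (simp add: AR_def)
    ultimately have "bstep (aff w (base + l)) (aff (w \<circ> refl \<alpha>) (base + l1))"
      unfolding bstep_iff_card[OF G] using l1(3) by metis
    then show "\<exists>w1\<in>W. \<exists>l1\<in>Q. y = (w1, \<mu> + emb l1) \<and> bstep (aff w (base + l)) (aff w1 (base + l1))"
      using w1 l1 by blast
  next
    assume "\<exists>w1\<in>W. \<exists>l1\<in>Q. y = (w1, \<mu> + emb l1) \<and> bstep (aff w (base + l)) (aff w1 (base + l1))"
    then obtain w1 l1 where y: "w1 \<in> W" "l1 \<in> Q" "y = (w1, \<mu> + emb l1)"
      and s: "bstep (aff w (base + l)) (aff w1 (base + l1))" by blast
    from s obtain a where a: "a \<in> AR" "aff w1 (base + l1) = aff w (base + l) \<circ> arefl a"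
      "card (N (aff w (base + l))) < card (N (aff w1 (base + l1)))" unfolding bstep_iff_card[OF G] by blast
    obtain k where k: "fst a \<in> R" "a = (fst a, of_int k)" using a(1) by (auto simp: AR_def elim!: Ints_cases)
    obtain l2 where l2: "l2 \<in> Q" "eaw_mult R emb pair (w, \<mu> + emb l) (af_refl emb (fst a, k)) = (w \<circ> refl (fst a), \<mu> + emb l2)"
      "aff w (base + l) \<circ> arefl (fst a, of_int k) = aff (w \<circ> refl (fst a)) (base + l2)"
      using af_refl_mult[OF w l k(1), of k] by blast
    have e: "aff w1 (base + l1) = aff (w \<circ> refl (fst a)) (base + l2)"
      using a(2) k(2) l2(3) by metis
    have "w1 = w \<circ> refl (fst a)" "l1 = l2" using aff_inj[OF e] by simp_all
    then have "y = eaw_mult R emb pair (w, \<mu> + emb l) (af_refl emb (fst a, k))" using y l2 by simp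
    moreover have "af_len R \<Delta> pair (w, \<mu> + emb l) < af_len R \<Delta> pair y"
      using a(3) af_len_N[OF w l] af_len_N[OF y(1,2)] y(3) by simp
    ultimately show "bruhat_step R \<Delta> emb pair (w, \<mu> + emb l) y"
      unfolding bruhat_step_def using w k by (intro conjI bexI[of _ "(fst a, k)"]) auto
  qed
qed

lemma bruhat_le_iff: assumes w: "w \<in> W" and l: "l \<in> Q"
  shows "bruhat_le R \<Delta> emb pair (w, \<mu> + emb l) y \<longleftrightarrow>
    (\<exists>w1\<in>W. \<exists>l1\<in>Q. y = (w1, \<mu> + emb l1) \<and> ble (aff w (base + l)) (aff w1 (base + l1)))"
proof
  assume "bruhat_le R \<Delta> emb pair (w, \<mu> + emb l) y"
  then show "\<exists>w1\<in>W. \<exists>l1\<in>Q. y = (w1, \<mu> + emb l1) \<and> ble (aff w (base + l)) (aff w1 (base + l1))"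
    unfolding bruhat_le_def
  proof (induction rule: rtranclp_induct)
    case base
    then show ?case using w l ble_refl by blast
  next
    case (step y z)
    then obtain w1 l1 where y: "w1 \<in> W" "l1 \<in> Q" "y = (w1, \<mu> + emb l1)"
      "ble (aff w (base + l)) (aff w1 (base + l1))" by blast
    from step(2) bruhat_step_iff[OF y(1,2)] y(3) obtain w2 l2 where "w2 \<in> W" "l2 \<in> Q" "z = (w2, \<mu> + emb l2)"
      "bstep (aff w1 (base + l1)) (aff w2 (base + l2))" by blast
    then show ?case using y ble_trans bstep_ble by blast
  qed
next
  assume "\<exists>w1\<in>W. \<exists>l1\<in>Q. y = (w1, \<mu> + emb l1) \<and> ble (aff w (base + l)) (aff w1 (base + l1))"
  then obtain w1 l1 where y: "w1 \<in> W" "l1 \<in> Q" "y = (w1, \<mu> + emb l1)"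
    and b: "ble (aff w (base + l)) (aff w1 (base + l1))" by blast
  \<comment> \<open>Intermediate elements of the chain are only known to be affine maps; the
    induction also shows that their translation parts lie in \<open>base + Q\<close>.\<close>
  have "\<exists>w2\<in>W. \<exists>l2\<in>Q. z = aff w2 (base + l2) \<and> bruhat_le R \<Delta> emb pair (w, \<mu> + emb l) (w2, \<mu> + emb l2)"
    if "ble (aff w (base + l)) z" for z
    using that unfolding ble_def
  proof (induction rule: rtranclp_induct)
    case base
    then show ?case using w l unfolding bruhat_le_def by blast
  next
    case (step y z)
    then obtain w2 l2 where y: "w2 \<in> W" "l2 \<in> Q" "y = aff w2 (base + l2)"
      "bruhat_le R \<Delta> emb pair (w, \<mu> + emb l) (w2, \<mu> + emb l2)" by blast
    obtain a where a: "a \<in> AR" "z = y \<circ> arefl a" using step(2) unfolding bstep_def by blast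
    obtain k where k: "fst a \<in> R" "a = (fst a, of_int k)" using a(1) by (auto simp: AR_def elim!: Ints_cases)
    obtain l3 where l3: "l3 \<in> Q" "aff w2 (base + l2) \<circ> arefl (fst a, of_int k) = aff (w2 \<circ> refl (fst a)) (base + l3)"
      using af_refl_mult[OF y(1,2) k(1), of k] by blast
    have z: "z = aff (w2 \<circ> refl (fst a)) (base + l3)" using a(2) y(3) k(2) l3(2) by metis
    have w3: "w2 \<circ> refl (fst a) \<in> W" using y k by (intro W_comp W_refl)
    have "bruhat_step R \<Delta> emb pair (w2, \<mu> + emb l2) (w2 \<circ> refl (fst a), \<mu> + emb l3)"
      unfolding bruhat_step_iff[OF y(1,2)] using step(2) y(3) z w3 l3(1) by blast
    then have "bruhat_le R \<Delta> emb pair (w, \<mu> + emb l) (w2 \<circ> refl (fst a), \<mu> + emb l3)"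
      using y(4) unfolding bruhat_le_def by (rule rtranclp.rtrancl_into_rtrancl[rotated])
    then show ?case using z w3 l3(1) by blast
  qed
  from this[OF b] obtain w2 l2 where "w2 \<in> W" "l2 \<in> Q" and e: "aff w1 (base + l1) = aff w2 (base + l2)"
    and z: "bruhat_le R \<Delta> emb pair (w, \<mu> + emb l) (w2, \<mu> + emb l2)" by blast
  have "w1 = w2" "l1 = l2" using aff_inj[OF e] by simp_all
  then show "bruhat_le R \<Delta> emb pair (w, \<mu> + emb l) y" using z y by simp
qed

lemma PC_Q: "x \<in> PC \<Longrightarrow> x \<in> Q"
  by (rule nspan_sub_zspan) (erule nspan_mono, use Pos_R in blast)

lemma qb_wt_Q: assumes "u \<in> W" "b \<in> W" shows "qb_wt R \<Delta> u b \<in> Q"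
proof -
  have "qb_wt R \<Delta> u b - 0 \<in> PC" using sle_incr'(1)[OF qb_wt_min(2)[OF assms] assms(1) CW_zero] .
  then show ?thesis using PC_Q by simp
qed

lemma modJ_Q: assumes "l1 \<in> PC" "l2 \<in> zspan (coroot ` sub_roots R J)" shows "l1 + l2 \<in> Q"
proof -
  have "l1 \<in> Q" using assms(1) PC_Q by blast
  moreover have "l2 \<in> Q" using assms(2) zspan_mono[of _ "coroot ` sub_roots R J" "coroot ` R"]
    by (auto simp: sub_roots_def)
  ultimately show ?thesis by (rule zspan_plus)
qed

lemma leq_mod_iff: assumes "q \<in> Q" "q' \<in> Q"
  shows "leq_mod R \<Delta> emb J (\<mu> + emb q) (\<mu> + emb q') \<longleftrightarrow> modJ J (q' - q)"
proof -
  have "\<mu> + emb q' - (\<mu> + emb q) = emb (q' - q)" using emb_diff[OF assms(2,1)] by simp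
  moreover have "emb (q' - q) = emb (l1 + l2) \<longleftrightarrow> q' - q = l1 + l2"
    if "l1 \<in> PC" "l2 \<in> zspan (coroot ` sub_roots R J)" for l1 l2
    using inj_on_eq_iff[OF emb_inj] modJ_Q[OF that] zspan_minus[OF assms(2,1)] by blast
  ultimately show ?thesis unfolding leq_mod_def modJ_def by auto
qed

lemma bruhat_le_iff_leq_mod:
  assumes w: "w \<in> W" and w': "w' \<in> W" and v: "bruhat_deciding R \<Delta> pair (w, \<mu>) v Js"
  shows "bruhat_le R \<Delta> emb pair (w, \<mu>) (w', \<mu>') \<longleftrightarrow>
    (\<forall>J\<in>set Js. \<exists>v'\<in>W. leq_mod R \<Delta> emb J
         (xact R emb pair (inv v) \<mu> + emb (qb_wt R \<Delta> v' v) + emb (qb_wt R \<Delta> (w \<circ> v) (w' \<circ> v')))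
         (xact R emb pair (inv v') \<mu>'))" 
    (is "?L \<longleftrightarrow> ?R" is "_ \<longleftrightarrow> (\<forall>J\<in>_. \<exists>v'\<in>_. leq_mod _ _ _ J (?a v') (?b v'))")
proof -
  have Js: "set Js \<noteq> {}" "\<And>J. J \<in> set Js \<Longrightarrow> J \<subseteq> \<Delta>" and vW: "v \<in> W"
    and LP: "\<And>\<alpha>. \<alpha> \<in> Pos \<Longrightarrow> len_fun R \<Delta> pair (w, \<mu>) (v \<alpha>) \<ge> 0"
    and LZ: "\<And>\<alpha>. \<alpha> \<in> sub_roots R (\<Inter>(set Js)) \<Longrightarrow> len_fun R \<Delta> pair (w, \<mu>) (v \<alpha>) = 0"
    using v by (auto simp: bruhat_deciding_def LP_def)
  have mu0: "\<mu> + emb 0 = \<mu>" by (simp add: emb_zero)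
  have zQ: "0 \<in> Q" by (rule zspan_zero)
  have lf: "base \<bullet> v \<alpha> + of_int (ng (w (v \<alpha>))) - of_int (ng (v \<alpha>)) = of_int (len_fun R \<Delta> pair (w, \<mu>) (v \<alpha>))"
    if "\<alpha> \<in> R" for \<alpha>
    using base_inner[OF W_R[OF vW that]] by (simp add: len_fun_def ng_def ind_pos_def)
  have iv: "inv v \<in> W" using W_inv_ex vW by blast
  have xv: "inv v base - base \<in> Q" "xact R emb pair (inv v) \<mu> = \<mu> + emb (inv v base - base)"
    using xact_baseQ[OF iv zQ] by (simp_all add: emb_zero)
  have lhs: "\<exists>q\<in>Q. q = inv v base - base + qb_wt R \<Delta> v' v + qb_wt R \<Delta> (w \<circ> v) (w' \<circ> v') \<and>
     ?a v' = \<mu> + emb q"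
    if v': "v' \<in> W" for v'
  proof -
    have q1: "qb_wt R \<Delta> v' v \<in> Q" using qb_wt_Q v' vW by blast
    have q2: "qb_wt R \<Delta> (w \<circ> v) (w' \<circ> v') \<in> Q" using qb_wt_Q W_comp w w' v' vW by blast
    show ?thesis
      using zspan_plus[OF zspan_plus[OF xv(1) q1] q2] emb_add[OF zspan_plus[OF xv(1) q1] q2] emb_add[OF xv(1) q1]
      by (simp add: xv(2) add.assoc)
  qed
  have main: "ble (aff w base) (aff w' (base + l)) \<longleftrightarrow> ?R" if l: "l \<in> Q" and m': "\<mu>' = \<mu> + emb l" for l
  proof -
    have "leq_mod R \<Delta> emb J (?a v') (?b v') \<longleftrightarrow>
       modJ J (inv v' (base + l) - (inv v base + qb_wt R \<Delta> v' v + qb_wt R \<Delta> (w \<circ> v) (w' \<circ> v')))"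
      if v': "v' \<in> W" for v' J
    proof -
      obtain q where q: "q \<in> Q" "q = inv v base - base + qb_wt R \<Delta> v' v + qb_wt R \<Delta> (w \<circ> v) (w' \<circ> v')"
        "?a v' = \<mu> + emb q"
        using lhs[OF v'] by blast
      have iv': "inv v' \<in> W" using W_inv_ex v' by blast
      note xv' = xact_baseQ[OF iv' l]
      have "inv v' (base + l) - base - q = inv v' (base + l) - (inv v base + qb_wt R \<Delta> v' v + qb_wt R \<Delta> (w \<circ> v) (w' \<circ> v'))"
        unfolding q(2) by simp
      then show ?thesis unfolding m' q(3) xv'(2) leq_mod_iff[OF q(1) xv'(1)] by (rule arg_cong)
    qed
    then show ?thesis
      using ble_iff_modJ[OF w w' vW base_CW baseQ_CW[OF l] Js] LP LZ lf Pos_R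
      by (simp add: sub_roots_def)
  qed
  show ?thesis
  proof
    assume ?L
    then obtain l where "l \<in> Q" "\<mu>' = \<mu> + emb l" "ble (aff w base) (aff w' (base + l))"
      using bruhat_le_iff[OF w zQ, of "(w', \<mu>')"] by (auto simp: emb_zero)
    then show ?R using main by blast
  next
    assume R: ?R
    \<comment> \<open>At this point \<open>\<mu>'\<close> need not lie in the coset of
      \<open>\<mu>\<close>; the condition for a single \<open>J\<close> shows that it does, and
      \<open>Js\<close> is nonempty.\<close>
    obtain J where J: "J \<in> set Js" using Js(1) by (meson ex_in_conv)
    with R obtain v' where v': "v' \<in> W" and lm: "leq_mod R \<Delta> emb J (?a v') (?b v')" by blast
    obtain q where q: "q \<in> Q"
      "?a v' = \<mu> + emb q"
      using lhs[OF v'] by blast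
    from lm obtain l1 l2 where l12: "l1 \<in> PC" "l2 \<in> zspan (coroot ` sub_roots R J)"
      "xact R emb pair (inv v') \<mu>' - (\<mu> + emb q) = emb (l1 + l2)" unfolding leq_mod_def q(2) by blast
    then have x1: "xact R emb pair (inv v') \<mu>' = \<mu> + emb (q + (l1 + l2))"
      using emb_add[OF q(1) modJ_Q[OF l12(1,2)]] by (simp add: algebra_simps)
    have "\<exists>l\<in>Q. xact R emb pair (inv v') \<mu>' = \<mu>' + emb l"
    proof -
      interpret b': cochar_base R \<Delta> emb pair \<mu>' by unfold_locales (rule cd)
      have "inv v' \<in> W" using W_inv_ex v' by blast
      from b'.xact_baseQ[OF this zQ] show ?thesis by (auto simp: emb_zero)
    qed
    then obtain l where l: "l \<in> Q" "xact R emb pair (inv v') \<mu>' = \<mu>' + emb l" by blast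
    have qQ: "q + (l1 + l2) \<in> Q" using zspan_plus q(1) modJ_Q[OF l12(1,2)] by blast
    have "\<mu>' = \<mu> + emb (q + (l1 + l2) - l)"
      using x1 unfolding l(2) emb_diff[OF qQ l(1)] by (metis add_diff_cancel_right' add_diff_eq)
    moreover have "q + (l1 + l2) - l \<in> Q" using qQ l(1) zspan_minus by blast
    ultimately show ?L
      using main R bruhat_le_iff[OF w zQ, of "(w', \<mu>')"] w' by (auto simp: emb_zero)
  qed
qed

end

theorem theorem4p2:
  fixes R \<Delta> :: "'a::euclidean_space set"
    and emb :: "'a \<Rightarrow> 'x::ab_group_add" and pair :: "'x \<Rightarrow> 'a \<Rightarrow> int"
    and w w' v :: "'a \<Rightarrow> 'a" and \<mu> \<mu>' :: 'x and Js :: "'a set list"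
  assumes "root_system R" and "root_basis R \<Delta>" and "cochar_datum R emb pair"
    and "w \<in> weyl R" and "w' \<in> weyl R"
    and "bruhat_deciding R \<Delta> pair (w, \<mu>) v Js"
  shows "bruhat_le R \<Delta> emb pair (w, \<mu>) (w', \<mu>') \<longleftrightarrow>
    (\<forall>J\<in>set Js. \<exists>v'\<in>weyl R.
       leq_mod R \<Delta> emb J
         (xact R emb pair (inv v) \<mu> + emb (qb_wt R \<Delta> v' v) + emb (qb_wt R \<Delta> (w \<circ> v) (w' \<circ> v')))
         (xact R emb pair (inv v') \<mu>'))"
proof -
  interpret cochar_base R \<Delta> emb pair \<mu> by unfold_locales (use assms in auto)
  show ?thesis using bruhat_le_iff_leq_mod assms(4-6) .
qed

end
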